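(* Let $d\ge 2$, $\alpha\in(0,2)$ and $K_1,K_2>0$, and suppose that the locally bounded potential $V:\mathbb R^d\to\mathbb R$ satisfies $$K_1(1+|x|)^{-\alpha}\le V(x)\le K_2(1+|x|)^{-\alpha},\qquad x\in\mathbb R^d.$$ Then there exist positive constants $C_1,C_2,C_3,C_4$ such that for all $x,y\in\mathbb R^d$ and $t>0$, $$C_1t^{-d/2}\exp\left(-C_2\left[\frac{|x-y|^2}{t}+\Phi(t,x,y)\right]\right)\le p(t,x,y)\le C_3t^{-d/2}\exp\left(-C_4\left[\frac{|x-y|^2}{t}+\Phi(t,x,y)\right]\right),$$ where $$\Phi(t,x,y):=\min\left\{\frac{t}{(1+\max\{|x|,|y|\})^{\alpha}},\ t^{(2-\alpha)/(2+\alpha)}\right\}.$$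
   Context: Let $V:\mathbb R^d\to\mathbb R$ be (measurable,) locally bounded and bounded from below, and let $\mathcal L^V=-\frac12\Delta+V$ on $\mathbb R^d$. Let $\{B_t\}_{t\ge0}$ be the standard $\mathbb R^d$-valued Brownian motion and $\mathbb E_x$ the expectation when it starts at $x$. The Schrödinger semigroup of $\mathcal L^V$ is given by the Feynman-Kac formula $T_t^Vf(x)=\mathbb E_x\left[f(B_t)\exp\left(-\int_0^tV(B_s)\,ds\right)\right]$, $f\in C_b(\mathbb R^d)$. The heat kernel $p(t,x,y)$ is its jointly continuous density with respect to Lebesgue measure: $T_t^Vf(x)=\int_{\mathbb R^d}p(t,x,y)f(y)\,dy$ for $f\in C_b(\mathbb R^d)$, $t>0$, $x\in\mathbb R^d$. *)

theory Defs
  imports "HOL-Probability.Probability"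
begin

text \<open>Standard Brownian motion in a Euclidean space, started at \<open>x\<close>, with time set \<open>{0..}\<close>.
  The increments over \<open>[s, t]\<close> have law \<open>N(0, (t - s) I)\<close>, so the generator is half the
  Laplacian. Paths are continuous for every outcome, not just almost surely; as \<open>M\<close> need not
  be complete, this is what makes path functionals such as \<open>\<integral>\<^sub>0\<^sup>t V(B\<^sub>s) ds\<close> measurable.
  The starting point is prescribed only almost surely, so that one process \<open>B\<close> on one sample
  space (e.g. the coordinate process on path space) can start at different points under
  different measures.\<close>

definition brownian_motion_from ::
  "'a::euclidean_space \<Rightarrow> 'w measure \<Rightarrow> (real \<Rightarrow> 'w \<Rightarrow> 'a) \<Rightarrow> bool" where
  "brownian_motion_from x M B \<longleftrightarrow>
     prob_space M \<and>
     (\<forall>t\<ge>0. B t \<in> borel_measurable M) \<and>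
     (AE \<omega> in M. B 0 \<omega> = x) \<and>
     (\<forall>\<omega>\<in>space M. continuous_on {0..} (\<lambda>t. B t \<omega>)) \<and>
     (\<forall>s t. 0 \<le> s \<and> s < t \<longrightarrow>
        distributed M lborel (\<lambda>\<omega>. B t \<omega> - B s \<omega>)
          (\<lambda>z. ennreal (\<Prod>b\<in>Basis. normal_density 0 (sqrt (t - s)) (z \<bullet> b)))) \<and>
     (\<forall>(\<tau> :: nat \<Rightarrow> real) n. 0 \<le> \<tau> 0 \<and> mono \<tau> \<longrightarrow>
        prob_space.indep_vars M (\<lambda>_. borel)
          (\<lambda>i \<omega>. B (\<tau> (Suc i)) \<omega> - B (\<tau> i) \<omega>) {..<n})"

text \<open>The Feynman--Kac semigroup. \<open>P x\<close> is the probability measure under which the process \<open>B\<close>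
  starts at \<open>x\<close>, so that integration against \<open>P x\<close> is the expectation \<open>E\<^sub>x\<close>.\<close>

definition feynman_kac ::
  "('a::euclidean_space \<Rightarrow> 'w measure) \<Rightarrow> (real \<Rightarrow> 'w \<Rightarrow> 'a) \<Rightarrow> ('a \<Rightarrow> real)
     \<Rightarrow> real \<Rightarrow> ('a \<Rightarrow> real) \<Rightarrow> 'a \<Rightarrow> real" where
  "feynman_kac P B V t f x =
     (\<integral>\<omega>. f (B t \<omega>) * exp (- (LBINT s:{0..t}. V (B s \<omega>))) \<partial>P x)"

definition is_heat_kernel ::
  "('a::euclidean_space \<Rightarrow> 'w measure) \<Rightarrow> (real \<Rightarrow> 'w \<Rightarrow> 'a) \<Rightarrow> ('a \<Rightarrow> real)
     \<Rightarrow> (real \<Rightarrow> 'a \<Rightarrow> 'a \<Rightarrow> real) \<Rightarrow> bool" where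
  "is_heat_kernel P B V p \<longleftrightarrow>
     continuous_on ({0<..} \<times> UNIV \<times> UNIV) (\<lambda>(t, x, y). p t x y) \<and>
     (\<forall>t>0. \<forall>x. \<forall>f\<in>bcontfun.
        has_bochner_integral lborel (\<lambda>y. p t x y * f y) (feynman_kac P B V t f x))"

definition Phi :: "real \<Rightarrow> real \<Rightarrow> 'a::real_normed_vector \<Rightarrow> 'a \<Rightarrow> real" where
  "Phi \<alpha> t x y =
     min (t / (1 + max (norm x) (norm y)) powr \<alpha>) (t powr ((2 - \<alpha>) / (2 + \<alpha>)))"

end

theory Submission
  imports Defs
begin

text \<open>
  Every bound on \<open>p t x y\<close> comes from a bound on the Feynman--Kac integral of a narrow bump
  around \<open>y\<close>, since \<open>p\<close> is continuous (\<open>pointwise_le_from_bumps\<close>). The Feynman--Kac integrals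
  are estimated by convexity of the exponential, which reduces everything to finite-dimensional
  laws of Brownian motion: the mean of a product \<open>h\<^sub>1(B t\<^sub>1) \<cdots> h\<^sub>n(B t\<^sub>n)\<close> is an iterated Gaussian
  integral (\<open>nn_integral_path_weight\<close>). The action of a path is \<open>A = \<integral>\<^sub>0\<^sup>t V(B\<^sub>s) ds\<close>.

  Upper bound. As \<open>V \<ge> 0\<close>, \<open>p\<close> is at most the Gaussian kernel, so it suffices to gain the factor
  \<open>exp (- c * Phi)\<close>. Put \<open>L = max (1 + |x|) (t powr (2 / (2 + \<alpha>)))\<close> and let \<open>\<theta>\<close> be the fraction of
  \<open>[0, t/2]\<close> that the path spends at distance at least \<open>L\<close> from \<open>x\<close>. Then
  \<open>A \<ge> (1 - \<theta>) b\<close> with \<open>b\<close> of order \<open>t * L powr (- \<alpha>)\<close>, and convexity gives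
  \<open>exp (- A) \<le> exp (- b) + \<theta>\<close>; the mean of \<open>\<theta>\<close> is an average of one-time probabilities and is at
  most of order \<open>exp (- L\<^sup>2 / (2 * t))\<close>. Up to constants, \<open>b\<close> and \<open>L\<^sup>2 / t\<close> are at least \<open>Phi\<close>
  (\<open>Feynman_Kac_upper_bound\<close>, \<open>heat_kernel_upper\<close>).

  Lower bound. Let \<open>\<Gamma>\<close> be the indicator that the path visits prescribed balls at prescribed times,
  multiplied by the bump at time \<open>t\<close>. The tangent inequality \<open>exp (- A) \<ge> exp (- a) * (1 + a - A)\<close>
  shows that \<open>E[\<Gamma> A] \<le> a * E[\<Gamma>]\<close> implies \<open>E[\<Gamma> exp (- A)] \<ge> exp (- a) * E[\<Gamma>]\<close>
  (\<open>Feynman_Kac_lower_bound\<close>). Between two visits the path is a Brownian bridge, so \<open>E[\<Gamma> V(B\<^sub>s)]\<close> is controlled by Gaussian means of \<open>V\<close> about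
  points of a segment; these are of order \<open>r powr (- \<alpha>)\<close> when the segment stays at distance of
  order \<open>r\<close> from the origin and the step lasts at most \<open>r powr (1 + \<alpha> / 2)\<close>.

  For \<open>t \<le> 1\<close> the action is bounded. For \<open>t \<ge> 1\<close> let \<open>R = max |x| |y|\<close>. If \<open>|x - y| \<le> R / 2\<close> and
  \<open>t \<le> R powr (1 + \<alpha> / 2)\<close>, the straight line from \<open>x\<close> to \<open>y\<close> suffices (\<open>steerable_direct\<close>).
  Otherwise put \<open>\<rho> = max R (t powr (2 / (2 + \<alpha>)))\<close>; then \<open>\<rho>\<^sup>2 / t\<close> is at most a multiple of
  \<open>|x - y|\<^sup>2 / t + Phi\<close>, and it is enough to find a detour whose cost is of order \<open>\<rho>\<^sup>2 / t\<close>
  (\<open>steerable_detour\<close>). The path moves from \<open>x\<close> to \<open>x + \<rho> e\<close> through the points \<open>x + r e\<close> with dyadic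
  \<open>r / \<rho>\<close>, spending a time proportional to \<open>r powr (1 + \<alpha> / 2)\<close> at height \<open>r\<close>, crosses to \<open>y + \<rho> e\<close>,
  and returns to \<open>y\<close> in the same way. Here \<open>e\<close> is a unit vector with \<open>x \<bullet> e \<ge> 0\<close> and \<open>y \<bullet> e \<ge> 0\<close>,
  which exists in dimension at least two and keeps the path away from the origin. At height \<open>r\<close> the
  displacement and the potential both cost at most a multiple of
  \<open>(\<rho>\<^sup>2 / t) * (r / \<rho>) powr (1 - \<alpha> / 2)\<close>, and these costs form a geometric series. For \<open>\<alpha> > 1\<close> a
  straight exit at constant speed would be too expensive, as it stays near the origin for too long.
\<close>

section \<open>The Gaussian kernel\<close>

definition heat :: "real \<Rightarrow> 'a::euclidean_space \<Rightarrow> real" where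
  "heat \<tau> z = (2 * pi * \<tau>) powr (- real DIM('a) / 2) * exp (- (norm z)\<^sup>2 / (2 * \<tau>))"

lemma heat_nonneg [simp]: "0 \<le> heat \<tau> z"
  by (simp add: heat_def)

lemma heat_measurable [measurable]: "heat \<tau> \<in> borel_measurable borel"
  unfolding heat_def by measurable

lemma heat_continuous: "continuous_on UNIV (heat \<tau>)"
  unfolding heat_def divide_inverse by (intro continuous_intros)

lemma heat_eq_prod_normal_density:
  fixes z :: "'a::euclidean_space"
  assumes "0 < \<tau>"
  shows "heat \<tau> z = (\<Prod>b\<in>Basis. normal_density 0 (sqrt \<tau>) (z \<bullet> b))"
proof -
  have "normal_density 0 (sqrt \<tau>) u = (2 * pi * \<tau>) powr (- 1 / 2) * exp (- u\<^sup>2 / (2 * \<tau>))" for u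
  proof -
    have "(2 * pi * \<tau>) powr (- 1 / 2) = 1 / sqrt (2 * pi * \<tau>)"
      using assms by (simp add: powr_minus_divide powr_half_sqrt)
    then show ?thesis
      using assms by (simp add: normal_density_def)
  qed
  then have "(\<Prod>b\<in>(Basis::'a set). normal_density 0 (sqrt \<tau>) (z \<bullet> b))
      = (\<Prod>b\<in>(Basis::'a set). (2 * pi * \<tau>) powr (- 1 / 2)) * (\<Prod>b\<in>Basis. exp (- (z \<bullet> b)\<^sup>2 / (2 * \<tau>)))"
    by (simp add: prod.distrib)
  also have "(\<Prod>b\<in>(Basis::'a set). (2 * pi * \<tau>) powr (- 1 / 2)) = (2 * pi * \<tau>) powr (- real DIM('a) / 2)"
    using assms by (simp add: powr_powr powr_realpow[symmetric])
  also have "(\<Prod>b\<in>Basis. exp (- (z \<bullet> b)\<^sup>2 / (2 * \<tau>))) = exp (- (norm z)\<^sup>2 / (2 * \<tau>))"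
    by (simp add: exp_sum[symmetric] sum_negf sum_divide_distrib[symmetric] power2_norm_eq_inner euclidean_inner[of z z] power2_eq_square[symmetric])
  finally show ?thesis by (simp add: heat_def)
qed

lemma nn_integral_heat:
  fixes a :: "'a::euclidean_space"
  assumes "0 < \<tau>"
  shows "(\<integral>\<^sup>+z. ennreal (heat \<tau> (z - a)) \<partial>lborel) = 1"
proof -
  have "(\<integral>\<^sup>+z. ennreal (heat \<tau> (z - a)) \<partial>lborel) = (\<integral>\<^sup>+z. ennreal (heat \<tau> (z - a)) \<partial>(distr lborel borel (\<lambda>z. a + z)))"
    by (subst lborel_distr_plus) simp
  also have "\<dots> = (\<integral>\<^sup>+z. ennreal (heat \<tau> (z::'a)) \<partial>lborel)"
    by (subst nn_integral_distr) auto
  also have "\<dots> = (\<integral>\<^sup>+z. (\<Prod>b\<in>(Basis::'a set). ennreal (normal_density 0 (sqrt \<tau>) (z \<bullet> b))) \<partial>lborel)"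
    using assms by (simp add: heat_eq_prod_normal_density prod_ennreal)
  also have "\<dots> = (\<Prod>b\<in>(Basis::'a set). (\<integral>\<^sup>+u. ennreal (normal_density 0 (sqrt \<tau>) u) \<partial>lborel))"
    by (subst nn_integral_lborel_prod) auto
  also have "\<dots> = 1"
    using assms by (simp add: nn_integral_eq_integral integrable_normal_density)
  finally show ?thesis .
qed

lemma heat_le: "0 < \<tau> \<Longrightarrow> heat \<tau> (z::'a::euclidean_space) \<le> (2 * pi * \<tau>) powr (- real DIM('a) / 2)"
  unfolding heat_def by (intro mult_left_le) auto

lemma heat_ge:
  assumes "0 < \<tau>" "norm z \<le> D"
  shows "(2 * pi * \<tau>) powr (- real DIM('a) / 2) * exp (- D\<^sup>2 / (2 * \<tau>)) \<le> heat \<tau> (z::'a::euclidean_space)"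
  unfolding heat_def using assms
  by (intro mult_left_mono) (auto intro!: divide_right_mono power_mono)

text \<open>Completing the square: given its values \<open>z\<close> and \<open>z'\<close> at times \<open>0\<close> and \<open>\<tau>\<close>, Brownian motion at
  time \<open>s\<close> is Gaussian about the point of the segment that is reached at constant speed, with variance at most
  \<open>\<tau>\<close> in every direction.\<close>

lemma heat_mult_heat:
  fixes w z z' :: "'a::euclidean_space"
  assumes "0 < s" "s < \<tau>"
  shows "heat s (w - z) * heat (\<tau> - s) (z' - w)
       = heat \<tau> (z' - z) * heat (s * (\<tau> - s) / \<tau>) (w - (z + (s / \<tau>) *\<^sub>R (z' - z)))"
proof -
  define v where "v = \<tau> - s"
  have v: "v > 0" "\<tau> = s + v" using assms by (auto simp: v_def)
  define a b where "a = w - z" and "b = z' - w"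
  have ab: "z' - z = a + b" "w - (z + (s / \<tau>) *\<^sub>R (z' - z)) = (v / \<tau>) *\<^sub>R a - (s / \<tau>) *\<^sub>R b"
  proof -
    show "z' - z = a + b" by (simp add: a_def b_def)
    have "a = ((s + v) / \<tau>) *\<^sub>R a" using v assms by simp
    then have "a = (s / \<tau>) *\<^sub>R a + (v / \<tau>) *\<^sub>R a"
      by (simp only: add_divide_distrib scaleR_left_distrib)
    then have "a - (s / \<tau>) *\<^sub>R a = (v / \<tau>) *\<^sub>R a"
      by (metis add_diff_cancel_left')
    then have "a - (s / \<tau>) *\<^sub>R (a + b) = (v / \<tau>) *\<^sub>R a - (s / \<tau>) *\<^sub>R b"
      by (simp add: scaleR_right_distrib algebra_simps)
    then show "w - (z + (s / \<tau>) *\<^sub>R (z' - z)) = (v / \<tau>) *\<^sub>R a - (s / \<tau>) *\<^sub>R b"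
      by (simp add: a_def b_def algebra_simps)
  qed
  have pos: "0 < s" "0 < v" "0 < \<tau>" using assms v by auto
  have pow: "(2 * pi * s) powr q * (2 * pi * v) powr q = (2 * pi * \<tau>) powr q * (2 * pi * (s * v / \<tau>)) powr q" for q
  proof -
    have "(2 * pi * s) * (2 * pi * v) = (2 * pi * \<tau>) * (2 * pi * (s * v / \<tau>))"
      using pos by simp
    then show ?thesis
      using pos by (metis powr_mult)
  qed
  have n2: "(norm (a + b))\<^sup>2 = a \<bullet> a + 2 * (a \<bullet> b) + b \<bullet> b"
    by (simp add: power2_norm_eq_inner inner_add_left inner_add_right inner_commute)
  have n3: "(norm ((v / \<tau>) *\<^sub>R a - (s / \<tau>) *\<^sub>R b))\<^sup>2 = (v\<^sup>2 * (a \<bullet> a) - 2 * v * s * (a \<bullet> b) + s\<^sup>2 * (b \<bullet> b)) / \<tau>\<^sup>2"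
    using pos by (simp add: power2_norm_eq_inner inner_diff_left inner_diff_right inner_commute) (simp add: field_simps power2_eq_square)
  have "- (norm a)\<^sup>2 / (2 * s) + - (norm b)\<^sup>2 / (2 * v)
      = - (norm (a + b))\<^sup>2 / (2 * \<tau>) + - (norm ((v / \<tau>) *\<^sub>R a - (s / \<tau>) *\<^sub>R b))\<^sup>2 / (2 * (s * v / \<tau>))"
    unfolding n2 n3 power2_norm_eq_inner[of a] power2_norm_eq_inner[of b]
    unfolding v(2)
    using pos(1,2) by (simp add: divide_simps add_pos_pos) algebra
  then have e: "exp (- (norm a)\<^sup>2 / (2 * s)) * exp (- (norm b)\<^sup>2 / (2 * v))
      = exp (- (norm (a + b))\<^sup>2 / (2 * \<tau>)) * exp (- (norm ((v / \<tau>) *\<^sub>R a - (s / \<tau>) *\<^sub>R b))\<^sup>2 / (2 * (s * v / \<tau>)))"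
    by (simp add: exp_add[symmetric])
  have prods: "(p1 * e1) * (p2 * e2) = (p3 * e3) * (p4 * e4)"
    if "e1 * e2 = e3 * e4" "p1 * p2 = p3 * p4" for p1 p2 p3 p4 e1 e2 e3 e4 :: real
    using arg_cong2[OF that, of times] by (simp add: ac_simps)
  show ?thesis
    unfolding ab(2) unfolding ab(1) heat_def a_def[symmetric] b_def[symmetric] v_def[symmetric]
    by (rule prods[OF e pow])
qed

text \<open>Half of the Gaussian exponent pays for the tail; the other half is the kernel of doubled
  variance, which has mass one.\<close>

lemma nn_integral_heat_tail:
  fixes a :: "'a::euclidean_space"
  assumes "0 < \<tau>" "0 \<le> r"
  shows "(\<integral>\<^sup>+z. ennreal (heat \<tau> (z - a)) * indicator {z. r \<le> norm (z - a)} z \<partial>lborel)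
       \<le> ennreal (2 powr (real DIM('a) / 2) * exp (- r\<^sup>2 / (4 * \<tau>)))"
proof -
  let ?c = "2 powr (real DIM('a) / 2) * exp (- r\<^sup>2 / (4 * \<tau>))"
  have *: "heat \<tau> u \<le> ?c * heat (2 * \<tau>) u" if "r \<le> norm u" for u :: 'a
  proof -
    have p: "(2 * pi * \<tau>) powr (- real DIM('a) / 2) = 2 powr (real DIM('a) / 2) * (2 * pi * (2 * \<tau>)) powr (- real DIM('a) / 2)"
    proof -
      have "2 powr (real DIM('a) / 2) * (2 * (2 * pi * \<tau>)) powr (- real DIM('a) / 2)
          = (2 powr (real DIM('a) / 2) * 2 powr (- real DIM('a) / 2)) * (2 * pi * \<tau>) powr (- real DIM('a) / 2)"
        using assms by (subst powr_mult) auto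
      then show ?thesis by (simp add: powr_add[symmetric] mult.left_commute)
    qed
    have "r\<^sup>2 \<le> (norm u)\<^sup>2" using that assms by (intro power_mono) auto
    then have "- (norm u)\<^sup>2 / (2 * \<tau>) \<le> - r\<^sup>2 / (4 * \<tau>) + - (norm u)\<^sup>2 / (2 * (2 * \<tau>))"
      using assms by (simp add: field_simps)
    then have "exp (- (norm u)\<^sup>2 / (2 * \<tau>)) \<le> exp (- r\<^sup>2 / (4 * \<tau>)) * exp (- (norm u)\<^sup>2 / (2 * (2 * \<tau>)))"
      by (simp add: exp_add[symmetric])
    then have "2 powr (real DIM('a) / 2) * (2 * pi * (2 * \<tau>)) powr (- real DIM('a) / 2) * exp (- (norm u)\<^sup>2 / (2 * \<tau>))
      \<le> 2 powr (real DIM('a) / 2) * (2 * pi * (2 * \<tau>)) powr (- real DIM('a) / 2) * (exp (- r\<^sup>2 / (4 * \<tau>)) * exp (- (norm u)\<^sup>2 / (2 * (2 * \<tau>))))"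
      by (intro mult_left_mono) auto
    then show ?thesis unfolding heat_def p by (simp only: ac_simps)
  qed
  have "(\<integral>\<^sup>+z. ennreal (heat \<tau> (z - a)) * indicator {z. r \<le> norm (z - a)} z \<partial>lborel)
      \<le> (\<integral>\<^sup>+z. ennreal ?c * ennreal (heat (2 * \<tau>) (z - a)) \<partial>lborel)"
    by (intro nn_integral_mono) (use * in \<open>auto simp: indicator_def ennreal_mult[symmetric] intro!: ennreal_leI\<close>)
  also have "\<dots> = ennreal ?c"
    using assms by (subst nn_integral_cmult) (auto simp: nn_integral_heat)
  finally show ?thesis .
qed

section \<open>Finite-dimensional laws of Brownian motion\<close>

text \<open>A list of pairs \<open>(\<tau>, h)\<close> prescribes successive time increments \<open>\<tau>\<close> and, at the end of
  each, a weight \<open>h\<close> on the position. The weights are \<open>ennreal\<close>-valued so that the integrals need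
  no integrability conditions.\<close>

fun chain_integral :: "(real \<times> ('a::euclidean_space \<Rightarrow> ennreal)) list \<Rightarrow> 'a \<Rightarrow> ennreal" where
  "chain_integral [] x = 1"
| "chain_integral ((\<tau>, h) # L) x = (\<integral>\<^sup>+z. ennreal (heat \<tau> (z - x)) * (h z * chain_integral L z) \<partial>lborel)"

fun path_weight :: "(real \<times> ('a::euclidean_space \<Rightarrow> ennreal)) list \<Rightarrow> real \<Rightarrow> (real \<Rightarrow> 'a) \<Rightarrow> ennreal" where
  "path_weight [] t b = 1"
| "path_weight ((\<tau>, h) # L) t b = h (b (t + \<tau>)) * path_weight L (t + \<tau>) b"

definition duration :: "(real \<times> 'b) list \<Rightarrow> real" where
  "duration L = sum_list (map fst L)"

definition admissible :: "(real \<times> ('a::euclidean_space \<Rightarrow> ennreal)) list \<Rightarrow> bool" where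
  "admissible L \<longleftrightarrow> (\<forall>(\<tau>, h)\<in>set L. 0 < \<tau> \<and> h \<in> borel_measurable borel)"

lemma duration_simps [simp]: "duration [] = 0" "duration ((\<tau>, h) # L) = \<tau> + duration L"
  by (simp_all add: duration_def)

lemma duration_append [simp]: "duration (L @ L') = duration L + duration L'"
  by (simp add: duration_def)

lemma admissible_simps [simp]:
  "admissible []"
  "admissible ((\<tau>, h) # L) \<longleftrightarrow> 0 < \<tau> \<and> h \<in> borel_measurable borel \<and> admissible L"
  "admissible (L @ L') \<longleftrightarrow> admissible L \<and> admissible L'"
  by (auto simp: admissible_def)

lemma duration_nonneg: "admissible L \<Longrightarrow> 0 \<le> duration L"
  by (induction L) auto

lemma chain_integral_measurable [measurable (raw)]:
  assumes "\<And>\<tau> h. (\<tau>, h) \<in> set L \<Longrightarrow> h \<in> borel_measurable borel"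
  shows "chain_integral L \<in> borel_measurable borel"
  using assms
proof (induction L)
  case (Cons a L)
  obtain \<tau> h where a: "a = (\<tau>, h)" by (cases a)
  have [measurable]: "chain_integral L \<in> borel_measurable borel" "h \<in> borel_measurable borel"
    using Cons by (auto simp: a)
  have "(\<lambda>x. \<integral>\<^sup>+z. ennreal (heat \<tau> (z - x)) * (h z * chain_integral L z) \<partial>lborel) \<in> borel_measurable borel"
    by measurable
  then show ?case by (simp add: a)
next
  case Nil
  have "chain_integral [] = (\<lambda>x::'a. 1)" by (rule ext) simp
  then show ?case by simp
qed

lemma chain_integral_measurable' [measurable]:
  "admissible L \<Longrightarrow> chain_integral L \<in> borel_measurable borel"
  by (rule chain_integral_measurable) (auto simp: admissible_def)

lemma path_weight_snoc:
  "path_weight (L @ [(\<tau>, h)]) t b = path_weight L t b * h (b (t + (duration L + \<tau>)))"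
  by (induction L arbitrary: t) (auto simp: mult.assoc add.assoc)

lemma path_weight_cong:
  assumes "\<And>i. i < length L \<Longrightarrow> b (t + duration (take (Suc i) L)) = b' (t + duration (take (Suc i) L))"
  shows "path_weight L t b = path_weight L t b'"
  using assms
proof (induction L arbitrary: t)
  case (Cons a L)
  obtain \<tau> h where a: "a = (\<tau>, h)" by (cases a)
  have "b (t + \<tau>) = b' (t + \<tau>)"
    using Cons.prems[of 0] by (simp add: a)
  moreover have "path_weight L (t + \<tau>) b = path_weight L (t + \<tau>) b'"
    using Cons.prems[of "Suc i" for i] by (intro Cons.IH) (auto simp: a add.assoc)
  ultimately show ?case by (simp add: a)
qed simp

lemma path_weight_measurable:
  assumes "admissible L" "0 \<le> t" and X: "\<And>s. 0 \<le> s \<Longrightarrow> (\<lambda>\<omega>. X s \<omega>) \<in> borel_measurable M"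
  shows "(\<lambda>\<omega>. path_weight L t (\<lambda>s. X s \<omega>)) \<in> borel_measurable M"
  using assms(1,2)
proof (induction L arbitrary: t)
  case (Cons a L)
  obtain \<tau> h where a: "a = (\<tau>, h)" by (cases a)
  have [measurable]: "(\<lambda>\<omega>. X (t + \<tau>) \<omega>) \<in> borel_measurable M" "h \<in> borel_measurable borel"
    "(\<lambda>\<omega>. path_weight L (t + \<tau>) (\<lambda>s. X s \<omega>)) \<in> borel_measurable M"
    using Cons X by (auto simp: a)
  show ?case by (simp add: a)
qed simp

text \<open>The last increment is independent of the increments between the earlier knots. The weight of
  the earlier positions is a function of those increments, because it does not change when the
  path is replaced by a step path with the same values at the knots.\<close>

lemma markov_step:
  fixes x :: "'a::euclidean_space"
  assumes bm: "brownian_motion_from x M B" and L: "admissible L" and "0 < \<tau>"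
    and u [measurable]: "u \<in> borel_measurable borel"
  shows "(\<integral>\<^sup>+\<omega>. path_weight L 0 (\<lambda>s. B s \<omega>) * u (B (duration L + \<tau>) \<omega>) \<partial>M)
       = (\<integral>\<^sup>+\<omega>. path_weight L 0 (\<lambda>s. B s \<omega>) *
            (\<integral>\<^sup>+z. ennreal (heat \<tau> (z - B (duration L) \<omega>)) * u z \<partial>lborel) \<partial>M)"
proof -
  interpret prob_space M using bm by (simp add: brownian_motion_from_def)
  have Bm: "B t \<in> borel_measurable M" if "0 \<le> t" for t
    using bm that by (simp add: brownian_motion_from_def)
  define n where "n = length L"
  define T where "T i = (if i \<le> n then duration (take i L) else duration L + \<tau>)" for i
  have T0: "T 0 = 0" and Tn: "T n = duration L" and TSn: "T (Suc n) = duration L + \<tau>"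
    by (simp_all add: T_def n_def)
  have Tstep: "T i < T (Suc i)" if "i \<le> n" for i
  proof (cases "i = n")
    case True then show ?thesis using \<open>0 < \<tau>\<close> by (simp add: Tn TSn)
  next
    case False
    then have "i < length L" using that by (simp add: n_def)
    then have "take (Suc i) L = take i L @ [L ! i]" "L ! i \<in> set L"
      by (simp_all add: take_Suc_conv_app_nth)
    then show ?thesis
      using L False that by (cases "L ! i") (auto simp: T_def admissible_def)
  qed
  have Tmono: "mono T"
  proof (rule mono_iff_le_Suc[THEN iffD2], rule allI)
    fix i show "T i \<le> T (Suc i)"
    proof (cases "i \<le> n")
      case True then show ?thesis using Tstep[of i] by simp
    next
      case False then show ?thesis by (simp add: T_def)
    qed
  qed
  have Tle: "T (Suc i) \<le> T k \<longleftrightarrow> i < k" if "i < n" "k \<le> n" for i k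
  proof
    assume "i < k" then show "T (Suc i) \<le> T k" using Tmono by (simp add: mono_def)
  next
    assume le: "T (Suc i) \<le> T k"
    show "i < k"
    proof (rule ccontr)
      assume "\<not> i < k"
      then have "T k \<le> T i" using Tmono by (simp add: mono_def)
      then show False using le Tstep[of i] that by simp
    qed
  qed
  have T_nonneg: "0 \<le> T i" for i using Tmono T0 by (metis le0 monoD)
  define D where "D i \<omega> = B (T (Suc i)) \<omega> - B (T i) \<omega>" for i \<omega>
  have D_meas [measurable]: "D i \<in> borel_measurable M" for i
    unfolding D_def using Bm T_nonneg by measurable
  have ind: "indep_vars (\<lambda>_. borel) D {..<Suc n}"
  proof -
    have "0 \<le> T 0 \<and> mono T" using T0 Tmono by simp
    then have "indep_vars (\<lambda>_. borel) (\<lambda>i \<omega>. B (T (Suc i)) \<omega> - B (T i) \<omega>) {..<Suc n}"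
      using bm unfolding brownian_motion_from_def by blast
    then show ?thesis by (simp add: D_def[abs_def])
  qed
  define N :: "(nat \<Rightarrow> 'a) measure" where "N = PiM {..<n} (\<lambda>_. borel)"
  define Y where "Y \<omega> = restrict (\<lambda>i. D i \<omega>) {..<n}" for \<omega>
  define N' :: "(nat \<Rightarrow> 'a) measure" where "N' = PiM {n} (\<lambda>_. borel)"
  define Z where "Z \<omega> = restrict (\<lambda>i. D i \<omega>) {n}" for \<omega>
  have Z_n: "Z \<omega> n = D n \<omega>" for \<omega> by (simp add: Z_def)
  have indYZ: "indep_var N Y N' Z"
    unfolding N_def N'_def Y_def[abs_def] Z_def[abs_def] by (rule indep_var_restrict[OF ind]) auto
  have [measurable]: "Y \<in> measurable M N" "Z \<in> measurable M N'"
    using indYZ by (rule indep_var_rv1, rule indep_var_rv2)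
  have comp_meas [measurable]: "(\<lambda>z. z n) \<in> borel_measurable N'"
    unfolding N'_def by simp
  \<comment> \<open>The step path rebuilt from the increments: it agrees with \<open>B\<close> at the knots, and each of its
      values is a finite sum of coordinates, hence measurable.\<close>
  define path where "path s y = x + (\<Sum>i | i < n \<and> T (Suc i) \<le> s. y i)" for s and y :: "nat \<Rightarrow> 'a"
  have path_meas [measurable]: "path s \<in> borel_measurable N" for s
    unfolding path_def N_def by (intro borel_measurable_add borel_measurable_const borel_measurable_sum)
      (auto intro!: measurable_component_singleton)
  define F where "F y = path_weight L 0 (\<lambda>s. path s y)" for y
  have F_meas [measurable]: "F \<in> borel_measurable N"
    unfolding F_def by (rule path_weight_measurable) (use L in auto)
  have path_eq: "path (T k) (Y \<omega>) = B (T k) \<omega>" if "B 0 \<omega> = x" "k \<le> n" for k \<omega>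
  proof -
    have "{i. i < n \<and> T (Suc i) \<le> T k} = {..<k}" using Tle that by auto
    then have "path (T k) (Y \<omega>) = x + (\<Sum>i<k. D i \<omega>)"
      using that by (simp add: path_def Y_def)
    also have "(\<Sum>i<k. D i \<omega>) = B (T k) \<omega> - B (T 0) \<omega>"
      unfolding D_def by (rule sum_lessThan_telescope)
    finally show ?thesis using that by (simp add: T0)
  qed
  have start: "AE \<omega> in M. B 0 \<omega> = x" using bm by (simp add: brownian_motion_from_def)
  have F_eq: "F (Y \<omega>) = path_weight L 0 (\<lambda>s. B s \<omega>)" if "B 0 \<omega> = x" for \<omega>
    unfolding F_def
  proof (rule path_weight_cong)
    fix i assume "i < length L"
    then have "path (T (Suc i)) (Y \<omega>) = B (T (Suc i)) \<omega>"
      using path_eq[of \<omega> "Suc i"] that by (simp add: n_def)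
    then show "path (0 + duration (take (Suc i) L)) (Y \<omega>) = B (0 + duration (take (Suc i) L)) \<omega>"
      using \<open>i < length L\<close> by (simp add: T_def n_def)
  qed
  have dist: "distributed M lborel (D n) (\<lambda>z. ennreal (heat \<tau> z))"
  proof -
    have "0 \<le> T n \<and> T n < T (Suc n)" using T_nonneg Tstep by simp
    then have "distributed M lborel (\<lambda>\<omega>. B (T (Suc n)) \<omega> - B (T n) \<omega>)
          (\<lambda>z. ennreal (\<Prod>b\<in>Basis. normal_density 0 (sqrt (T (Suc n) - T n)) (z \<bullet> b)))"
      using bm unfolding brownian_motion_from_def by blast
    then show ?thesis
      using \<open>0 < \<tau>\<close> by (simp add: D_def[abs_def] Tn TSn heat_eq_prod_normal_density)
  qed
  interpret Y: prob_space "distr M N Y" by (rule prob_space_distr) simp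
  interpret Z: prob_space "distr M N' Z" by (rule prob_space_distr) simp
  have shift: "(\<integral>\<^sup>+z. u (a + z n) \<partial>distr M N' Z) = (\<integral>\<^sup>+z. ennreal (heat \<tau> (z - a)) * u z \<partial>lborel)" for a
  proof -
    have "(\<integral>\<^sup>+z. u (a + z n) \<partial>distr M N' Z) = (\<integral>\<^sup>+\<omega>. u (a + D n \<omega>) \<partial>M)"
      by (subst nn_integral_distr) (auto simp: Z_n)
    also have "\<dots> = (\<integral>\<^sup>+z. ennreal (heat \<tau> z) * u (a + z) \<partial>lborel)"
      using dist by (subst distributed_nn_integral[symmetric, of M lborel "D n"]) auto
    also have "\<dots> = (\<integral>\<^sup>+z. ennreal (heat \<tau> (z - a)) * u z \<partial>distr lborel borel ((+) a))"
      by (subst nn_integral_distr) auto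
    finally show ?thesis by (simp add: lborel_distr_plus)
  qed
  have "(\<integral>\<^sup>+\<omega>. path_weight L 0 (\<lambda>s. B s \<omega>) * u (B (duration L + \<tau>) \<omega>) \<partial>M)
      = (\<integral>\<^sup>+\<omega>. F (Y \<omega>) * u (path (T n) (Y \<omega>) + D n \<omega>) \<partial>M)"
    by (rule nn_integral_cong_AE) (use start in eventually_elim, simp add: F_eq path_eq, simp add: D_def Tn TSn)
  also have "\<dots> = (\<integral>\<^sup>+yz. (case yz of (y, z) \<Rightarrow> F y * u (path (T n) y + z n)) \<partial>distr M (N \<Otimes>\<^sub>M N') (\<lambda>\<omega>. (Y \<omega>, Z \<omega>)))"
    by (subst nn_integral_distr) (auto simp: Z_n)
  also have "distr M (N \<Otimes>\<^sub>M N') (\<lambda>\<omega>. (Y \<omega>, Z \<omega>)) = distr M N Y \<Otimes>\<^sub>M distr M N' Z"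
    using indYZ by (simp add: indep_var_distribution_eq)
  also have "(\<integral>\<^sup>+yz. (case yz of (y, z) \<Rightarrow> F y * u (path (T n) y + z n)) \<partial>(distr M N Y \<Otimes>\<^sub>M distr M N' Z))
     = (\<integral>\<^sup>+y. \<integral>\<^sup>+z. F y * u (path (T n) y + z n) \<partial>distr M N' Z \<partial>distr M N Y)"
    by (subst Z.nn_integral_fst[symmetric]) auto
  also have "\<dots> = (\<integral>\<^sup>+y. F y * (\<integral>\<^sup>+z. ennreal (heat \<tau> (z - path (T n) y)) * u z \<partial>lborel) \<partial>distr M N Y)"
    by (simp add: nn_integral_cmult shift)
  also have "\<dots> = (\<integral>\<^sup>+\<omega>. F (Y \<omega>) * (\<integral>\<^sup>+z. ennreal (heat \<tau> (z - path (T n) (Y \<omega>))) * u z \<partial>lborel) \<partial>M)"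
    by (subst nn_integral_distr) auto
  also have "\<dots> = (\<integral>\<^sup>+\<omega>. path_weight L 0 (\<lambda>s. B s \<omega>) *
            (\<integral>\<^sup>+z. ennreal (heat \<tau> (z - B (duration L) \<omega>)) * u z \<partial>lborel) \<partial>M)"
    by (rule nn_integral_cong_AE) (use start in eventually_elim, simp add: F_eq path_eq, simp add: Tn)
  finally show ?thesis .
qed

text \<open>The induction peels the list from the front, which moves entries from \<open>L\<close> to an initial
  part \<open>L'\<close> whose weight is still carried by the path.\<close>

theorem nn_integral_path_weight:
  fixes x :: "'a::euclidean_space"
  assumes bm: "brownian_motion_from x M B" and L: "admissible L"
  shows "(\<integral>\<^sup>+\<omega>. path_weight L 0 (\<lambda>s. B s \<omega>) \<partial>M) = chain_integral L x"
proof -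
  have *: "(\<integral>\<^sup>+\<omega>. path_weight (L' @ L) 0 (\<lambda>s. B s \<omega>) \<partial>M)
      = (\<integral>\<^sup>+\<omega>. path_weight L' 0 (\<lambda>s. B s \<omega>) * chain_integral L (B (duration L') \<omega>) \<partial>M)"
    if "admissible L'" for L'
    using L that
  proof (induction L arbitrary: L')
    case (Cons a L)
    obtain \<tau> h where a: "a = (\<tau>, h)" by (cases a)
    have [measurable]: "admissible L" "h \<in> borel_measurable borel" and "0 < \<tau>"
      using Cons.prems by (auto simp: a)
    have "(\<integral>\<^sup>+\<omega>. path_weight ((L' @ [(\<tau>, h)]) @ L) 0 (\<lambda>s. B s \<omega>) \<partial>M)
       = (\<integral>\<^sup>+\<omega>. path_weight (L' @ [(\<tau>, h)]) 0 (\<lambda>s. B s \<omega>) * chain_integral L (B (duration L' + \<tau>) \<omega>) \<partial>M)"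
      using Cons.prems by (subst Cons.IH) (auto simp: a)
    also have "\<dots> = (\<integral>\<^sup>+\<omega>. path_weight L' 0 (\<lambda>s. B s \<omega>) * (\<lambda>z. h z * chain_integral L z) (B (duration L' + \<tau>) \<omega>) \<partial>M)"
      by (simp add: path_weight_snoc mult.assoc)
    also have "\<dots> = (\<integral>\<^sup>+\<omega>. path_weight L' 0 (\<lambda>s. B s \<omega>) *
            (\<integral>\<^sup>+z. ennreal (heat \<tau> (z - B (duration L') \<omega>)) * (\<lambda>z. h z * chain_integral L z) z \<partial>lborel) \<partial>M)"
      using Cons.prems \<open>0 < \<tau>\<close> by (intro markov_step[OF bm]) auto
    finally show ?case by (simp add: a)
  qed simp
  interpret prob_space M using bm by (simp add: brownian_motion_from_def)
  have "(\<integral>\<^sup>+\<omega>. path_weight L 0 (\<lambda>s. B s \<omega>) \<partial>M) = (\<integral>\<^sup>+\<omega>. chain_integral L (B 0 \<omega>) \<partial>M)"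
    using *[of "[]"] by simp
  also have "\<dots> = (\<integral>\<^sup>+\<omega>. chain_integral L x \<partial>M)"
    using bm by (intro nn_integral_cong_AE) (auto simp: brownian_motion_from_def elim: eventually_mono)
  finally show ?thesis by (simp add: emeasure_space_1)
qed

section \<open>The Feynman--Kac integral\<close>

text \<open>Continuity of the paths makes the process a limit of its discretisations at times in
  \<open>\<nat> / (k + 1)\<close>. The maximum with \<open>0\<close> cuts off negative times, at which nothing is known
  about \<open>B\<close>.\<close>

lemma brownian_path_jointly_measurable:
  assumes bm: "brownian_motion_from x M B"
  shows "(\<lambda>(s, \<omega>). B (max 0 s) \<omega>) \<in> borel_measurable (lborel \<Otimes>\<^sub>M M)"
proof (rule borel_measurable_LIMSEQ_metric)
  fix k :: nat
  have "(\<lambda>p. (\<lambda>i p. B (real i / real (Suc k)) (snd p)) (nat \<lfloor>real (Suc k) * max 0 (fst p)\<rfloor>) p)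
      \<in> borel_measurable (lborel \<Otimes>\<^sub>M M)"
  proof (rule measurable_compose_countable[where f = "\<lambda>i p. B (real i / real (Suc k)) (snd p)" and g = "\<lambda>p. nat \<lfloor>real (Suc k) * max 0 (fst p)\<rfloor>"])
    fix i :: nat
    have "B (real i / real (Suc k)) \<in> borel_measurable M"
      using bm by (simp add: brownian_motion_from_def)
    then show "(\<lambda>p. B (real i / real (Suc k)) (snd p)) \<in> borel_measurable (lborel \<Otimes>\<^sub>M M)"
      by measurable
  qed measurable
  then show "(\<lambda>(s, \<omega>). B (real (nat \<lfloor>real (Suc k) * max 0 s\<rfloor>) / real (Suc k)) \<omega>) \<in> borel_measurable (lborel \<Otimes>\<^sub>M M)"
    by (simp add: case_prod_unfold)
next
  fix p :: "real \<times> 'b" assume "p \<in> space (lborel \<Otimes>\<^sub>M M)"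
  then obtain s \<omega> where p: "p = (s, \<omega>)" "\<omega> \<in> space M"
    by (auto simp: space_pair_measure)
  define u where "u = max 0 s"
  have "0 \<le> u" by (simp add: u_def)
  have cont: "continuous_on {0..} (\<lambda>t. B t \<omega>)"
    using bm p by (simp add: brownian_motion_from_def)
  have "(\<lambda>k. real (nat \<lfloor>real (Suc k) * u\<rfloor>) / real (Suc k)) \<longlonglongrightarrow> u"
  proof (rule real_tendsto_sandwich)
    show "\<forall>\<^sub>F k in sequentially. u - 1 / real (Suc k) \<le> real (nat \<lfloor>real (Suc k) * u\<rfloor>) / real (Suc k)"
    proof (rule always_eventually, rule allI)
      fix k
      have "real (Suc k) * u - 1 \<le> real_of_int \<lfloor>real (Suc k) * u\<rfloor>" by linarith
      then have "(real (Suc k) * u - 1) / real (Suc k) \<le> real_of_int \<lfloor>real (Suc k) * u\<rfloor> / real (Suc k)"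
        by (rule divide_right_mono) simp
      moreover have "(real (Suc k) * u - 1) / real (Suc k) = u - 1 / real (Suc k)"
        by (simp add: diff_divide_distrib del: of_nat_Suc)
      ultimately have "u - 1 / real (Suc k) \<le> real_of_int \<lfloor>real (Suc k) * u\<rfloor> / real (Suc k)"
        by simp
      then show "u - 1 / real (Suc k) \<le> real (nat \<lfloor>real (Suc k) * u\<rfloor>) / real (Suc k)"
        using \<open>0 \<le> u\<close> by simp
    qed
    show "\<forall>\<^sub>F k in sequentially. real (nat \<lfloor>real (Suc k) * u\<rfloor>) / real (Suc k) \<le> u"
    proof (rule always_eventually, rule allI)
      fix k
      have "real_of_int \<lfloor>real (Suc k) * u\<rfloor> \<le> real (Suc k) * u" by linarith
      then show "real (nat \<lfloor>real (Suc k) * u\<rfloor>) / real (Suc k) \<le> u"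
        using \<open>0 \<le> u\<close> by (simp add: divide_simps) (simp add: algebra_simps)
    qed
    have "(\<lambda>k. 1 / real (Suc k)) \<longlonglongrightarrow> 0"
      using LIMSEQ_inverse_real_of_nat by (simp add: inverse_eq_divide)
    then show "(\<lambda>k. u - 1 / real (Suc k)) \<longlonglongrightarrow> u"
      using tendsto_diff[OF tendsto_const, of "\<lambda>k. 1 / real (Suc k)" 0 sequentially u] by simp
  qed simp
  from continuous_on_tendsto_compose[OF cont this]
  show "(\<lambda>k. case p of (s, \<omega>) \<Rightarrow> B (real (nat \<lfloor>real (Suc k) * max 0 s\<rfloor>) / real (Suc k)) \<omega>)
      \<longlonglongrightarrow> (case p of (s, \<omega>) \<Rightarrow> B (max 0 s) \<omega>)"
    using \<open>0 \<le> u\<close> by (simp add: p u_def)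
qed

text \<open>The weight \<open>v\<close> is inserted at absolute time \<open>s\<close>, splitting the increment that contains it. This turns
  the mean of \<open>\<Gamma> * V(B\<^sub>s)\<close> into another chain integral. When \<open>s\<close> is itself a knot, the resulting
  list has a vanishing increment and is not admissible; there are only finitely many such times.\<close>

fun insert_weight :: "('a \<Rightarrow> ennreal) \<Rightarrow> (real \<times> ('a \<Rightarrow> ennreal)) list \<Rightarrow> real \<Rightarrow> (real \<times> ('a \<Rightarrow> ennreal)) list" where
  "insert_weight v [] s = []"
| "insert_weight v ((\<tau>, h) # L) s =
     (if s < \<tau> then (s, v) # (\<tau> - s, h) # L else (\<tau>, h) # insert_weight v L (s - \<tau>))"

lemma path_weight_insert_weight:
  "0 \<le> s \<Longrightarrow> s < duration L \<Longrightarrow> path_weight (insert_weight v L s) t b = v (b (t + s)) * path_weight L t b"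
  by (induction v L s arbitrary: t rule: insert_weight.induct) (auto simp: ac_simps)

lemma finite_not_admissible_insert_weight:
  assumes "admissible L" "v \<in> borel_measurable borel"
  shows "finite {s. 0 \<le> s \<and> \<not> admissible (insert_weight v L s)}"
  using assms(1)
proof (induction L)
  case (Cons a L)
  obtain \<tau> h where a: "a = (\<tau>, h)" by (cases a)
  let ?E = "{s. 0 \<le> s \<and> \<not> admissible (insert_weight v L s)}"
  have sub: "{s. 0 \<le> s \<and> \<not> admissible (insert_weight v (a # L) s)} \<subseteq> insert 0 ((\<lambda>s. s + \<tau>) ` ?E)"
  proof
    fix s assume s: "s \<in> {s. 0 \<le> s \<and> \<not> admissible (insert_weight v (a # L) s)}"
    show "s \<in> insert 0 ((\<lambda>s. s + \<tau>) ` ?E)"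
    proof (cases "s < \<tau>")
      case True
      then show ?thesis using s Cons.prems assms(2) by (auto simp: a)
    next
      case False
      then have "s - \<tau> \<in> ?E" using s Cons.prems by (auto simp: a)
      then have "s - \<tau> + \<tau> \<in> (\<lambda>s. s + \<tau>) ` ?E" by (rule imageI)
      then show ?thesis by simp
    qed
  qed
  have "finite ?E" using Cons by (simp add: a)
  then show ?case by (intro finite_subset[OF sub]) simp
qed simp

lemma AE_admissible_insert_weight:
  assumes "admissible L" "v \<in> borel_measurable borel"
  shows "AE s in lborel. 0 \<le> s \<longrightarrow> admissible (insert_weight v L s)"
proof (rule AE_I')
  show "{s. 0 \<le> s \<and> \<not> admissible (insert_weight v L s)} \<in> null_sets lborel"
    using finite_not_admissible_insert_weight[OF assms] by (intro finite_imp_null_set_lborel)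
qed auto

locale bounded_potential =
  fixes V :: "'a::euclidean_space \<Rightarrow> real" and K :: real
  assumes V_measurable [measurable]: "V \<in> borel_measurable borel"
    and V_nonneg: "0 \<le> V z" and V_le: "V z \<le> K"
begin

lemma K_nonneg: "0 \<le> K" using V_nonneg V_le order_trans by blast

definition action :: "(real \<Rightarrow> 'w \<Rightarrow> 'a) \<Rightarrow> real \<Rightarrow> 'w \<Rightarrow> real" where
  "action B t \<omega> = (LBINT s:{0..t}. V (B s \<omega>))"

lemma action_eq: "action B t \<omega> = (\<integral>s. indicator {0..t} s * V (B (max 0 s) \<omega>) \<partial>lborel)"
  unfolding action_def set_lebesgue_integral_def
  by (intro Bochner_Integration.integral_cong) (auto simp: indicator_def)

context
  fixes x M and B :: "real \<Rightarrow> 'w \<Rightarrow> 'a"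
  assumes bm: "brownian_motion_from x M B"
begin

interpretation prob_space M using bm by (simp add: brownian_motion_from_def)

lemma B_measurable: "0 \<le> t \<Longrightarrow> B t \<in> borel_measurable M"
  using bm by (simp add: brownian_motion_from_def)

lemma B_jointly_measurable:
  "(\<lambda>p. B (max 0 (fst p)) (snd p)) \<in> borel_measurable (lborel \<Otimes>\<^sub>M M)"
  using brownian_path_jointly_measurable[OF bm] by (simp add: case_prod_unfold)

lemma B_jointly_measurable':
  assumes [measurable]: "f \<in> borel_measurable N" "g \<in> measurable N M"
  shows "(\<lambda>p. B (max 0 (f p)) (g p)) \<in> borel_measurable N"
proof -
  have "(\<lambda>p. (f p, g p)) \<in> measurable N (lborel \<Otimes>\<^sub>M M)" by measurable
  from measurable_compose[OF this B_jointly_measurable] show ?thesis by simp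
qed

lemma action_integrable:
  assumes "\<omega> \<in> space M"
  shows "integrable lborel (\<lambda>s. indicator {0..t} s * V (B (max 0 s) \<omega>))"
proof (rule Bochner_Integration.integrable_bound)
  show "integrable lborel (\<lambda>s. K * indicator {0..t} s :: real)"
    by (intro integrable_mult_right integrable_real_indicator) (simp_all add: emeasure_lborel_Icc_eq)
  have "(\<lambda>s. (s, \<omega>)) \<in> measurable lborel (lborel \<Otimes>\<^sub>M M)"
    using assms by (intro measurable_Pair) auto
  from measurable_compose[OF this B_jointly_measurable]
  have [measurable]: "(\<lambda>s. B (max 0 s) \<omega>) \<in> borel_measurable lborel" by simp
  show "(\<lambda>s. indicator {0..t} s * V (B (max 0 s) \<omega>)) \<in> borel_measurable lborel"
    by measurable
  show "AE s in lborel. norm (indicator {0..t} s * V (B (max 0 s) \<omega>)) \<le> norm (K * indicator {0..t} s :: real)"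
    using V_nonneg V_le K_nonneg by (intro AE_I2) (auto simp: indicator_def)
qed

lemma action_nonneg: "0 \<le> action B t \<omega>"
  unfolding action_eq by (intro Bochner_Integration.integral_nonneg) (simp add: V_nonneg)

lemma action_measurable: "action B t \<in> borel_measurable M"
proof -
  note [measurable (raw)] = B_jointly_measurable'
  have "(\<lambda>\<omega>. \<integral>s. indicator {0..t} s * V (B (max 0 s) \<omega>) \<partial>lborel) \<in> borel_measurable M"
    by measurable
  then show ?thesis by (simp add: action_eq[abs_def])
qed

lemma ennreal_action:
  assumes "\<omega> \<in> space M"
  shows "ennreal (action B t \<omega>) = (\<integral>\<^sup>+s. indicator {0..t} s * ennreal (V (B (max 0 s) \<omega>)) \<partial>lborel)"
proof -
  have "ennreal (action B t \<omega>) = (\<integral>\<^sup>+s. ennreal (indicator {0..t} s * V (B (max 0 s) \<omega>)) \<partial>lborel)"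
    unfolding action_eq using V_nonneg
    by (intro nn_integral_eq_integral[symmetric] action_integrable assms) auto
  then show ?thesis
    by (simp add: ennreal_mult' V_nonneg ennreal_indicator)
qed

lemma Feynman_Kac_integrand_integrable:
  fixes f :: "'a \<Rightarrow> real"
  assumes "0 \<le> t" and [measurable]: "f \<in> borel_measurable borel" and f: "\<And>z. 0 \<le> f z" "\<And>z. f z \<le> F"
  shows "integrable M (\<lambda>\<omega>. f (B t \<omega>) * exp (- action B t \<omega>))"
proof (rule integrable_const_bound)
  note [measurable] = action_measurable
  have [measurable]: "B t \<in> borel_measurable M" using B_measurable assms by simp
  show "(\<lambda>\<omega>. f (B t \<omega>) * exp (- action B t \<omega>)) \<in> borel_measurable M" by measurable
  show "AE \<omega> in M. norm (f (B t \<omega>) * exp (- action B t \<omega>)) \<le> F"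
    using f action_nonneg by (intro AE_I2) (auto simp: abs_mult intro!: mult_le_one order_trans[OF mult_left_le])
qed

lemma ennreal_Feynman_Kac:
  fixes f :: "'a \<Rightarrow> real"
  assumes "0 \<le> t" and "f \<in> borel_measurable borel" and f: "\<And>z. 0 \<le> f z" "\<And>z. f z \<le> F"
  shows "ennreal (\<integral>\<omega>. f (B t \<omega>) * exp (- action B t \<omega>) \<partial>M)
       = (\<integral>\<^sup>+\<omega>. ennreal (f (B t \<omega>)) * ennreal (exp (- action B t \<omega>)) \<partial>M)"
  using f by (subst nn_integral_eq_integral[OF Feynman_Kac_integrand_integrable[OF assms], symmetric])
    (auto simp: ennreal_mult)

end

text \<open>The two ingredients of a lower bound, for a family of paths following a common schedule \<open>L\<close>: a
  lower bound \<open>m\<close> on the mass of the family and an upper bound \<open>a\<close> on its mean action. The starting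
  point ranges over a set and \<open>V(B\<^sub>s)\<close> is bounded time by time, because in this form schedules can
  be prolonged at the beginning (\<open>steerable_step\<close>).\<close>

definition steerable :: "real \<Rightarrow> 'a set \<Rightarrow> ('a \<Rightarrow> real) \<Rightarrow> real \<Rightarrow> real \<Rightarrow> bool" where
  "steerable t S f m a \<longleftrightarrow> (\<exists>L c. admissible L \<and> duration L = t \<and>
     (\<forall>t\<^sub>0 b. path_weight L t\<^sub>0 b \<le> ennreal (f (b (t\<^sub>0 + t)))) \<and>
     (\<forall>x\<in>S. ennreal m \<le> chain_integral L x) \<and>
     c \<in> borel_measurable borel \<and> (\<integral>\<^sup>+s. indicator {0..<t} s * c s \<partial>lborel) \<le> ennreal a \<and>
     (\<forall>x\<in>S. \<forall>s\<in>{0..<t}. chain_integral (insert_weight (\<lambda>z. ennreal (V z)) L s) x \<le> c s * chain_integral L x))"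

text \<open>This is Jensen's inequality for the path measure with density \<open>\<Gamma>\<close>, in the form of the tangent
  line of \<open>exp\<close> at the bound \<open>a\<close> for the mean action.\<close>

lemma Feynman_Kac_lower_bound:
  fixes f :: "'a \<Rightarrow> real"
  assumes bm: "brownian_motion_from x M B"
    and st: "steerable t S f m a" "x \<in> S" "0 \<le> m" "0 \<le> a"
    and [measurable]: "f \<in> borel_measurable borel" and f: "\<And>z. 0 \<le> f z" "\<And>z. f z \<le> F"
  shows "m * exp (- a) \<le> (\<integral>\<omega>. f (B t \<omega>) * exp (- action B t \<omega>) \<partial>M)"
proof -
  interpret prob_space M using bm by (simp add: brownian_motion_from_def)
  interpret MxL: pair_sigma_finite M lborel by unfold_locales
  note [measurable] = action_measurable[OF bm]
  note [measurable (raw)] = B_jointly_measurable'[OF bm]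
  obtain L c where L: "admissible L" "duration L = t"
      "\<And>t\<^sub>0 b. path_weight L t\<^sub>0 b \<le> ennreal (f (b (t\<^sub>0 + t)))" "ennreal m \<le> chain_integral L x"
    and c [measurable]: "c \<in> borel_measurable borel"
    and c_int: "(\<integral>\<^sup>+s. indicator {0..<t} s * c s \<partial>lborel) \<le> ennreal a"
    and cost: "\<And>s. s \<in> {0..<t} \<Longrightarrow>
        chain_integral (insert_weight (\<lambda>z. ennreal (V z)) L s) x \<le> c s * chain_integral L x"
    using st unfolding steerable_def by blast
  have "0 \<le> t" using L duration_nonneg by blast
  define \<Gamma> where "\<Gamma> \<omega> = path_weight L 0 (\<lambda>s. B s \<omega>)" for \<omega>
  have [measurable]: "\<Gamma> \<in> borel_measurable M"
    unfolding \<Gamma>_def using L B_measurable[OF bm] by (intro path_weight_measurable) auto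
  define q where "q = chain_integral L x"
  have E\<Gamma>: "(\<integral>\<^sup>+\<omega>. \<Gamma> \<omega> \<partial>M) = q"
    unfolding \<Gamma>_def q_def by (rule nn_integral_path_weight[OF bm L(1)])
  have \<Gamma>_le: "\<Gamma> \<omega> \<le> ennreal (f (B t \<omega>))" for \<omega>
    using L(3)[of 0 "\<lambda>s. B s \<omega>"] by (simp add: \<Gamma>_def)
  have q_fin: "q \<noteq> \<top>"
  proof -
    have "q \<le> (\<integral>\<^sup>+\<omega>. ennreal F \<partial>M)"
      unfolding E\<Gamma>[symmetric] using \<Gamma>_le f(2) by (intro nn_integral_mono) (meson ennreal_leI order_trans)
    also have "\<dots> < \<top>" by (simp add: emeasure_space_1)
    finally show ?thesis by simp
  qed
  have E\<Gamma>A: "(\<integral>\<^sup>+\<omega>. \<Gamma> \<omega> * ennreal (action B t \<omega>) \<partial>M) \<le> ennreal a * q"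
  proof -
    have "(\<integral>\<^sup>+\<omega>. \<Gamma> \<omega> * ennreal (action B t \<omega>) \<partial>M)
        = (\<integral>\<^sup>+\<omega>. (\<integral>\<^sup>+s. \<Gamma> \<omega> * (indicator {0..t} s * ennreal (V (B (max 0 s) \<omega>))) \<partial>lborel) \<partial>M)"
      by (intro nn_integral_cong) (simp add: ennreal_action[OF bm] nn_integral_cmult)
    also have "\<dots> = (\<integral>\<^sup>+s. (\<integral>\<^sup>+\<omega>. \<Gamma> \<omega> * (indicator {0..t} s * ennreal (V (B (max 0 s) \<omega>))) \<partial>M) \<partial>lborel)"
      by (intro MxL.Fubini'[symmetric]) measurable
    also have "\<dots> \<le> (\<integral>\<^sup>+s. indicator {0..<t} s * c s * q \<partial>lborel)"
    proof (rule nn_integral_mono_AE)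
      have "AE s in lborel. s \<noteq> t" by (rule AE_lborel_singleton)
      moreover have "AE s in lborel. 0 \<le> s \<longrightarrow> admissible (insert_weight (\<lambda>z. ennreal (V z)) L s)"
        by (rule AE_admissible_insert_weight[OF L(1)]) simp
      ultimately show "AE s in lborel. (\<integral>\<^sup>+\<omega>. \<Gamma> \<omega> * (indicator {0..t} s * ennreal (V (B (max 0 s) \<omega>))) \<partial>M)
          \<le> indicator {0..<t} s * c s * q"
      proof eventually_elim
        case (elim s)
        show ?case
        proof (cases "s \<in> {0..<t}")
          case True
          then have "(\<integral>\<^sup>+\<omega>. \<Gamma> \<omega> * (indicator {0..t} s * ennreal (V (B (max 0 s) \<omega>))) \<partial>M)
             = (\<integral>\<^sup>+\<omega>. path_weight (insert_weight (\<lambda>z. ennreal (V z)) L s) 0 (\<lambda>s. B s \<omega>) \<partial>M)"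
            using L(2) by (simp add: path_weight_insert_weight \<Gamma>_def mult.commute)
          also have "\<dots> = chain_integral (insert_weight (\<lambda>z. ennreal (V z)) L s) x"
            using elim True by (intro nn_integral_path_weight[OF bm]) auto
          also have "\<dots> \<le> c s * q" using cost[OF True] by (simp add: q_def)
          finally show ?thesis using True by simp
        next
          case False
          then have "indicator {0..t} s = (0::ennreal)" using elim by (auto simp: indicator_def)
          then show ?thesis by simp
        qed
      qed
    qed
    also have "\<dots> = (\<integral>\<^sup>+s. indicator {0..<t} s * c s \<partial>lborel) * q"
      by (rule nn_integral_multc) measurable
    also have "\<dots> \<le> ennreal a * q" using c_int by (rule mult_right_mono) simp
    finally show ?thesis .
  qed
  let ?I = "\<integral>\<^sup>+\<omega>. \<Gamma> \<omega> * ennreal (exp (- action B t \<omega>)) \<partial>M"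
  \<comment> \<open>The tangent inequality, rearranged so that all terms are nonnegative.\<close>
  have pt: "ennreal (exp (- a) * (1 + a)) * \<Gamma> \<omega>
      \<le> \<Gamma> \<omega> * ennreal (exp (- action B t \<omega>)) + ennreal (exp (- a)) * (\<Gamma> \<omega> * ennreal (action B t \<omega>))" for \<omega>
  proof -
    let ?A = "action B t \<omega>"
    have A: "0 \<le> ?A" by (rule action_nonneg[OF bm])
    have "exp (- a) * (1 + (a - ?A)) \<le> exp (- a) * exp (a - ?A)"
      by (intro mult_left_mono exp_ge_add_one_self) simp
    then have "exp (- a) * (1 + a) \<le> exp (- ?A) + exp (- a) * ?A"
      by (simp add: exp_add[symmetric] algebra_simps)
    then have "ennreal (exp (- a) * (1 + a)) \<le> ennreal (exp (- ?A)) + ennreal (exp (- a)) * ennreal ?A"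
      using A by (simp add: ennreal_plus[symmetric] ennreal_mult[symmetric] ennreal_leI del: ennreal_plus)
    then have "ennreal (exp (- a) * (1 + a)) * \<Gamma> \<omega> \<le> (ennreal (exp (- ?A)) + ennreal (exp (- a)) * ennreal ?A) * \<Gamma> \<omega>"
      by (rule mult_right_mono) simp
    then show ?thesis by (simp only: distrib_right) (simp add: ac_simps)
  qed
  have "ennreal (exp (- a) * (1 + a)) * q = (\<integral>\<^sup>+\<omega>. ennreal (exp (- a) * (1 + a)) * \<Gamma> \<omega> \<partial>M)"
    by (simp add: nn_integral_cmult E\<Gamma>)
  also have "\<dots> \<le> (\<integral>\<^sup>+\<omega>. \<Gamma> \<omega> * ennreal (exp (- action B t \<omega>)) + ennreal (exp (- a)) * (\<Gamma> \<omega> * ennreal (action B t \<omega>)) \<partial>M)"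
    by (intro nn_integral_mono pt)
  also have "\<dots> = ?I + ennreal (exp (- a)) * (\<integral>\<^sup>+\<omega>. \<Gamma> \<omega> * ennreal (action B t \<omega>) \<partial>M)"
    by (simp add: nn_integral_add nn_integral_cmult)
  also have "\<dots> \<le> ?I + ennreal (exp (- a)) * (ennreal a * q)"
    by (intro add_left_mono mult_left_mono E\<Gamma>A) simp
  finally have "ennreal (exp (- a) * (1 + a)) * q \<le> ?I + ennreal (exp (- a)) * (ennreal a * q)" .
  moreover have "ennreal (exp (- a) * (1 + a)) * q = ennreal (exp (- a)) * q + ennreal (exp (- a)) * (ennreal a * q)"
    using \<open>0 \<le> a\<close> by (simp add: ennreal_mult distrib_left distrib_right mult.assoc)
  ultimately have "ennreal (exp (- a)) * q + ennreal (exp (- a)) * (ennreal a * q) \<le> ?I + ennreal (exp (- a)) * (ennreal a * q)"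
    by simp
  moreover have "ennreal (exp (- a)) * (ennreal a * q) \<noteq> \<top>"
    using q_fin by (simp add: ennreal_mult_eq_top_iff)
  ultimately have I: "ennreal (exp (- a)) * q \<le> ?I"
    by (simp add: add.commute[of _ "ennreal (exp (- a)) * (ennreal a * q)"] ennreal_add_left_cancel_le)
  have "ennreal (m * exp (- a)) = ennreal (exp (- a)) * ennreal m"
    using \<open>0 \<le> m\<close> by (simp add: ennreal_mult mult.commute)
  also have "\<dots> \<le> ennreal (exp (- a)) * q"
    using L(4) by (intro mult_left_mono) (simp_all add: q_def)
  also note I
  also have "?I \<le> (\<integral>\<^sup>+\<omega>. ennreal (f (B t \<omega>)) * ennreal (exp (- action B t \<omega>)) \<partial>M)"
    by (intro nn_integral_mono mult_right_mono \<Gamma>_le) simp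
  also have "\<dots> = ennreal (\<integral>\<omega>. f (B t \<omega>) * exp (- action B t \<omega>) \<partial>M)"
    by (rule ennreal_Feynman_Kac[OF bm \<open>0 \<le> t\<close> _ f, symmetric]) simp
  finally show ?thesis
    using f by (subst (asm) ennreal_le_iff) (auto intro!: Bochner_Integration.integral_nonneg)
qed


lemma Feynman_Kac_le_heat:
  fixes f :: "'a \<Rightarrow> real"
  assumes bm: "brownian_motion_from x M B" and "0 < t"
    and [measurable]: "f \<in> borel_measurable borel" and f: "\<And>z. 0 \<le> f z" "\<And>z. f z \<le> F"
  shows "ennreal (\<integral>\<omega>. f (B t \<omega>) * exp (- action B t \<omega>) \<partial>M)
    \<le> (\<integral>\<^sup>+y. ennreal (heat t (y - x)) * ennreal (f y) \<partial>lborel)"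
proof -
  have "ennreal (\<integral>\<omega>. f (B t \<omega>) * exp (- action B t \<omega>) \<partial>M)
      = (\<integral>\<^sup>+\<omega>. ennreal (f (B t \<omega>)) * ennreal (exp (- action B t \<omega>)) \<partial>M)"
    using \<open>0 < t\<close> by (intro ennreal_Feynman_Kac[OF bm _ _ f]) auto
  also have "\<dots> \<le> (\<integral>\<^sup>+\<omega>. path_weight [(t, \<lambda>z. ennreal (f z))] 0 (\<lambda>s. B s \<omega>) \<partial>M)"
    using action_nonneg[OF bm] by (intro nn_integral_mono) (auto intro!: mult_left_le)
  also have "\<dots> = chain_integral [(t, \<lambda>z. ennreal (f z))] x"
    using \<open>0 < t\<close> by (intro nn_integral_path_weight[OF bm]) auto
  finally show ?thesis by simp
qed

text \<open>On \<open>[0, t / 2]\<close> the path spends a time \<open>n\<close> outside the ball of radius \<open>r\<close> about \<open>x\<close>, where \<open>V\<close> is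
  bounded below by \<open>0\<close> only. Convexity of \<open>exp\<close> in the fraction \<open>2 * n / t\<close> makes the
  bound linear in \<open>n\<close>, and then one-time marginals suffice. Restricting to the first half of the
  time leaves a Gaussian density of variance at least \<open>t / 2\<close> for the final position.\<close>

lemma Feynman_Kac_upper_bound:
  fixes f :: "'a \<Rightarrow> real"
  assumes bm: "brownian_motion_from x M B" and t: "0 < t" and r: "0 \<le> r"
    and w: "0 \<le> w" "\<And>z. norm (z - x) < r \<Longrightarrow> w \<le> V z"
    and [measurable]: "f \<in> borel_measurable borel" and f: "\<And>z. 0 \<le> f z" "\<And>z. f z \<le> F"
  shows "ennreal (\<integral>\<omega>. f (B t \<omega>) * exp (- action B t \<omega>) \<partial>M)
    \<le> ennreal ((pi * t) powr (- real DIM('a) / 2) *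
         (exp (- (t / 2) * w) + 2 powr (real DIM('a) / 2) * exp (- r\<^sup>2 / (2 * t)))) *
       (\<integral>\<^sup>+y. ennreal (f y) \<partial>lborel)"
proof -
  interpret prob_space M using bm by (simp add: brownian_motion_from_def)
  interpret MxL: pair_sigma_finite M lborel by unfold_locales
  note [measurable] = action_measurable[OF bm]
  note [measurable (raw)] = B_jointly_measurable'[OF bm]
  define T where "T = t / 2"
  have T: "0 < T" "T < t" using t by (simp_all add: T_def)
  define far where "far = {z. r \<le> norm (z - x)}"
  have [measurable]: "far \<in> sets borel" unfolding far_def by measurable
  define n where "n \<omega> = (\<integral>s. indicator {0..T} s * indicator far (B (max 0 s) \<omega>) \<partial>lborel :: real)" for \<omega>
  let ?G = "(pi * t) powr (- real DIM('a) / 2)"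
  let ?If = "\<integral>\<^sup>+y. ennreal (f y) \<partial>lborel"
  have n_int: "integrable lborel (\<lambda>s. indicator {0..T} s * indicator far (B (max 0 s) \<omega>) :: real)" if "\<omega> \<in> space M" for \<omega>
  proof (rule Bochner_Integration.integrable_bound)
    show "integrable lborel (indicator {0..T} :: real \<Rightarrow> real)"
      by (intro integrable_real_indicator) (simp_all add: emeasure_lborel_Icc_eq)
    have "(\<lambda>s. (s, \<omega>)) \<in> measurable lborel (lborel \<Otimes>\<^sub>M M)"
      using that by (intro measurable_Pair) auto
    from measurable_compose[OF this B_jointly_measurable[OF bm]]
    have [measurable]: "(\<lambda>s. B (max 0 s) \<omega>) \<in> borel_measurable lborel" by simp
    show "(\<lambda>s. indicator {0..T} s * indicator far (B (max 0 s) \<omega>) :: real) \<in> borel_measurable lborel"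
      by measurable
  qed (auto simp: indicator_def)
  have n_ennreal: "ennreal (n \<omega>) = (\<integral>\<^sup>+s. indicator {0..T} s * indicator far (B (max 0 s) \<omega>) \<partial>lborel)"
    if "\<omega> \<in> space M" for \<omega>
    unfolding n_def using that
    by (subst nn_integral_eq_integral[OF n_int, symmetric])
      (auto simp: ennreal_mult' ennreal_indicator)
  have n_bounds: "0 \<le> n \<omega>" "n \<omega> \<le> T" if "\<omega> \<in> space M" for \<omega>
  proof -
    show "0 \<le> n \<omega>" unfolding n_def by (intro Bochner_Integration.integral_nonneg) simp
    have "n \<omega> \<le> (\<integral>s. indicator {0..T} s \<partial>lborel)"
      unfolding n_def using that
      by (intro integral_mono n_int integrable_real_indicator) (auto simp: emeasure_lborel_Icc_eq indicator_def)
    then show "n \<omega> \<le> T" using T by simp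
  qed
  have action_ge: "w * (T - n \<omega>) \<le> action B t \<omega>" if "\<omega> \<in> space M" for \<omega>
  proof -
    have "w * (T - n \<omega>) = (\<integral>s. w * (indicator {0..T} s - indicator {0..T} s * indicator far (B (max 0 s) \<omega>)) \<partial>lborel)"
      using T n_int[OF that] unfolding n_def
      by (simp add: Bochner_Integration.integral_diff integrable_real_indicator emeasure_lborel_Icc_eq)
    also have "\<dots> \<le> action B t \<omega>"
      unfolding action_eq
    proof (rule integral_mono)
      show "integrable lborel (\<lambda>s. w * (indicator {0..T} s - indicator {0..T} s * indicator far (B (max 0 s) \<omega>)))"
        by (intro integrable_mult_right Bochner_Integration.integrable_diff n_int that integrable_real_indicator)
          (simp_all add: emeasure_lborel_Icc_eq)
      show "w * (indicator {0..T} s - indicator {0..T} s * indicator far (B (max 0 s) \<omega>))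
          \<le> indicator {0..t} s * V (B (max 0 s) \<omega>)" for s
        using w(2)[of "B (max 0 s) \<omega>"] V_nonneg T by (auto simp: indicator_def far_def)
    qed (rule action_integrable[OF bm that])
    finally show ?thesis .
  qed
  have pt: "ennreal (f (B t \<omega>)) * ennreal (exp (- action B t \<omega>))
     \<le> ennreal (exp (- T * w)) * ennreal (f (B t \<omega>)) + ennreal (1 / T) * (ennreal (f (B t \<omega>)) * ennreal (n \<omega>))"
    if "\<omega> \<in> space M" for \<omega>
  proof -
    define \<theta> where "\<theta> = n \<omega> / T"
    have \<theta>: "0 \<le> \<theta>" "\<theta> \<le> 1" "n \<omega> = T * \<theta>" using n_bounds[OF that] T by (simp_all add: \<theta>_def)
    have "exp (- action B t \<omega>) \<le> exp ((1 - \<theta>) *\<^sub>R (- T * w) + \<theta> *\<^sub>R 0)"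
      using action_ge[OF that] \<theta> by (simp add: algebra_simps)
    also have "\<dots> \<le> (1 - \<theta>) * exp (- T * w) + \<theta> * exp 0"
      using \<theta> by (intro convex_onD[OF exp_convex]) auto
    also have "\<dots> \<le> exp (- T * w) + 1 / T * n \<omega>"
      using \<theta> T by (simp add: algebra_simps)
    finally have "f (B t \<omega>) * exp (- action B t \<omega>) \<le> f (B t \<omega>) * (exp (- T * w) + 1 / T * n \<omega>)"
      by (intro mult_left_mono f)
    then have "ennreal (f (B t \<omega>) * exp (- action B t \<omega>))
      \<le> ennreal (exp (- T * w) * f (B t \<omega>) + 1 / T * (f (B t \<omega>) * n \<omega>))"
      by (intro ennreal_leI) (simp add: algebra_simps)
    then show ?thesis
      using f(1) n_bounds[OF that] T by (simp add: ennreal_mult[symmetric] ennreal_plus[symmetric] del: ennreal_plus)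
  qed
  have plain: "(\<integral>\<^sup>+\<omega>. ennreal (f (B t \<omega>)) \<partial>M) \<le> ennreal ?G * ?If"
  proof -
    have "(\<integral>\<^sup>+\<omega>. ennreal (f (B t \<omega>)) \<partial>M) = chain_integral [(t, \<lambda>z. ennreal (f z))] x"
      using t nn_integral_path_weight[OF bm, of "[(t, \<lambda>z. ennreal (f z))]"] by simp
    also have "\<dots> \<le> (\<integral>\<^sup>+y. ennreal ?G * ennreal (f y) \<partial>lborel)"
      unfolding chain_integral.simps mult_1_right
    proof (intro nn_integral_mono mult_right_mono ennreal_leI)
      fix y
      have "heat t (y - x) \<le> (2 * pi * t) powr (- real DIM('a) / 2)" using t by (rule heat_le)
      also have "\<dots> \<le> ?G" using t by (intro powr_mono2') auto
      finally show "heat t (y - x) \<le> ?G" .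
    qed simp
    finally show ?thesis by (simp add: nn_integral_cmult)
  qed
  have marginal: "(\<integral>\<^sup>+\<omega>. ennreal (f (B t \<omega>)) * indicator far (B s \<omega>) \<partial>M)
      \<le> ennreal (2 powr (real DIM('a) / 2) * exp (- r\<^sup>2 / (2 * t))) * (ennreal ?G * ?If)" if s: "0 < s" "s \<le> T" for s
  proof -
    have "(\<integral>\<^sup>+\<omega>. ennreal (f (B t \<omega>)) * indicator far (B s \<omega>) \<partial>M)
       = chain_integral [(s, indicator far), (t - s, \<lambda>z. ennreal (f z))] x"
      using s T nn_integral_path_weight[OF bm, of "[(s, indicator far), (t - s, \<lambda>z. ennreal (f z))]"]
      by (simp add: mult.commute)
    also have "\<dots> \<le> (\<integral>\<^sup>+z. (ennreal (heat s (z - x)) * indicator far z) * (ennreal ?G * ?If) \<partial>lborel)"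
      unfolding chain_integral.simps mult_1_right mult.assoc
    proof (intro nn_integral_mono mult_left_mono)
      fix z
      have "(\<integral>\<^sup>+y. ennreal (heat (t - s) (y - z)) * ennreal (f y) \<partial>lborel) \<le> (\<integral>\<^sup>+y. ennreal ?G * ennreal (f y) \<partial>lborel)"
      proof (intro nn_integral_mono mult_right_mono ennreal_leI)
        fix y
        have "heat (t - s) (y - z) \<le> (2 * pi * (t - s)) powr (- real DIM('a) / 2)" using s T by (intro heat_le) auto
        also have "\<dots> \<le> ?G" using s t by (intro powr_mono2') (auto simp: T_def)
        finally show "heat (t - s) (y - z) \<le> ?G" .
      qed simp
      then show "(\<integral>\<^sup>+y. ennreal (heat (t - s) (y - z)) * ennreal (f y) \<partial>lborel) \<le> ennreal ?G * ?If"
        by (simp add: nn_integral_cmult)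
    qed auto
    also have "\<dots> = (\<integral>\<^sup>+z. ennreal (heat s (z - x)) * indicator far z \<partial>lborel) * (ennreal ?G * ?If)"
      by (rule nn_integral_multc) measurable
    also have "\<dots> \<le> ennreal (2 powr (real DIM('a) / 2) * exp (- r\<^sup>2 / (2 * t))) * (ennreal ?G * ?If)"
    proof (rule mult_right_mono)
      have "(\<integral>\<^sup>+z. ennreal (heat s (z - x)) * indicator far z \<partial>lborel)
          \<le> ennreal (2 powr (real DIM('a) / 2) * exp (- r\<^sup>2 / (4 * s)))"
        unfolding far_def by (rule nn_integral_heat_tail) (use s r in auto)
      also have "\<dots> \<le> ennreal (2 powr (real DIM('a) / 2) * exp (- r\<^sup>2 / (2 * t)))"
      proof (intro ennreal_leI mult_left_mono)
        have "4 * s \<le> 2 * t" using s by (simp add: T_def)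
        then have "r\<^sup>2 / (2 * t) \<le> r\<^sup>2 / (4 * s)" using s by (intro divide_left_mono) (auto simp: t)
        then show "exp (- r\<^sup>2 / (4 * s)) \<le> exp (- r\<^sup>2 / (2 * t))" by simp
      qed simp
      finally show "(\<integral>\<^sup>+z. ennreal (heat s (z - x)) * indicator far z \<partial>lborel)
          \<le> ennreal (2 powr (real DIM('a) / 2) * exp (- r\<^sup>2 / (2 * t)))" .
    qed simp
    finally show ?thesis .
  qed
  have [measurable]: "B t \<in> borel_measurable M" using B_measurable[OF bm] t by simp
  have n_meas [measurable]: "n \<in> borel_measurable M" unfolding n_def by measurable
  let ?c = "ennreal (2 powr (real DIM('a) / 2) * exp (- r\<^sup>2 / (2 * t))) * (ennreal ?G * ?If)"
  have far_part: "(\<integral>\<^sup>+\<omega>. ennreal (f (B t \<omega>)) * ennreal (n \<omega>) \<partial>M) \<le> ennreal T * ?c"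
  proof -
    have "(\<integral>\<^sup>+\<omega>. ennreal (f (B t \<omega>)) * ennreal (n \<omega>) \<partial>M)
       = (\<integral>\<^sup>+\<omega>. (\<integral>\<^sup>+s. ennreal (f (B t \<omega>)) * (indicator {0..T} s * indicator far (B (max 0 s) \<omega>)) \<partial>lborel) \<partial>M)"
      by (intro nn_integral_cong) (simp add: n_ennreal nn_integral_cmult)
    also have "\<dots> = (\<integral>\<^sup>+s. (\<integral>\<^sup>+\<omega>. ennreal (f (B t \<omega>)) * (indicator {0..T} s * indicator far (B (max 0 s) \<omega>)) \<partial>M) \<partial>lborel)"
      by (intro MxL.Fubini'[symmetric]) measurable
    also have "\<dots> \<le> (\<integral>\<^sup>+s. ?c * indicator {0..T} s \<partial>lborel)"
    proof (rule nn_integral_mono_AE)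
      have "AE s in lborel. s \<noteq> (0::real)" by (rule AE_lborel_singleton)
      then show "AE s in lborel. (\<integral>\<^sup>+\<omega>. ennreal (f (B t \<omega>)) * (indicator {0..T} s * indicator far (B (max 0 s) \<omega>)) \<partial>M)
          \<le> ?c * indicator {0..T} s"
      proof eventually_elim
        case (elim s)
        show ?case
        proof (cases "s \<in> {0..T}")
          case True
          then show ?thesis using elim marginal[of s] by simp
        qed simp
      qed
    qed
    also have "\<dots> = ennreal T * ?c"
      using T by (subst nn_integral_cmult_indicator) (simp_all add: ac_simps)
    finally show ?thesis .
  qed
  have "ennreal (\<integral>\<omega>. f (B t \<omega>) * exp (- action B t \<omega>) \<partial>M)
      = (\<integral>\<^sup>+\<omega>. ennreal (f (B t \<omega>)) * ennreal (exp (- action B t \<omega>)) \<partial>M)"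
    using t by (intro ennreal_Feynman_Kac[OF bm _ _ f]) auto
  also have "\<dots> \<le> (\<integral>\<^sup>+\<omega>. ennreal (exp (- T * w)) * ennreal (f (B t \<omega>)) + ennreal (1 / T) * (ennreal (f (B t \<omega>)) * ennreal (n \<omega>)) \<partial>M)"
    by (intro nn_integral_mono pt) auto
  also have "\<dots> = ennreal (exp (- T * w)) * (\<integral>\<^sup>+\<omega>. ennreal (f (B t \<omega>)) \<partial>M)
       + ennreal (1 / T) * (\<integral>\<^sup>+\<omega>. ennreal (f (B t \<omega>)) * ennreal (n \<omega>) \<partial>M)"
    by (simp add: nn_integral_add nn_integral_cmult)
  also have "\<dots> \<le> ennreal (exp (- T * w)) * (ennreal ?G * ?If) + ennreal (1 / T) * (ennreal T * ?c)"
    by (intro add_mono mult_left_mono plain far_part) auto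
  also have "ennreal (1 / T) * (ennreal T * ?c) = ?c"
    using T by (simp add: mult.assoc[symmetric] ennreal_mult[symmetric])
  also have "ennreal (exp (- T * w)) * (ennreal ?G * ?If) + ?c
      = ennreal (?G * (exp (- T * w) + 2 powr (real DIM('a) / 2) * exp (- r\<^sup>2 / (2 * t)))) * ?If"
    by (simp add: ennreal_mult distrib_left distrib_right ac_simps)
  finally show ?thesis by (simp add: T_def)
qed

end

section \<open>Bridges in a bounded potential\<close>

context bounded_potential
begin

definition mean_potential :: "real \<Rightarrow> 'a \<Rightarrow> ennreal" where
  "mean_potential v m = (\<integral>\<^sup>+w. ennreal (heat v (w - m)) * ennreal (V w) \<partial>lborel)"

lemma mean_potential_le_bound: "0 < v \<Longrightarrow> mean_potential v m \<le> ennreal K"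
proof -
  assume "0 < v"
  have "mean_potential v m \<le> (\<integral>\<^sup>+w. ennreal (heat v (w - m)) * ennreal K \<partial>lborel)"
    unfolding mean_potential_def by (intro nn_integral_mono mult_left_mono ennreal_leI V_le) simp
  also have "\<dots> = ennreal K"
    using \<open>0 < v\<close> by (simp add: nn_integral_multc nn_integral_heat)
  finally show ?thesis .
qed

text \<open>For \<open>s = 0\<close> the left side vanishes, because \<open>heat 0\<close> is \<open>0\<close>; so the knots need no separate
  treatment in the bounds on inserted weights.\<close>

lemma nn_integral_bridge_potential_le:
  assumes s: "0 \<le> s" "s < \<tau>"
    and cost: "\<And>m v. m \<in> closed_segment z z' \<Longrightarrow> 0 < v \<Longrightarrow> v \<le> \<tau> \<Longrightarrow> mean_potential v m \<le> ennreal \<kappa>"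
  shows "(\<integral>\<^sup>+w. ennreal (heat s (w - z)) * (ennreal (V w) * ennreal (heat (\<tau> - s) (z' - w))) \<partial>lborel)
    \<le> ennreal \<kappa> * ennreal (heat \<tau> (z' - z))"
proof (cases "s = 0")
  case True
  then show ?thesis by (simp add: heat_def)
next
  case False
  define m where "m = z + (s / \<tau>) *\<^sub>R (z' - z)"
  define v where "v = s * (\<tau> - s) / \<tau>"
  have "m = (1 - s / \<tau>) *\<^sub>R z + (s / \<tau>) *\<^sub>R z'" by (simp add: m_def algebra_simps)
  moreover have "0 \<le> s / \<tau>" "s / \<tau> \<le> 1" using s by simp_all
  ultimately have "m \<in> closed_segment z z'" unfolding closed_segment_def by blast
  have "s * (\<tau> - s) \<le> \<tau> * \<tau>" using s by (intro mult_mono) auto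
  then have v: "0 < v" "v \<le> \<tau>" using s False by (simp_all add: v_def field_simps)
  have "(\<integral>\<^sup>+w. ennreal (heat s (w - z)) * (ennreal (V w) * ennreal (heat (\<tau> - s) (z' - w))) \<partial>lborel)
      = (\<integral>\<^sup>+w. ennreal (heat \<tau> (z' - z)) * (ennreal (heat v (w - m)) * ennreal (V w)) \<partial>lborel)"
  proof (intro nn_integral_cong)
    fix w
    have "heat s (w - z) * heat (\<tau> - s) (z' - w) = heat \<tau> (z' - z) * heat v (w - m)"
      unfolding m_def v_def using s False by (intro heat_mult_heat) auto
    then have "ennreal (heat s (w - z)) * ennreal (heat (\<tau> - s) (z' - w)) = ennreal (heat \<tau> (z' - z)) * ennreal (heat v (w - m))"
      by (simp add: ennreal_mult[symmetric])
    then show "ennreal (heat s (w - z)) * (ennreal (V w) * ennreal (heat (\<tau> - s) (z' - w)))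
        = ennreal (heat \<tau> (z' - z)) * (ennreal (heat v (w - m)) * ennreal (V w))"
      by (metis mult.assoc mult.commute)
  qed
  also have "\<dots> = ennreal (heat \<tau> (z' - z)) * mean_potential v m"
    unfolding mean_potential_def by (rule nn_integral_cmult) measurable
  also have "\<dots> \<le> ennreal (heat \<tau> (z' - z)) * ennreal \<kappa>"
    by (intro mult_left_mono cost v \<open>m \<in> closed_segment z z'\<close>) simp
  finally show ?thesis by (simp add: mult.commute)
qed

text \<open>Inserting \<open>V\<close> into the first increment multiplies the mass by at most the largest Gaussian mean of
  \<open>V\<close> about the points of the segments from \<open>z\<close> to the support of the first weight.\<close>

lemma chain_integral_insert_head:
  assumes s: "0 \<le> s" "s < \<tau>" and L: "admissible L" and h [measurable]: "h \<in> borel_measurable borel"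
    and cost: "\<And>z' m v. h z' \<noteq> 0 \<Longrightarrow> m \<in> closed_segment z z' \<Longrightarrow> 0 < v \<Longrightarrow> v \<le> \<tau> \<Longrightarrow> mean_potential v m \<le> ennreal \<kappa>"
  shows "chain_integral ((s, \<lambda>z. ennreal (V z)) # (\<tau> - s, h) # L) z \<le> ennreal \<kappa> * chain_integral ((\<tau>, h) # L) z"
proof -
  note [measurable] = chain_integral_measurable'[OF L]
  let ?u = "\<lambda>z'. h z' * chain_integral L z'"
  have "chain_integral ((s, \<lambda>z. ennreal (V z)) # (\<tau> - s, h) # L) z
     = (\<integral>\<^sup>+w. (\<integral>\<^sup>+z'. ennreal (heat s (w - z)) * (ennreal (V w) * ennreal (heat (\<tau> - s) (z' - w))) * ?u z' \<partial>lborel) \<partial>lborel)"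
    unfolding chain_integral.simps
    by (intro nn_integral_cong) (simp add: nn_integral_cmult[symmetric] mult.assoc)
  also have "\<dots> = (\<integral>\<^sup>+z'. (\<integral>\<^sup>+w. ennreal (heat s (w - z)) * (ennreal (V w) * ennreal (heat (\<tau> - s) (z' - w))) * ?u z' \<partial>lborel) \<partial>lborel)"
    by (intro lborel_pair.Fubini') measurable
  also have "\<dots> \<le> (\<integral>\<^sup>+z'. ennreal \<kappa> * (ennreal (heat \<tau> (z' - z)) * ?u z') \<partial>lborel)"
  proof (intro nn_integral_mono)
    fix z'
    have "(\<integral>\<^sup>+w. ennreal (heat s (w - z)) * (ennreal (V w) * ennreal (heat (\<tau> - s) (z' - w))) * ?u z' \<partial>lborel)
       = (\<integral>\<^sup>+w. ennreal (heat s (w - z)) * (ennreal (V w) * ennreal (heat (\<tau> - s) (z' - w))) \<partial>lborel) * ?u z'"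
      by (rule nn_integral_multc) measurable
    also have "\<dots> \<le> ennreal \<kappa> * (ennreal (heat \<tau> (z' - z)) * ?u z')"
    proof (cases "h z' = 0")
      case False
      then have "(\<integral>\<^sup>+w. ennreal (heat s (w - z)) * (ennreal (V w) * ennreal (heat (\<tau> - s) (z' - w))) \<partial>lborel)
          \<le> ennreal \<kappa> * ennreal (heat \<tau> (z' - z))"
        by (intro nn_integral_bridge_potential_le s cost)
      then show ?thesis
        by (simp add: mult.assoc[symmetric] mult_right_mono)
    qed simp
    finally show "(\<integral>\<^sup>+w. ennreal (heat s (w - z)) * (ennreal (V w) * ennreal (heat (\<tau> - s) (z' - w))) * ?u z' \<partial>lborel)
        \<le> ennreal \<kappa> * (ennreal (heat \<tau> (z' - z)) * ?u z')" .
  qed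
  also have "\<dots> = ennreal \<kappa> * chain_integral ((\<tau>, h) # L) z"
    by (simp add: nn_integral_cmult)
  finally show ?thesis .
qed

lemma steerable_mono:
  assumes "steerable t S f m a" "m' \<le> m" "a \<le> a'"
  shows "steerable t S f m' a'"
proof -
  obtain L c where *: "admissible L" "duration L = t"
      "\<forall>t\<^sub>0 b. path_weight L t\<^sub>0 b \<le> ennreal (f (b (t\<^sub>0 + t)))"
      "\<forall>x\<in>S. ennreal m \<le> chain_integral L x" "c \<in> borel_measurable borel"
      "(\<integral>\<^sup>+s. indicator {0..<t} s * c s \<partial>lborel) \<le> ennreal a"
      "\<forall>x\<in>S. \<forall>s\<in>{0..<t}. chain_integral (insert_weight (\<lambda>z. ennreal (V z)) L s) x \<le> c s * chain_integral L x"
    using assms(1) unfolding steerable_def by blast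
  have "\<forall>x\<in>S. ennreal m' \<le> chain_integral L x"
    using *(4) assms(2) by (meson ennreal_leI order_trans)
  moreover have "(\<integral>\<^sup>+s. indicator {0..<t} s * c s \<partial>lborel) \<le> ennreal a'"
    using *(6) assms(3) by (meson ennreal_leI order_trans)
  ultimately show ?thesis using * unfolding steerable_def by blast
qed

lemma steerable_final:
  fixes f :: "'a \<Rightarrow> real"
  assumes "0 < \<tau>" "0 \<le> \<kappa>" "0 \<le> D" and [measurable]: "f \<in> borel_measurable borel" and "0 \<le> m" and f: "ennreal m \<le> (\<integral>\<^sup>+z. ennreal (f z) \<partial>lborel)"
    and dist: "\<And>z z'. z \<in> S \<Longrightarrow> f z' \<noteq> 0 \<Longrightarrow> norm (z' - z) \<le> D"
    and cost: "\<And>z z' c v. z \<in> S \<Longrightarrow> f z' \<noteq> 0 \<Longrightarrow> c \<in> closed_segment z z' \<Longrightarrow> 0 < v \<Longrightarrow> v \<le> \<tau> \<Longrightarrow> mean_potential v c \<le> ennreal \<kappa>"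
  shows "steerable \<tau> S f ((2 * pi * \<tau>) powr (- real DIM('a) / 2) * exp (- D\<^sup>2 / (2 * \<tau>)) * m) (\<kappa> * \<tau>)"
proof -
  let ?G = "(2 * pi * \<tau>) powr (- real DIM('a) / 2) * exp (- D\<^sup>2 / (2 * \<tau>))"
  let ?L = "[(\<tau>, \<lambda>z. ennreal (f z))]"
  have "admissible ?L" "duration ?L = \<tau>" using \<open>0 < \<tau>\<close> by auto
  moreover have "path_weight ?L t\<^sub>0 b \<le> ennreal (f (b (t\<^sub>0 + \<tau>)))" for t\<^sub>0 b by simp
  moreover have "ennreal (?G * m) \<le> chain_integral ?L z" if "z \<in> S" for z
  proof -
    have "ennreal (?G * m) = ennreal ?G * ennreal m" using \<open>0 \<le> m\<close> by (simp add: ennreal_mult)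
    also have "\<dots> \<le> ennreal ?G * (\<integral>\<^sup>+z. ennreal (f z) \<partial>lborel)" using f by (intro mult_left_mono) auto
    also have "\<dots> = (\<integral>\<^sup>+z'. ennreal ?G * ennreal (f z') \<partial>lborel)" by (simp add: nn_integral_cmult)
    also have "\<dots> \<le> (\<integral>\<^sup>+z'. ennreal (heat \<tau> (z' - z)) * ennreal (f z') \<partial>lborel)"
    proof (intro nn_integral_mono)
      fix z'
      show "ennreal ?G * ennreal (f z') \<le> ennreal (heat \<tau> (z' - z)) * ennreal (f z')"
      proof (cases "f z' = 0")
        case False
        then show ?thesis
          using heat_ge[OF \<open>0 < \<tau>\<close> dist[OF that False]] by (intro mult_right_mono ennreal_leI) auto
      qed simp
    qed
    finally show ?thesis by simp
  qed
  moreover have "(\<integral>\<^sup>+s. indicator {0..<\<tau>} s * (ennreal \<kappa>) \<partial>lborel) \<le> ennreal (\<kappa> * \<tau>)"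
  proof -
    have "(\<integral>\<^sup>+s. indicator {0..<\<tau>} s * (ennreal \<kappa>) \<partial>lborel) = (\<integral>\<^sup>+s. ennreal \<kappa> * indicator {0..<\<tau>} s \<partial>lborel)"
      by (simp add: mult.commute)
    also have "\<dots> = ennreal (\<kappa> * \<tau>)"
      using \<open>0 < \<tau>\<close> \<open>0 \<le> \<kappa>\<close> by (subst nn_integral_cmult_indicator) (auto simp: ennreal_mult)
    finally show ?thesis by simp
  qed
  moreover have "chain_integral (insert_weight (\<lambda>z. ennreal (V z)) ?L s) z \<le> ennreal \<kappa> * chain_integral ?L z"
    if "z \<in> S" "s \<in> {0..<\<tau>}" for z s
  proof -
    have "chain_integral ((s, \<lambda>z. ennreal (V z)) # (\<tau> - s, \<lambda>z. ennreal (f z)) # []) z \<le> ennreal \<kappa> * chain_integral ?L z"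
    proof (rule chain_integral_insert_head)
      fix z' c v assume *: "ennreal (f z') \<noteq> 0" "c \<in> closed_segment z z'" "0 < v" "v \<le> \<tau>"
      have "f z' \<noteq> 0" using *(1) by auto
      then show "mean_potential v c \<le> ennreal \<kappa>" using that(1) * cost by blast
    qed (use that in auto)
    then show ?thesis using that by simp
  qed
  ultimately show ?thesis
    unfolding steerable_def by (intro exI[of _ ?L] exI[of _ "\<lambda>_. ennreal \<kappa>"]) auto
qed

text \<open>Prolongs a schedule at its beginning by a visit to \<open>S'\<close>. Masses multiply: the Gaussian density is
  bounded below by its value at distance \<open>D\<close>, and \<open>\<mu>\<close> is the volume over which it is integrated.
  Actions add.\<close>

lemma steerable_step:
  fixes f :: "'a \<Rightarrow> real"
  assumes st: "steerable t S' f m a"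
    and \<tau>: "0 < \<tau>" and \<kappa>: "0 \<le> \<kappa>" and D: "0 \<le> D" and m: "0 \<le> m" and a: "0 \<le> a"
    and [measurable]: "S' \<in> sets borel" and \<mu>: "0 \<le> \<mu>" "ennreal \<mu> \<le> emeasure lborel S'"
    and dist: "\<And>z z'. z \<in> S \<Longrightarrow> z' \<in> S' \<Longrightarrow> norm (z' - z) \<le> D"
    and cost: "\<And>z z' c v. z \<in> S \<Longrightarrow> z' \<in> S' \<Longrightarrow> c \<in> closed_segment z z' \<Longrightarrow> 0 < v \<Longrightarrow> v \<le> \<tau> \<Longrightarrow> mean_potential v c \<le> ennreal \<kappa>"
  shows "steerable (\<tau> + t) S f ((2 * pi * \<tau>) powr (- real DIM('a) / 2) * exp (- D\<^sup>2 / (2 * \<tau>)) * \<mu> * m) (\<kappa> * \<tau> + a)"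
proof -
  let ?G = "(2 * pi * \<tau>) powr (- real DIM('a) / 2) * exp (- D\<^sup>2 / (2 * \<tau>))"
  let ?V = "\<lambda>z. ennreal (V z)"
  obtain L c where L: "admissible L" "duration L = t"
      "\<And>t\<^sub>0 b. path_weight L t\<^sub>0 b \<le> ennreal (f (b (t\<^sub>0 + t)))"
      "\<And>x. x \<in> S' \<Longrightarrow> ennreal m \<le> chain_integral L x"
    and c [measurable]: "c \<in> borel_measurable borel"
    and c_int: "(\<integral>\<^sup>+s. indicator {0..<t} s * c s \<partial>lborel) \<le> ennreal a"
    and Lcost: "\<And>x s. x \<in> S' \<Longrightarrow> s \<in> {0..<t} \<Longrightarrow>
        chain_integral (insert_weight ?V L s) x \<le> c s * chain_integral L x"
    using st unfolding steerable_def by blast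
  have "0 \<le> t" using L duration_nonneg by blast
  let ?L = "(\<tau>, indicator S') # L"
  define c' where "c' s = (if s < \<tau> then ennreal \<kappa> else c (s - \<tau>))" for s
  have "admissible ?L" "duration ?L = \<tau> + t" using \<tau> L by auto
  moreover have "path_weight ?L t\<^sub>0 b \<le> ennreal (f (b (t\<^sub>0 + (\<tau> + t))))" for t\<^sub>0 b
  proof -
    have "path_weight ?L t\<^sub>0 b \<le> 1 * path_weight L (t\<^sub>0 + \<tau>) b"
      unfolding path_weight.simps by (intro mult_right_mono) (auto simp: indicator_def)
    also have "\<dots> \<le> ennreal (f (b (t\<^sub>0 + \<tau> + t)))" using L(3) by simp
    finally show ?thesis by (simp add: add.assoc)
  qed
  moreover have "ennreal (?G * \<mu> * m) \<le> chain_integral ?L z" if "z \<in> S" for z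
  proof -
    have "ennreal (?G * \<mu> * m) = ennreal (?G * m) * ennreal \<mu>" using m \<mu> by (simp add: ennreal_mult ac_simps)
    also have "\<dots> \<le> ennreal (?G * m) * emeasure lborel S'" using \<mu> by (intro mult_left_mono) auto
    also have "\<dots> = (\<integral>\<^sup>+z'. ennreal (?G * m) * indicator S' z' \<partial>lborel)" by (simp add: nn_integral_cmult_indicator)
    also have "\<dots> \<le> (\<integral>\<^sup>+z'. ennreal (heat \<tau> (z' - z)) * (indicator S' z' * chain_integral L z') \<partial>lborel)"
    proof (intro nn_integral_mono)
      fix z'
      show "ennreal (?G * m) * indicator S' z' \<le> ennreal (heat \<tau> (z' - z)) * (indicator S' z' * chain_integral L z')"
      proof (cases "z' \<in> S'")
        case True
        have "ennreal (?G * m) = ennreal ?G * ennreal m" using m by (simp add: ennreal_mult)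
        also have "\<dots> \<le> ennreal (heat \<tau> (z' - z)) * chain_integral L z'"
          using heat_ge[OF \<tau> dist[OF that True]] L(4)[OF True] by (intro mult_mono ennreal_leI) auto
        finally show ?thesis using True by simp
      qed simp
    qed
    finally show ?thesis by simp
  qed
  moreover have c'_meas: "c' \<in> borel_measurable borel" unfolding c'_def by measurable
  moreover have "(\<integral>\<^sup>+s. indicator {0..<\<tau> + t} s * c' s \<partial>lborel) \<le> ennreal (\<kappa> * \<tau> + a)"
  proof -
    have "(\<integral>\<^sup>+s. indicator {0..<\<tau> + t} s * c' s \<partial>lborel)
        = (\<integral>\<^sup>+s. ennreal \<kappa> * indicator {0..<\<tau>} s + indicator {0..<t} (s - \<tau>) * c (s - \<tau>) \<partial>lborel)"
      using \<tau> \<open>0 \<le> t\<close> by (intro nn_integral_cong) (auto simp: c'_def indicator_def)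
    also have "\<dots> = (\<integral>\<^sup>+s. ennreal \<kappa> * indicator {0..<\<tau>} s \<partial>lborel) + (\<integral>\<^sup>+s. indicator {0..<t} (s - \<tau>) * c (s - \<tau>) \<partial>lborel)"
      by (intro nn_integral_add) measurable
    also have "(\<integral>\<^sup>+s. ennreal \<kappa> * indicator {0..<\<tau>} s \<partial>lborel) = ennreal (\<kappa> * \<tau>)"
      using \<tau> \<kappa> by (subst nn_integral_cmult_indicator) (auto simp: ennreal_mult)
    also have "(\<integral>\<^sup>+s. indicator {0..<t} (s - \<tau>) * c (s - \<tau>) \<partial>lborel)
        = (\<integral>\<^sup>+s. indicator {0..<t} (s - \<tau>) * c (s - \<tau>) \<partial>distr lborel borel ((+) \<tau>))"
      by (simp only: lborel_distr_plus)
    also have "\<dots> = (\<integral>\<^sup>+s. indicator {0..<t} s * c s \<partial>lborel)"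
      by (subst nn_integral_distr) auto
    also have "ennreal (\<kappa> * \<tau>) + (\<integral>\<^sup>+s. indicator {0..<t} s * c s \<partial>lborel) \<le> ennreal (\<kappa> * \<tau>) + ennreal a"
      by (intro add_left_mono c_int)
    finally show ?thesis using \<kappa> \<tau> a by (simp add: ennreal_plus[symmetric] del: ennreal_plus)
  qed
  moreover have "chain_integral (insert_weight ?V ?L s) z \<le> c' s * chain_integral ?L z"
    if "z \<in> S" "s \<in> {0..<\<tau> + t}" for z s
  proof (cases "s < \<tau>")
    case True
    have "chain_integral ((s, ?V) # (\<tau> - s, indicator S') # L) z \<le> ennreal \<kappa> * chain_integral ?L z"
    proof (rule chain_integral_insert_head)
      fix z' k v assume *: "indicator S' z' \<noteq> (0::ennreal)" "k \<in> closed_segment z z'" "0 < v" "v \<le> \<tau>"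
      then have "z' \<in> S'" by (auto simp: indicator_def split: if_splits)
      then show "mean_potential v k \<le> ennreal \<kappa>" using that(1) * cost by blast
    qed (use that True L in auto)
    then show ?thesis using True by (simp add: c'_def)
  next
    case False
    have "chain_integral (insert_weight ?V ?L s) z
        = (\<integral>\<^sup>+z'. ennreal (heat \<tau> (z' - z)) * (indicator S' z' * chain_integral (insert_weight ?V L (s - \<tau>)) z') \<partial>lborel)"
      using False by simp
    also have "\<dots> \<le> (\<integral>\<^sup>+z'. c (s - \<tau>) * (ennreal (heat \<tau> (z' - z)) * (indicator S' z' * chain_integral L z')) \<partial>lborel)"
    proof (intro nn_integral_mono)
      fix z'
      show "ennreal (heat \<tau> (z' - z)) * (indicator S' z' * chain_integral (insert_weight ?V L (s - \<tau>)) z')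
          \<le> c (s - \<tau>) * (ennreal (heat \<tau> (z' - z)) * (indicator S' z' * chain_integral L z'))"
      proof (cases "z' \<in> S'")
        case True
        have "chain_integral (insert_weight ?V L (s - \<tau>)) z' \<le> c (s - \<tau>) * chain_integral L z'"
          using True that False by (intro Lcost) auto
        then have "ennreal (heat \<tau> (z' - z)) * chain_integral (insert_weight ?V L (s - \<tau>)) z'
            \<le> ennreal (heat \<tau> (z' - z)) * (c (s - \<tau>) * chain_integral L z')"
          by (rule mult_left_mono) simp
        then show ?thesis using True by (simp add: ac_simps)
      qed simp
    qed
    also have "\<dots> = c (s - \<tau>) * chain_integral ?L z"
      using L(1) by (simp add: nn_integral_cmult)
    finally show ?thesis using False by (simp add: c'_def)
  qed
  ultimately show ?thesis
    unfolding steerable_def by (intro exI[of _ ?L] exI[of _ c']) auto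
qed

end

section \<open>Steering through a slowly decaying potential\<close>

text \<open>Follows from \<open>u / a \<le> exp (u / a)\<close> by taking the power \<open>a\<close>. It converts exponential smallness into
  the decay rate of the potential.\<close>

lemma exp_minus_le_powr:
  fixes u a :: real
  assumes "0 < a" "0 < u"
  shows "exp (- u) \<le> (a / u) powr a"
proof -
  have "0 < u / a" using assms by simp
  then have "(u / a) powr a \<le> exp (u / a) powr a"
    using assms(1) exp_ge_add_one_self[of "u / a"] by (intro powr_mono2) linarith+
  also have "\<dots> = exp u" using assms by (simp add: powr_def)
  finally have "inverse (exp u) \<le> inverse ((u / a) powr a)"
    using assms by (intro le_imp_inverse_le) auto
  then show ?thesis
    using assms by (simp add: exp_minus powr_divide divide_simps)
qed

text \<open>A vector orthogonal to \<open>x\<close>, with the sign chosen by \<open>y\<close>. On the line there is no such vector when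
  \<open>x\<close> and \<open>y\<close> have opposite signs.\<close>

lemma exists_unit_inner_nonneg:
  fixes x y :: "'a::euclidean_space"
  assumes "2 \<le> DIM('a)"
  obtains e where "norm e = 1" "0 \<le> x \<bullet> e" "0 \<le> y \<bullet> e"
proof -
  obtain u where u: "u \<noteq> 0" "orthogonal x u"
    using orthogonal_to_vector_exists[OF assms, of x] by blast
  define e where "e = (if 0 \<le> y \<bullet> u then u /\<^sub>R norm u else - u /\<^sub>R norm u)"
  have "norm e = 1" "x \<bullet> e = 0" using u by (auto simp: e_def orthogonal_def)
  moreover have "0 \<le> y \<bullet> e" using u by (auto simp: e_def mult_nonneg_nonpos)
  ultimately show ?thesis using that by auto
qed

lemma exists_dyadic_scale:
  fixes \<rho> :: real
  assumes "1 \<le> \<rho>"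
  obtains n where "1 \<le> \<rho> / 2 ^ n" "\<rho> / 2 ^ n < 2"
proof -
  obtain N where "\<rho> < 2 ^ N" using real_arch_pow[of 2 \<rho>] by auto
  define k where "k = (LEAST k. \<rho> < 2 ^ k)"
  have k: "\<rho> < 2 ^ k" unfolding k_def by (rule LeastI) fact
  have "k \<noteq> 0" using k assms by (cases k) auto
  then obtain n where n: "k = Suc n" by (cases k) auto
  then have "\<not> \<rho> < 2 ^ n" using not_less_Least[of n "\<lambda>k. \<rho> < 2 ^ k"] by (simp add: k_def[symmetric])
  then show ?thesis using k n by (intro that[of n]) (auto simp: field_simps)
qed

locale decaying_potential = bounded_potential V K for V :: "'a::euclidean_space \<Rightarrow> real" and K +
  fixes \<alpha> :: real
  assumes \<alpha>: "0 < \<alpha>" "\<alpha> < 2"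
    and V_decay: "V z \<le> K * (1 + norm z) powr (- \<alpha>)"
begin

text \<open>In time \<open>r powr \<gamma>\<close> a move over distance \<open>r\<close> costs \<open>r\<^sup>2 / r powr \<gamma> = r powr \<beta>\<close>, and a potential of
  size \<open>r powr (- \<alpha>)\<close> costs \<open>r powr (\<gamma> - \<alpha>) = r powr \<beta>\<close> as well.\<close>

abbreviation "\<gamma> \<equiv> 1 + \<alpha> / 2"
abbreviation "\<beta> \<equiv> 1 - \<alpha> / 2"

text \<open>Within distance \<open>R / 2\<close> of \<open>m\<close> the decay of \<open>V\<close> applies, and outside only its bound \<open>K\<close>, on a
  Gaussian tail.\<close>

lemma mean_potential_far:
  assumes "0 < v" "0 < R" "R \<le> norm m"
  shows "mean_potential v m \<le> ennreal (K * ((R / 2) powr (- \<alpha>) + 2 powr (real DIM('a) / 2) * exp (- (R / 2)\<^sup>2 / (4 * v))))"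
proof -
  let ?far = "{w. R / 2 \<le> norm (w - m)}"
  let ?T = "2 powr (real DIM('a) / 2) * exp (- (R / 2)\<^sup>2 / (4 * v))"
  have V_split: "ennreal (V w) \<le> ennreal (K * (R / 2) powr (- \<alpha>)) + ennreal K * indicator ?far w" for w
  proof (cases "R / 2 \<le> norm w")
    case True
    have "V w \<le> K * (1 + norm w) powr (- \<alpha>)" by (rule V_decay)
    also have "\<dots> \<le> K * (R / 2) powr (- \<alpha>)"
      using True assms \<alpha> K_nonneg by (intro mult_left_mono powr_mono2') auto
    finally have "ennreal (V w) \<le> ennreal (K * (R / 2) powr (- \<alpha>))" by (rule ennreal_leI)
    then show ?thesis by (rule add_increasing2[rotated]) simp
  next
    case False
    have "norm m \<le> norm w + norm (w - m)" by (metis norm_minus_commute norm_triangle_sub)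
    then have "w \<in> ?far" using False assms by simp
    moreover have "ennreal (V w) \<le> ennreal K" by (intro ennreal_leI V_le)
    ultimately show ?thesis by (simp add: add_increasing)
  qed
  have "mean_potential v m
      \<le> (\<integral>\<^sup>+w. ennreal (heat v (w - m)) * (ennreal (K * (R / 2) powr (- \<alpha>)) + ennreal K * indicator ?far w) \<partial>lborel)"
    unfolding mean_potential_def by (intro nn_integral_mono mult_left_mono V_split) simp
  also have "\<dots> = (\<integral>\<^sup>+w. ennreal (heat v (w - m)) * ennreal (K * (R / 2) powr (- \<alpha>)) + ennreal K * (ennreal (heat v (w - m)) * indicator ?far w) \<partial>lborel)"
    by (simp only: distrib_left mult.left_commute)
  also have "\<dots> = ennreal (K * (R / 2) powr (- \<alpha>)) + ennreal K * (\<integral>\<^sup>+w. ennreal (heat v (w - m)) * indicator ?far w \<partial>lborel)"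
    using assms by (subst nn_integral_add) (simp_all add: nn_integral_multc nn_integral_cmult nn_integral_heat)
  also have "\<dots> \<le> ennreal (K * (R / 2) powr (- \<alpha>)) + ennreal K * ennreal ?T"
    using assms by (intro add_left_mono mult_left_mono nn_integral_heat_tail) auto
  also have "\<dots> = ennreal (K * ((R / 2) powr (- \<alpha>) + ?T))"
    using K_nonneg by (simp add: ennreal_mult[symmetric] ennreal_plus[symmetric] distrib_left del: ennreal_plus)
  finally show ?thesis .
qed

text \<open>The Gaussian tail is at most \<open>exp (- r powr \<beta> / 256)\<close> up to a constant, because \<open>v \<le> r powr \<gamma>\<close> and \<open>2 - \<gamma> = \<beta>\<close>;
  this is smaller than any power of \<open>r\<close>. For bounded \<open>r\<close> the bound \<open>K\<close> is good enough, wherever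
  \<open>m\<close> lies; this covers the first and last steps of a detour, which may pass through the origin.\<close>

lemma mean_potential_decay:
  obtains C where "0 < C"
    "\<And>r v m. 1 \<le> r \<Longrightarrow> 0 < v \<Longrightarrow> v \<le> r powr \<gamma> \<Longrightarrow> r / 4 \<le> norm m \<or> r \<le> 2 \<Longrightarrow>
        mean_potential v m \<le> ennreal (C * r powr (- \<alpha>))"
proof -
  define a where "a = \<alpha> / \<beta>"
  have a: "0 < a" "\<beta> * a = \<alpha>" using \<alpha> by (simp_all add: a_def)
  define A where "A = 8 powr \<alpha> + 2 powr (real DIM('a) / 2) * (256 * a) powr a"
  have A: "0 < A" unfolding A_def using a by (intro add_pos_pos mult_pos_pos) auto
  define C where "C = K * (A + 2 powr \<alpha>) + 1"
  have C: "0 < C" "K * A \<le> C" "K * 2 powr \<alpha> \<le> C"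
  proof -
    have "0 \<le> K * A" "0 \<le> K * 2 powr \<alpha>" using A K_nonneg by auto
    then show "0 < C" "K * A \<le> C" "K * 2 powr \<alpha> \<le> C" by (simp_all add: C_def distrib_left)
  qed
  show ?thesis
  proof (rule that[OF C(1)])
    fix r v :: real and m :: 'a
    assume r: "1 \<le> r" and v: "0 < v" "v \<le> r powr \<gamma>" and m: "r / 4 \<le> norm m \<or> r \<le> 2"
    show "mean_potential v m \<le> ennreal (C * r powr (- \<alpha>))"
    proof (cases "r \<le> 2")
      case True
      have "K = K * 2 powr \<alpha> * 2 powr (- \<alpha>)" by (simp add: powr_minus)
      also have "\<dots> \<le> C * r powr (- \<alpha>)"
        using C K_nonneg \<alpha> r True by (intro mult_mono powr_mono2') auto
      finally show ?thesis
        using mean_potential_le_bound[OF v(1), of m] by (meson ennreal_leI order_trans)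
    next
      case False
      then have "r / 4 \<le> norm m" using m by simp
      then have "mean_potential v m \<le> ennreal (K * ((r / 8) powr (- \<alpha>) + 2 powr (real DIM('a) / 2) * exp (- (r / 8)\<^sup>2 / (4 * v))))"
        using mean_potential_far[of v "r / 4" m] v r by simp
      also have "\<dots> \<le> ennreal (C * r powr (- \<alpha>))"
      proof (rule ennreal_leI)
        have "r powr \<beta> * v \<le> r powr \<beta> * r powr \<gamma>" using v by (intro mult_left_mono) auto
        also have "\<dots> = r\<^sup>2" using r by (simp add: powr_add[symmetric] powr_numeral)
        finally have "r powr \<beta> / 256 \<le> (r / 8)\<^sup>2 / (4 * v)"
          using v by (simp add: field_simps power2_eq_square)
        then have "exp (- (r / 8)\<^sup>2 / (4 * v)) \<le> exp (- (r powr \<beta> / 256))" by simp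
        also have "\<dots> \<le> (a / (r powr \<beta> / 256)) powr a"
          using a r by (intro exp_minus_le_powr) auto
        also have "\<dots> = (256 * a) powr a * r powr (- \<alpha>)"
        proof -
          have "a / (r powr \<beta> / 256) = (256 * a) * r powr (- \<beta>)"
            using r by (simp add: powr_minus field_simps)
          then have "(a / (r powr \<beta> / 256)) powr a = (256 * a) powr a * (r powr (- \<beta>)) powr a"
            using a by (simp add: powr_mult)
          also have "(r powr (- \<beta>)) powr a = r powr (- \<alpha>)"
            unfolding powr_powr using a by (metis mult_minus_left)
          finally show ?thesis .
        qed
        finally have "2 powr (real DIM('a) / 2) * exp (- (r / 8)\<^sup>2 / (4 * v))
            \<le> 2 powr (real DIM('a) / 2) * ((256 * a) powr a * r powr (- \<alpha>))"
          by (rule mult_left_mono) simp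
        moreover have "(r / 8) powr (- \<alpha>) = 8 powr \<alpha> * r powr (- \<alpha>)"
          using r powr_divide[of r 8 "- \<alpha>"] powr_minus_divide[of 8 \<alpha>] by simp
        ultimately have "(r / 8) powr (- \<alpha>) + 2 powr (real DIM('a) / 2) * exp (- (r / 8)\<^sup>2 / (4 * v)) \<le> A * r powr (- \<alpha>)"
          by (simp add: A_def algebra_simps)
        then have "K * ((r / 8) powr (- \<alpha>) + 2 powr (real DIM('a) / 2) * exp (- (r / 8)\<^sup>2 / (4 * v))) \<le> K * (A * r powr (- \<alpha>))"
          using K_nonneg by (rule mult_left_mono)
        also have "\<dots> \<le> C * r powr (- \<alpha>)"
          unfolding mult.assoc[symmetric] by (intro mult_right_mono C) auto
        finally show "K * ((r / 8) powr (- \<alpha>) + 2 powr (real DIM('a) / 2) * exp (- (r / 8)\<^sup>2 / (4 * v))) \<le> C * r powr (- \<alpha>)" .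
      qed
      finally show ?thesis .
    qed
  qed
qed

text \<open>The price of hitting a ball of fixed radius is a power of the duration, thus of \<open>r\<close>, and powers
  of \<open>r \<ge> 1\<close> are at most \<open>exp (C * r powr \<beta>)\<close>. Hence the radius need not grow with the scale.\<close>

lemma quarter_ball_mass:
  obtains \<mu> C where "0 < \<mu>" "\<And>q :: 'a. emeasure lborel (ball q (1 / 4)) = ennreal \<mu>" "0 < C"
    "\<And>r \<tau>. 1 \<le> r \<Longrightarrow> 0 < \<tau> \<Longrightarrow> \<tau> \<le> r powr \<gamma> \<Longrightarrow>
        exp (- C * r powr \<beta>) \<le> (2 * pi * \<tau>) powr (- real DIM('a) / 2) * \<mu>"
proof -
  define \<mu> where "\<mu> = measure lborel (ball (0::'a) (1 / 4))"
  have \<mu>: "0 < \<mu>" unfolding \<mu>_def by (rule content_ball_pos) simp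
  have em: "emeasure lborel (ball q (1 / 4)) = ennreal \<mu>" for q :: 'a
  proof -
    have "measure lborel (ball q (1 / 4)) = \<mu>"
      unfolding \<mu>_def by (subst (1 2) content_ball_conv_unit_ball) auto
    moreover have "emeasure lborel (ball q (1 / 4)) \<noteq> \<infinity>"
      using emeasure_lborel_ball_finite[of q "1 / 4"] by simp
    ultimately show ?thesis by (simp add: emeasure_eq_ennreal_measure)
  qed
  define d where "d = real DIM('a)"
  have d: "0 < d" by (simp add: d_def)
  define C where "C = d / 2 * (ln (2 * pi) + \<gamma> / \<beta>) + \<bar>ln \<mu>\<bar> + 1"
  have ln2pi: "0 \<le> ln (2 * pi)" using pi_gt3 by (intro ln_ge_zero) linarith
  have "0 \<le> d / 2 * (ln (2 * pi) + \<gamma> / \<beta>)" using d ln2pi \<alpha> by (intro mult_nonneg_nonneg add_nonneg_nonneg divide_nonneg_nonneg) auto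
  then have C: "0 < C" by (simp add: C_def add_nonneg_pos)
  show ?thesis
  proof (rule that[OF \<mu> em C])
    fix r \<tau> :: real assume r: "1 \<le> r" and \<tau>: "0 < \<tau>" "\<tau> \<le> r powr \<gamma>"
    have b: "0 < \<beta>" using \<alpha> by simp
    have rb: "1 \<le> r powr \<beta>" using r b by (intro ge_one_powr_ge_zero) auto
    have "\<beta> * ln r = ln (r powr \<beta>)" using r by (simp add: ln_powr)
    also have "\<dots> \<le> r powr \<beta>" using rb ln_le_minus_one[of "r powr \<beta>"] by linarith
    finally have lnr: "ln r \<le> r powr \<beta> / \<beta>" using b by (simp add: field_simps)
    have "\<gamma> * ln r \<le> \<gamma> * (r powr \<beta> / \<beta>)" using lnr \<alpha> by (intro mult_left_mono) auto
    moreover have "ln (2 * pi) \<le> ln (2 * pi) * r powr \<beta>" using ln2pi rb by (simp add: mult_le_cancel_left1)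
    ultimately have "ln (2 * pi) + \<gamma> * ln r \<le> (ln (2 * pi) + \<gamma> / \<beta>) * r powr \<beta>"
      by (simp add: distrib_right)
    then have "d / 2 * (ln (2 * pi) + \<gamma> * ln r) \<le> d / 2 * ((ln (2 * pi) + \<gamma> / \<beta>) * r powr \<beta>)"
      using d by (intro mult_left_mono) auto
    moreover have "- ln \<mu> \<le> (\<bar>ln \<mu>\<bar> + 1) * r powr \<beta>"
    proof -
      have "- ln \<mu> \<le> (\<bar>ln \<mu>\<bar> + 1) * 1" by simp
      also have "\<dots> \<le> (\<bar>ln \<mu>\<bar> + 1) * r powr \<beta>" using rb by (intro mult_left_mono) auto
      finally show ?thesis .
    qed
    moreover have "C * r powr \<beta> = d / 2 * ((ln (2 * pi) + \<gamma> / \<beta>) * r powr \<beta>) + (\<bar>ln \<mu>\<bar> + 1) * r powr \<beta>"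
      by (simp only: C_def distrib_right[of _ _ "r powr \<beta>"] mult.assoc mult_1_left add.assoc)
    ultimately have "d / 2 * (ln (2 * pi) + \<gamma> * ln r) - ln \<mu> \<le> C * r powr \<beta>"
      by linarith
    then have "exp (- C * r powr \<beta>) \<le> exp (- d / 2 * (ln (2 * pi) + \<gamma> * ln r) + ln \<mu>)" by simp
    also have "\<dots> = exp (- d / 2 * (ln (2 * pi) + \<gamma> * ln r)) * \<mu>"
      using \<mu> by (simp only: exp_add exp_ln)
    also have "ln (2 * pi) + \<gamma> * ln r = ln (2 * pi * r powr \<gamma>)"
      using r by (simp add: ln_mult ln_powr)
    also have "exp (- d / 2 * ln (2 * pi * r powr \<gamma>)) = (2 * pi * r powr \<gamma>) powr (- d / 2)"
      using r by (simp add: powr_def)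
    also have "(2 * pi * r powr \<gamma>) powr (- d / 2) * \<mu> \<le> (2 * pi * \<tau>) powr (- d / 2) * \<mu>"
      using \<tau> d \<mu> by (intro mult_right_mono powr_mono2') auto
    finally show "exp (- C * r powr \<beta>) \<le> (2 * pi * \<tau>) powr (- real DIM('a) / 2) * \<mu>" by (simp add: d_def)
  qed
qed

lemma norm_ge_on_segment:
  fixes e :: 'a
  assumes "norm e = 1" "h \<le> z \<bullet> e" "h \<le> z' \<bullet> e" "c \<in> closed_segment z z'"
  shows "h \<le> norm c"
proof -
  have "closed_segment z z' \<subseteq> {u. h \<le> e \<bullet> u}"
    using assms(2,3) by (intro closed_segment_subset convex_halfspace_ge) (auto simp: inner_commute)
  then have "h \<le> e \<bullet> c" using assms(4) by auto
  also have "\<dots> \<le> norm c" using norm_cauchy_schwarz[of e c] assms(1) by simp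
  finally show ?thesis .
qed

text \<open>One step of a detour, at scale \<open>r\<close>: all points stay at height at least \<open>r / 4\<close> in direction \<open>e\<close>, or else the
  scale is bounded. The same exponent measures the loss of mass and the action.\<close>

lemma steerable_move:
  obtains C where "0 < C"
    "\<And>r \<tau> S q D e t f m E. 1 \<le> r \<Longrightarrow> 0 < \<tau> \<Longrightarrow> \<tau> \<le> r powr \<gamma> \<Longrightarrow> norm e = 1 \<Longrightarrow>
       (\<forall>z\<in>S \<union> ball q (1 / 4). r / 4 \<le> z \<bullet> e) \<or> r \<le> 2 \<Longrightarrow>
       0 \<le> D \<Longrightarrow> (\<And>z. z \<in> S \<Longrightarrow> norm (q - z) + 1 / 4 \<le> D) \<Longrightarrow>
       0 \<le> m \<Longrightarrow> 0 \<le> E \<Longrightarrow> steerable t (ball q (1 / 4)) f (m * exp (- E)) E \<Longrightarrow>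
       steerable (\<tau> + t) S f (m * exp (- (D\<^sup>2 / \<tau> + C * r powr \<beta> + E))) (D\<^sup>2 / \<tau> + C * r powr \<beta> + E)"
proof -
  obtain A where A: "0 < A"
    "\<And>r v m. 1 \<le> r \<Longrightarrow> 0 < v \<Longrightarrow> v \<le> r powr \<gamma> \<Longrightarrow> r / 4 \<le> norm m \<or> r \<le> 2 \<Longrightarrow>
        mean_potential v m \<le> ennreal (A * r powr (- \<alpha>))"
    using mean_potential_decay by blast
  obtain \<mu> C' where \<mu>: "0 < \<mu>" "\<And>q :: 'a. emeasure lborel (ball q (1 / 4)) = ennreal \<mu>" and C': "0 < C'"
    "\<And>r \<tau>. 1 \<le> r \<Longrightarrow> 0 < \<tau> \<Longrightarrow> \<tau> \<le> r powr \<gamma> \<Longrightarrow>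
        exp (- C' * r powr \<beta>) \<le> (2 * pi * \<tau>) powr (- real DIM('a) / 2) * \<mu>"
    using quarter_ball_mass by blast
  show ?thesis
  proof (rule that[of "A + C'"])
    show "0 < A + C'" using A C' by simp
    fix r \<tau> D t m E :: real and S and q e :: 'a and f
    assume r: "1 \<le> r" and \<tau>: "0 < \<tau>" "\<tau> \<le> r powr \<gamma>" and e: "norm e = 1"
      and away: "(\<forall>z\<in>S \<union> ball q (1 / 4). r / 4 \<le> z \<bullet> e) \<or> r \<le> 2"
      and D: "0 \<le> D" "\<And>z. z \<in> S \<Longrightarrow> norm (q - z) + 1 / 4 \<le> D"
      and m: "0 \<le> m" and E: "0 \<le> E" and st: "steerable t (ball q (1 / 4)) f (m * exp (- E)) E"
    let ?G = "(2 * pi * \<tau>) powr (- real DIM('a) / 2)"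
    let ?\<Delta> = "D\<^sup>2 / \<tau> + (A + C') * r powr \<beta>"
    have "steerable (\<tau> + t) S f (?G * exp (- D\<^sup>2 / (2 * \<tau>)) * \<mu> * (m * exp (- E))) (A * r powr (- \<alpha>) * \<tau> + E)"
    proof (rule steerable_step[OF st \<tau>(1)])
      show "ennreal \<mu> \<le> emeasure lborel (ball q (1 / 4))" by (simp add: \<mu>)
      show "norm (z' - z) \<le> D" if "z \<in> S" "z' \<in> ball q (1 / 4)" for z z'
      proof -
        have "norm (z' - z) \<le> norm (q - z) + norm (z' - q)" using norm_triangle_ineq[of "q - z" "z' - q"] by simp
        also have "norm (z' - q) \<le> 1 / 4" using that by (simp add: dist_norm norm_minus_commute)
        finally show ?thesis using D(2)[OF that(1)] by simp
      qed
      show "mean_potential v c \<le> ennreal (A * r powr (- \<alpha>))"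
        if "z \<in> S" "z' \<in> ball q (1 / 4)" "c \<in> closed_segment z z'" "0 < v" "v \<le> \<tau>" for z z' c v
      proof (rule A(2)[OF r])
        show "r / 4 \<le> norm c \<or> r \<le> 2"
          using away norm_ge_on_segment[OF e _ _ that(3), of "r / 4"] that by blast
      qed (use that \<tau> in auto)
    qed (use A r D m E \<mu> in auto)
    then show "steerable (\<tau> + t) S f (m * exp (- (?\<Delta> + E))) (?\<Delta> + E)"
    proof (rule steerable_mono)
      have "exp (- (?\<Delta> + E)) \<le> exp (- C' * r powr \<beta>) * exp (- D\<^sup>2 / (2 * \<tau>)) * exp (- E)"
      proof -
        have "D\<^sup>2 / (2 * \<tau>) \<le> D\<^sup>2 / \<tau>" using \<tau> by (intro divide_left_mono) auto
        moreover have "0 \<le> A * r powr \<beta>" using A by simp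
        ultimately have "- (?\<Delta> + E) \<le> - C' * r powr \<beta> + (- D\<^sup>2 / (2 * \<tau>)) + (- E)"
          by (simp add: distrib_right)
        then show ?thesis unfolding exp_add[symmetric] by simp
      qed
      also have "\<dots> \<le> (?G * \<mu>) * exp (- D\<^sup>2 / (2 * \<tau>)) * exp (- E)"
        using C'(2)[OF r \<tau>] by (intro mult_right_mono) auto
      finally have "m * exp (- (?\<Delta> + E)) \<le> m * ((?G * \<mu>) * exp (- D\<^sup>2 / (2 * \<tau>)) * exp (- E))"
        using m by (rule mult_left_mono)
      then show "m * exp (- (?\<Delta> + E)) \<le> ?G * exp (- D\<^sup>2 / (2 * \<tau>)) * \<mu> * (m * exp (- E))"
        by (simp add: ac_simps)
      have "A * r powr (- \<alpha>) * \<tau> \<le> A * r powr (- \<alpha>) * r powr \<gamma>" using A \<tau> by (intro mult_left_mono) auto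
      also have "\<dots> = A * r powr \<beta>" using r by (simp add: powr_add[symmetric])
      also have "\<dots> \<le> ?\<Delta>" using \<tau> C' by (simp add: distrib_right)
      finally show "A * r powr (- \<alpha>) * \<tau> + E \<le> ?\<Delta> + E" by simp
    qed
  qed
qed

text \<open>One point is at distance \<open>R\<close> from the origin and the other within \<open>R / 2\<close> of it, so the segment
  stays at distance at least \<open>R / 4\<close>.\<close>

lemma steerable_direct:
  obtains C where "0 < C"
    "\<And>R t x y f m. 1 \<le> R \<Longrightarrow> 0 < t \<Longrightarrow> t \<le> R powr \<gamma> \<Longrightarrow> norm (x - y) \<le> R / 2 \<Longrightarrow> norm x = R \<or> norm y = R \<Longrightarrow>
       f \<in> borel_measurable borel \<Longrightarrow> 0 \<le> m \<Longrightarrow> ennreal m \<le> (\<integral>\<^sup>+z. ennreal (f z) \<partial>lborel) \<Longrightarrow>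
       (\<And>z. f z \<noteq> 0 \<Longrightarrow> norm (z - y) \<le> 1 / 4) \<Longrightarrow>
       steerable t {x} f ((2 * pi * t) powr (- real DIM('a) / 2) * exp (- (norm (x - y) + 1 / 4)\<^sup>2 / (2 * t)) * m)
         (C * R powr (- \<alpha>) * t)"
proof -
  obtain A where A: "0 < A"
    "\<And>r v m. 1 \<le> r \<Longrightarrow> 0 < v \<Longrightarrow> v \<le> r powr \<gamma> \<Longrightarrow> r / 4 \<le> norm m \<or> r \<le> 2 \<Longrightarrow>
        mean_potential v m \<le> ennreal (A * r powr (- \<alpha>))"
    using mean_potential_decay by blast
  show ?thesis
  proof (rule that[OF A(1)])
    fix R t m :: real and x y :: 'a and f :: "'a \<Rightarrow> real"
    assume R: "1 \<le> R" and t: "0 < t" "t \<le> R powr \<gamma>" and xy: "norm (x - y) \<le> R / 2" "norm x = R \<or> norm y = R"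
      and f: "f \<in> borel_measurable borel" "0 \<le> m" "ennreal m \<le> (\<integral>\<^sup>+z. ennreal (f z) \<partial>lborel)"
      and supp: "\<And>z. f z \<noteq> 0 \<Longrightarrow> norm (z - y) \<le> 1 / 4"
    show "steerable t {x} f ((2 * pi * t) powr (- real DIM('a) / 2) * exp (- (norm (x - y) + 1 / 4)\<^sup>2 / (2 * t)) * m)
         (A * R powr (- \<alpha>) * t)"
    proof (rule steerable_final)
      show "norm (z' - z) \<le> norm (x - y) + 1 / 4" if "z \<in> {x}" "f z' \<noteq> 0" for z z'
      proof -
        have "norm (z' - x) \<le> norm (x - y) + norm (z' - y)"
          using norm_triangle_ineq[of "y - x" "z' - y"] by (simp add: norm_minus_commute)
        then show ?thesis using supp[OF that(2)] that(1) by simp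
      qed
      show "mean_potential v c \<le> ennreal (A * R powr (- \<alpha>))"
        if "z \<in> {x}" "f z' \<noteq> 0" "c \<in> closed_segment z z'" "0 < v" "v \<le> t" for z z' c v
      proof (rule A(2)[OF R])
        have "R / 4 \<le> norm c"
        proof (cases "norm y = R")
          case True
          have "closed_segment x z' \<subseteq> cball y (R / 2)"
            using xy supp[OF that(2)] R by (intro closed_segment_subset) (auto simp: dist_norm norm_minus_commute)
          then have "norm (y - c) \<le> R / 2" using that by (auto simp: dist_norm)
          then show ?thesis using True norm_triangle_sub[of y c] R by simp
        next
          case False
          then have nx: "norm x = R" using xy by simp
          have "norm (z' - x) \<le> norm (x - y) + norm (z' - y)"
            using norm_triangle_ineq[of "y - x" "z' - y"] by (simp add: norm_minus_commute)
          then have "closed_segment x z' \<subseteq> cball x (R / 2 + 1 / 4)"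
            using xy supp[OF that(2)] R by (intro closed_segment_subset) (auto simp: dist_norm norm_minus_commute)
          then have "norm (x - c) \<le> R / 2 + 1 / 4" using that by (auto simp: dist_norm)
          then show ?thesis using nx norm_triangle_sub[of x c] R by simp
        qed
        then show "R / 4 \<le> norm c \<or> R \<le> 2" by simp
      qed (use that t in auto)
    qed (use A R t f in auto)
  qed
qed


text \<open>The schedule is built backwards from its end at \<open>y\<close>: from the innermost level outwards along \<open>y + r\<^sub>j e\<close>, across to \<open>x + \<rho> e\<close>, and inwards
  along \<open>x + r\<^sub>j e\<close> to \<open>x\<close>, with \<open>r\<^sub>j = \<rho> / 2 ^ j\<close> and \<open>j\<close> up to the scale of order one. Since a move between
  the levels \<open>j\<close> and \<open>j + 1\<close> takes the time \<open>\<tau>\<^sub>j\<close>, proportional to \<open>r\<^sub>j powr \<gamma>\<close>, it costs at most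
  \<open>\<delta>\<^sub>j = A * (\<rho>\<^sup>2 / t) * Q ^ j\<close> with \<open>Q = 2 powr (- \<beta>) < 1\<close>.\<close>

lemma steerable_detour:
  assumes dim: "2 \<le> DIM('a)"
  obtains C where "0 < C"
    "\<And>\<rho> t x y f m. 1 \<le> \<rho> \<Longrightarrow> 0 < t \<Longrightarrow> t \<le> \<rho> powr \<gamma> \<Longrightarrow> norm x \<le> \<rho> \<Longrightarrow> norm y \<le> \<rho> \<Longrightarrow>
       f \<in> borel_measurable borel \<Longrightarrow> 0 \<le> m \<Longrightarrow> ennreal m \<le> (\<integral>\<^sup>+z. ennreal (f z) \<partial>lborel) \<Longrightarrow>
       (\<And>z. f z \<noteq> 0 \<Longrightarrow> norm (z - y) \<le> 1 / 4) \<Longrightarrow>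
       steerable t {x} f ((2 * pi * t) powr (- real DIM('a) / 2) * m * exp (- (C * (\<rho>\<^sup>2 / t)))) (C * (\<rho>\<^sup>2 / t))"
proof -
  obtain C\<^sub>0 where C\<^sub>0: "0 < C\<^sub>0" and move:
    "\<And>r \<tau> S q D e t f m E. 1 \<le> r \<Longrightarrow> 0 < \<tau> \<Longrightarrow> \<tau> \<le> r powr \<gamma> \<Longrightarrow> norm e = 1 \<Longrightarrow>
       (\<forall>z\<in>S \<union> ball q (1 / 4). r / 4 \<le> z \<bullet> e) \<or> r \<le> 2 \<Longrightarrow>
       0 \<le> D \<Longrightarrow> (\<And>z. z \<in> S \<Longrightarrow> norm (q - z) + 1 / 4 \<le> D) \<Longrightarrow>
       0 \<le> m \<Longrightarrow> 0 \<le> E \<Longrightarrow> steerable t (ball q (1 / 4)) f (m * exp (- E)) E \<Longrightarrow>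
       steerable (\<tau> + t) S f (m * exp (- (D\<^sup>2 / \<tau> + C\<^sub>0 * r powr \<beta> + E))) (D\<^sup>2 / \<tau> + C\<^sub>0 * r powr \<beta> + E)"
    using steerable_move by blast
  obtain C\<^sub>1 where C\<^sub>1: "0 < C\<^sub>1"
    "\<And>r v m. 1 \<le> r \<Longrightarrow> 0 < v \<Longrightarrow> v \<le> r powr \<gamma> \<Longrightarrow> r / 4 \<le> norm m \<or> r \<le> 2 \<Longrightarrow>
        mean_potential v m \<le> ennreal (C\<^sub>1 * r powr (- \<alpha>))"
    using mean_potential_decay by blast
  define A where "A = 32 + C\<^sub>0 + C\<^sub>1"
  define Q where "Q = (2::real) powr (- \<beta>)"
  have A: "0 < A" using C\<^sub>0 C\<^sub>1 by (simp add: A_def)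
  have Q: "0 < Q" "Q < 1" using \<alpha> powr_less_mono[of "- \<beta>" 0 2] by (simp_all add: Q_def)
  define C where "C = (2 / (1 - Q) + 1) * A"
  have C: "0 < C" unfolding C_def using Q A by (intro mult_pos_pos add_pos_pos) auto
  show ?thesis
  proof (rule that[OF C])
    fix \<rho> t m :: real and x y :: 'a and f :: "'a \<Rightarrow> real"
    assume \<rho>: "1 \<le> \<rho>" and t: "0 < t" "t \<le> \<rho> powr \<gamma>" and xy: "norm x \<le> \<rho>" "norm y \<le> \<rho>"
      and f: "f \<in> borel_measurable borel" and m: "0 \<le> m" "ennreal m \<le> (\<integral>\<^sup>+z. ennreal (f z) \<partial>lborel)"
      and supp: "\<And>z. f z \<noteq> 0 \<Longrightarrow> norm (z - y) \<le> 1 / 4"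
    obtain e where e: "norm e = 1" "0 \<le> x \<bullet> e" "0 \<le> y \<bullet> e"
      using exists_unit_inner_nonneg[OF dim] by blast
    obtain n where n: "1 \<le> \<rho> / 2 ^ n" "\<rho> / 2 ^ n < 2"
      using exists_dyadic_scale[OF \<rho>] by blast
    define r where "r j = \<rho> / 2 ^ j" for j :: nat
    define \<tau> where "\<tau> j = t / 8 * (1 / 2 ^ j) powr \<gamma>" for j :: nat
    define \<Lambda> where "\<Lambda> = \<rho>\<^sup>2 / t"
    define \<delta> where "\<delta> j = A * \<Lambda> * Q ^ j" for j :: nat
    define M where "M = (2 * pi * t) powr (- real DIM('a) / 2) * m"
    have \<Lambda>: "0 < \<Lambda>" using \<rho> t by (simp add: \<Lambda>_def)
    have \<delta>: "0 \<le> \<delta> j" for j using A \<Lambda> Q by (simp add: \<delta>_def)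
    have M: "0 \<le> M" using m by (simp add: M_def)
    have r_ge: "1 \<le> r j" if "j \<le> n" for j
    proof -
      have "(2::real) ^ j \<le> 2 ^ n" using that by (intro power_increasing) auto
      then have "\<rho> / 2 ^ n \<le> \<rho> / 2 ^ j" using \<rho> by (intro divide_left_mono) auto
      then show ?thesis using n(1) unfolding r_def by linarith
    qed
    have r0: "r 0 = \<rho>" and r_Suc: "r (Suc j) = r j / 2" for j by (simp_all add: r_def)
    have Q_pow: "Q ^ j = (1 / 2 ^ j) powr \<beta>" for j
    proof -
      have "Q ^ j = Q powr real j" using Q by (simp add: powr_realpow)
      also have "\<dots> = 2 powr (- \<beta> * real j)" by (simp only: Q_def powr_powr)
      also have "- \<beta> * real j = - real j * \<beta>" by (simp add: algebra_simps)
      also have "2 powr (- real j * \<beta>) = (2 powr (- real j)) powr \<beta>" by (simp only: powr_powr)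
      also have "2 powr (- real j) = 1 / 2 ^ j" by (simp add: powr_minus_divide powr_realpow)
      finally show ?thesis .
    qed
    have \<tau>_pos: "0 < \<tau> j" for j using t by (simp add: \<tau>_def)
    have half_le: "(1 / 2 ^ j) powr \<gamma> \<le> (1 / 2 ^ j :: real)" for j :: nat
      using \<alpha> powr_mono'[of 1 \<gamma> "1 / 2 ^ j :: real"] by (simp add: divide_simps)
    have \<tau>_le: "\<tau> j \<le> r j powr \<gamma>" for j
    proof -
      have "\<tau> j \<le> \<rho> powr \<gamma> * (1 / 2 ^ j) powr \<gamma>"
        unfolding \<tau>_def using t by (intro mult_right_mono) auto
      also have "\<dots> = r j powr \<gamma>" using \<rho> by (simp add: r_def powr_mult[symmetric])
      finally show ?thesis .
    qed
    \<comment> \<open>The factor \<open>1 / 8\<close> in \<open>\<tau>\<close> leaves at least half of the time for the crossing.\<close>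
    have \<tau>_sum: "(\<Sum>j\<le>n. \<tau> j) \<le> t / 4"
    proof -
      have "(\<Sum>j\<le>n. \<tau> j) \<le> (\<Sum>j\<le>n. t / 8 * (1 / 2) ^ j)"
        unfolding \<tau>_def using t half_le by (intro sum_mono mult_left_mono) (auto simp: power_one_over)
      also have "\<dots> = t / 8 * (\<Sum>j\<le>n. (1 / 2) ^ j)" by (simp add: sum_distrib_left)
      also have "(\<Sum>j\<le>n. (1 / 2 :: real) ^ j) \<le> 2" by (simp add: sum_gp0)
      finally show ?thesis using t by simp
    qed
    have Q_sum: "(\<Sum>j\<le>n. \<delta> j) \<le> A * \<Lambda> * (1 / (1 - Q))"
    proof -
      have "(\<Sum>j\<le>n. \<delta> j) = A * \<Lambda> * (\<Sum>j\<le>n. Q ^ j)" by (simp add: \<delta>_def sum_distrib_left)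
      also have "(\<Sum>j\<le>n. Q ^ j) \<le> 1 / (1 - Q)" using Q by (simp add: sum_gp0 divide_right_mono)
      finally show ?thesis using A \<Lambda> by (simp add: mult_left_mono)
    qed
    have speed: "(r j)\<^sup>2 / \<tau> j = 8 * \<Lambda> * Q ^ j" for j
    proof -
      define b where "b = (1 / 2 ^ j :: real)"
      have b: "0 < b" by (simp add: b_def)
      have "b powr \<gamma> * b powr \<beta> = b\<^sup>2" using b by (simp add: powr_add[symmetric] powr_numeral)
      then have "b\<^sup>2 / b powr \<gamma> = b powr \<beta>" using b by (simp add: field_simps)
      moreover have "(r j)\<^sup>2 / \<tau> j = 8 * \<Lambda> * (b\<^sup>2 / b powr \<gamma>)"
        by (simp add: r_def \<tau>_def \<Lambda>_def b_def power_divide ac_simps)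
      ultimately show ?thesis by (simp add: Q_pow b_def)
    qed
    have \<rho>\<beta>: "\<rho> powr \<beta> \<le> \<Lambda>"
    proof -
      have "\<rho> powr \<beta> * t \<le> \<rho> powr \<beta> * \<rho> powr \<gamma>" using t by (intro mult_left_mono) auto
      also have "\<dots> = \<rho>\<^sup>2" using \<rho> by (simp add: powr_add[symmetric] powr_numeral)
      finally show ?thesis using t by (simp add: \<Lambda>_def field_simps)
    qed
    have r\<beta>: "r j powr \<beta> \<le> \<Lambda> * Q ^ j" for j
    proof -
      have "r j powr \<beta> = \<rho> powr \<beta> * (1 / 2 ^ j) powr \<beta>" using \<rho> by (simp add: r_def powr_mult[symmetric])
      also have "\<dots> \<le> \<Lambda> * Q ^ j" unfolding Q_pow using \<rho>\<beta> by (intro mult_right_mono) auto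
      finally show ?thesis .
    qed
    have cost_le: "(2 * r j)\<^sup>2 / \<tau> j + C\<^sub>0 * r j powr \<beta> + C\<^sub>1 * r j powr \<beta> \<le> \<delta> j" for j
    proof -
      have "(2 * r j)\<^sup>2 / \<tau> j = 32 * (\<Lambda> * Q ^ j)"
        using speed[of j] by (simp add: power_mult_distrib)
      moreover have "C\<^sub>0 * r j powr \<beta> \<le> C\<^sub>0 * (\<Lambda> * Q ^ j)" "C\<^sub>1 * r j powr \<beta> \<le> C\<^sub>1 * (\<Lambda> * Q ^ j)"
        using r\<beta> C\<^sub>0 C\<^sub>1 by (auto intro!: mult_left_mono)
      moreover have "\<delta> j = 32 * (\<Lambda> * Q ^ j) + C\<^sub>0 * (\<Lambda> * Q ^ j) + C\<^sub>1 * (\<Lambda> * Q ^ j)"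
        by (simp add: \<delta>_def A_def distrib_right)
      ultimately show ?thesis by linarith
    qed
    have level_step: "steerable (\<tau> j + T) S f (M * exp (- (\<delta> j + E))) (\<delta> j + E)"
      if "j \<le> n" "(\<forall>z\<in>S \<union> ball q (1 / 4). r j / 4 \<le> z \<bullet> e) \<or> r j \<le> 2"
        "\<And>z. z \<in> S \<Longrightarrow> norm (q - z) + 1 / 4 \<le> 2 * r j" "0 \<le> E"
        "steerable T (ball q (1 / 4)) f (M * exp (- E)) E" for j S q T E
    proof (rule steerable_mono)
      show "steerable (\<tau> j + T) S f (M * exp (- ((2 * r j)\<^sup>2 / \<tau> j + C\<^sub>0 * r j powr \<beta> + E))) ((2 * r j)\<^sup>2 / \<tau> j + C\<^sub>0 * r j powr \<beta> + E)"
        by (rule move[OF r_ge[OF that(1)] \<tau>_pos \<tau>_le e(1) that(2) _ that(3) M that(4,5)]) (use r_ge[OF that(1)] in auto)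
      have le: "(2 * r j)\<^sup>2 / \<tau> j + C\<^sub>0 * r j powr \<beta> \<le> \<delta> j"
        using cost_le[of j] C\<^sub>1 by (smt (verit) mult_nonneg_nonneg powr_ge_zero)
      then show "(2 * r j)\<^sup>2 / \<tau> j + C\<^sub>0 * r j powr \<beta> + E \<le> \<delta> j + E" by simp
      show "M * exp (- (\<delta> j + E)) \<le> M * exp (- ((2 * r j)\<^sup>2 / \<tau> j + C\<^sub>0 * r j powr \<beta> + E))"
        using le M by (intro mult_left_mono) auto
    qed
    \<comment> \<open>The base points have nonnegative height, so only the radius of the ball is lost.\<close>
    have inner_near: "h - 1 / 4 \<le> z \<bullet> e" if "z \<in> ball (p + h *\<^sub>R e) (1 / 4)" "0 \<le> p \<bullet> e" for z p h
    proof -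
      have ee: "e \<bullet> e = 1" using e by (simp add: norm_eq_1)
      have "(p + h *\<^sub>R e - z) \<bullet> e \<le> norm (p + h *\<^sub>R e - z) * norm e" by (rule norm_cauchy_schwarz)
      also have "\<dots> \<le> 1 / 4" using that e by (simp add: dist_norm)
      finally show ?thesis using that ee by (simp add: inner_diff_left inner_add_left)
    qed
    have dist_near: "norm (p + h' *\<^sub>R e - z) + 1 / 4 \<le> \<bar>h' - h\<bar> + 1 / 2" if "z \<in> ball (p + h *\<^sub>R e) (1 / 4)" for z p h h'
    proof -
      have "norm (p + h' *\<^sub>R e - z) = norm ((h' - h) *\<^sub>R e + (p + h *\<^sub>R e - z))" by (simp add: algebra_simps)
      also have "\<dots> \<le> norm ((h' - h) *\<^sub>R e) + norm (p + h *\<^sub>R e - z)" by (rule norm_triangle_ineq)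
      also have "\<dots> \<le> \<bar>h' - h\<bar> + 1 / 4" using that e by (simp add: dist_norm)
      finally show ?thesis by simp
    qed
    \<comment> \<open>From level \<open>j\<close> above \<open>y\<close> down to \<open>y\<close>.\<close>
    have inward: "steerable (\<Sum>i=j..n. \<tau> i) (ball (y + r j *\<^sub>R e) (1 / 4)) f (M * exp (- (\<Sum>i=j..n. \<delta> i))) (\<Sum>i=j..n. \<delta> i)"
      if "j \<le> n" for j
      using that
    proof (induction j rule: inc_induct)
      case base
      have "steerable (\<tau> n) (ball (y + r n *\<^sub>R e) (1 / 4)) f
          ((2 * pi * \<tau> n) powr (- real DIM('a) / 2) * exp (- (2 * r n)\<^sup>2 / (2 * \<tau> n)) * m) (C\<^sub>1 * r n powr (- \<alpha>) * \<tau> n)"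
      proof (rule steerable_final[OF \<tau>_pos _ _ f m])
        show "norm (z' - z) \<le> 2 * r n" if "z \<in> ball (y + r n *\<^sub>R e) (1 / 4)" "f z' \<noteq> 0" for z z'
        proof -
          have "norm (y - z) + 1 / 4 \<le> r n + 1 / 2" using dist_near[OF that(1), of 0] r_ge[of n] by simp
          moreover have "norm (z' - z) \<le> norm (y - z) + norm (z' - y)"
            using norm_triangle_ineq[of "y - z" "z' - y"] by simp
          ultimately show ?thesis using supp[OF that(2)] r_ge[of n] by simp
        qed
        show "mean_potential v c \<le> ennreal (C\<^sub>1 * r n powr (- \<alpha>))"
          if "0 < v" "v \<le> \<tau> n" for v c
          using C\<^sub>1(2)[of "r n" v c] that \<tau>_le[of n] n r_ge[of n] by (simp add: r_def)
      qed (use C\<^sub>1 r_ge[of n] in auto)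
      then have "steerable (\<tau> n) (ball (y + r n *\<^sub>R e) (1 / 4)) f (M * exp (- \<delta> n)) (\<delta> n)"
      proof (rule steerable_mono)
        have "C\<^sub>1 * r n powr (- \<alpha>) * \<tau> n \<le> C\<^sub>1 * r n powr (- \<alpha>) * r n powr \<gamma>"
          using C\<^sub>1 \<tau>_le by (intro mult_left_mono) auto
        also have "\<dots> = C\<^sub>1 * r n powr \<beta>" using r_ge[of n] by (simp add: powr_add[symmetric])
        also have "\<dots> \<le> \<delta> n"
          using cost_le[of n] C\<^sub>0 \<tau>_pos[of n] by (smt (verit) mult_nonneg_nonneg powr_ge_zero zero_le_divide_iff zero_le_power2)
        finally show "C\<^sub>1 * r n powr (- \<alpha>) * \<tau> n \<le> \<delta> n" .
        have "(2 * r n)\<^sup>2 / (2 * \<tau> n) \<le> (2 * r n)\<^sup>2 / \<tau> n" using \<tau>_pos[of n] by (intro divide_left_mono) auto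
        also have "\<dots> \<le> \<delta> n"
          using cost_le[of n] C\<^sub>0 C\<^sub>1 by (smt (verit) mult_nonneg_nonneg powr_ge_zero)
        finally have "exp (- \<delta> n) \<le> exp (- (2 * r n)\<^sup>2 / (2 * \<tau> n))" by simp
        moreover have "(2 * pi * t) powr (- real DIM('a) / 2) \<le> (2 * pi * \<tau> n) powr (- real DIM('a) / 2)"
        proof (rule powr_mono2')
          have "(1 / 2 ^ n :: real) \<le> 1" by simp
          then have "(1 / 2 ^ n) powr \<gamma> \<le> (1::real)" using half_le[of n] by linarith
          then have "t / 8 * (1 / 2 ^ n) powr \<gamma> \<le> t / 8 * 1" using t by (intro mult_left_mono) auto
          then show "2 * pi * \<tau> n \<le> 2 * pi * t" using t by (simp add: \<tau>_def)
        qed (use \<tau>_pos in auto)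
        ultimately have "(2 * pi * t) powr (- real DIM('a) / 2) * exp (- \<delta> n) * m
            \<le> (2 * pi * \<tau> n) powr (- real DIM('a) / 2) * exp (- (2 * r n)\<^sup>2 / (2 * \<tau> n)) * m"
          using m by (intro mult_right_mono mult_mono) auto
        then show "M * exp (- \<delta> n) \<le> (2 * pi * \<tau> n) powr (- real DIM('a) / 2) * exp (- (2 * r n)\<^sup>2 / (2 * \<tau> n)) * m"
          by (simp add: M_def mult.commute mult.left_commute)
      qed
      then show ?case by simp
    next
      case (step j)
      have rj: "1 \<le> r j" using r_ge step.hyps by simp
      have sums: "(\<Sum>i=j..n. g i) = g j + (\<Sum>i=Suc j..n. g i)" for g :: "nat \<Rightarrow> real"
        using step.hyps by (simp add: sum.atLeast_Suc_atMost)
      show ?case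
        unfolding sums
      proof (rule level_step[OF _ _ _ _ step.IH])
        have "r j / 4 \<le> z \<bullet> e" if "z \<in> ball (y + r j *\<^sub>R e) (1 / 4) \<union> ball (y + r (Suc j) *\<^sub>R e) (1 / 4)" for z
          using that inner_near[of z y "r j"] inner_near[of z y "r (Suc j)"] e rj by (auto simp: r_Suc)
        then show "(\<forall>z\<in>ball (y + r j *\<^sub>R e) (1 / 4) \<union> ball (y + r (Suc j) *\<^sub>R e) (1 / 4). r j / 4 \<le> z \<bullet> e) \<or> r j \<le> 2"
          by blast
        show "norm (y + r (Suc j) *\<^sub>R e - z) + 1 / 4 \<le> 2 * r j" if "z \<in> ball (y + r j *\<^sub>R e) (1 / 4)" for z
          using dist_near[OF that, of "r (Suc j)"] rj by (simp add: r_Suc)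
      qed (use step.hyps \<delta> in \<open>auto intro: sum_nonneg\<close>)
    qed
    define E\<^sub>0 where "E\<^sub>0 = (\<Sum>i=0..n. \<delta> i)"
    define T\<^sub>0 where "T\<^sub>0 = (\<Sum>i=0..n. \<tau> i)"
    define T\<^sub>1 where "T\<^sub>1 = t - 2 * T\<^sub>0"
    have T\<^sub>0: "0 \<le> T\<^sub>0" "T\<^sub>0 \<le> t / 4"
      using \<tau>_sum unfolding T\<^sub>0_def atLeast0AtMost by (auto intro!: sum_nonneg less_imp_le[OF \<tau>_pos])
    have E\<^sub>0: "0 \<le> E\<^sub>0" using \<delta> by (auto simp: E\<^sub>0_def intro: sum_nonneg)
    have across: "steerable (T\<^sub>1 + T\<^sub>0) (ball (x + \<rho> *\<^sub>R e) (1 / 4)) f (M * exp (- (A * \<Lambda> + E\<^sub>0))) (A * \<Lambda> + E\<^sub>0)"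
    proof (rule steerable_mono)
      have T\<^sub>1: "0 < T\<^sub>1" "t / 2 \<le> T\<^sub>1" "T\<^sub>1 \<le> \<rho> powr \<gamma>" using T\<^sub>0 t by (auto simp: T\<^sub>1_def)
      show "steerable (T\<^sub>1 + T\<^sub>0) (ball (x + \<rho> *\<^sub>R e) (1 / 4)) f
         (M * exp (- ((4 * \<rho>)\<^sup>2 / T\<^sub>1 + C\<^sub>0 * \<rho> powr \<beta> + E\<^sub>0))) ((4 * \<rho>)\<^sup>2 / T\<^sub>1 + C\<^sub>0 * \<rho> powr \<beta> + E\<^sub>0)"
      proof (rule move[OF \<rho> T\<^sub>1(1,3) e(1)])
        show "steerable T\<^sub>0 (ball (y + \<rho> *\<^sub>R e) (1 / 4)) f (M * exp (- E\<^sub>0)) E\<^sub>0"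
          using inward[of 0] by (simp add: T\<^sub>0_def E\<^sub>0_def r0)
        have "\<rho> / 4 \<le> z \<bullet> e" if "z \<in> ball (x + \<rho> *\<^sub>R e) (1 / 4) \<union> ball (y + \<rho> *\<^sub>R e) (1 / 4)" for z
          using that inner_near[of z x \<rho>] inner_near[of z y \<rho>] e \<rho> by auto
        then show "(\<forall>z\<in>ball (x + \<rho> *\<^sub>R e) (1 / 4) \<union> ball (y + \<rho> *\<^sub>R e) (1 / 4). \<rho> / 4 \<le> z \<bullet> e) \<or> \<rho> \<le> 2"
          by blast
        show "norm (y + \<rho> *\<^sub>R e - z) + 1 / 4 \<le> 4 * \<rho>" if "z \<in> ball (x + \<rho> *\<^sub>R e) (1 / 4)" for z
        proof -
          have "norm (x + \<rho> *\<^sub>R e - z) + 1 / 4 \<le> 1 / 2" using dist_near[OF that, of \<rho>] by simp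
          moreover have "norm (y + \<rho> *\<^sub>R e - z) \<le> norm (y - x) + norm (x + \<rho> *\<^sub>R e - z)"
            using norm_triangle_ineq[of "y - x" "x + \<rho> *\<^sub>R e - z"] by (simp add: add_diff_eq)
          moreover have "norm (y - x) \<le> 2 * \<rho>" using norm_triangle_ineq4[of y x] xy by simp
          ultimately show ?thesis using \<rho> by simp
        qed
      qed (use \<rho> M E\<^sub>0 in auto)
      have "(4 * \<rho>)\<^sup>2 / T\<^sub>1 \<le> (4 * \<rho>)\<^sup>2 / (t / 2)" using T\<^sub>1 t by (intro divide_left_mono) auto
      also have "\<dots> = 32 * \<Lambda>" by (simp add: \<Lambda>_def power_mult_distrib)
      finally have "(4 * \<rho>)\<^sup>2 / T\<^sub>1 + C\<^sub>0 * \<rho> powr \<beta> \<le> 32 * \<Lambda> + C\<^sub>0 * \<Lambda>"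
        using \<rho>\<beta> C\<^sub>0 by (intro add_mono mult_left_mono) auto
      also have "\<dots> \<le> A * \<Lambda>" using C\<^sub>1 \<Lambda> by (simp add: A_def distrib_right)
      finally have le: "(4 * \<rho>)\<^sup>2 / T\<^sub>1 + C\<^sub>0 * \<rho> powr \<beta> \<le> A * \<Lambda>" .
      then show "(4 * \<rho>)\<^sup>2 / T\<^sub>1 + C\<^sub>0 * \<rho> powr \<beta> + E\<^sub>0 \<le> A * \<Lambda> + E\<^sub>0" by simp
      show "M * exp (- (A * \<Lambda> + E\<^sub>0)) \<le> M * exp (- ((4 * \<rho>)\<^sup>2 / T\<^sub>1 + C\<^sub>0 * \<rho> powr \<beta> + E\<^sub>0))"
        using le M by (intro mult_left_mono) auto
    qed
    define E\<^sub>1 where "E\<^sub>1 = A * \<Lambda> + E\<^sub>0"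
    have E\<^sub>1: "0 \<le> E\<^sub>1" using E\<^sub>0 A \<Lambda> by (simp add: E\<^sub>1_def)
    \<comment> \<open>From level \<open>j\<close> above \<open>x\<close>, through level \<open>0\<close> and the crossing, to \<open>y\<close>.\<close>
    have outward: "steerable ((\<Sum>i<j. \<tau> i) + (T\<^sub>1 + T\<^sub>0)) (ball (x + r j *\<^sub>R e) (1 / 4)) f
        (M * exp (- ((\<Sum>i<j. \<delta> i) + E\<^sub>1))) ((\<Sum>i<j. \<delta> i) + E\<^sub>1)" if "j \<le> n" for j
      using that
    proof (induction j)
      case 0
      then show ?case using across by (simp add: r0 E\<^sub>1_def)
    next
      case (Suc j)
      have rj: "1 \<le> r j" using r_ge Suc.prems by simp
      have "steerable (\<tau> j + ((\<Sum>i<j. \<tau> i) + (T\<^sub>1 + T\<^sub>0))) (ball (x + r (Suc j) *\<^sub>R e) (1 / 4)) f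
        (M * exp (- (\<delta> j + ((\<Sum>i<j. \<delta> i) + E\<^sub>1)))) (\<delta> j + ((\<Sum>i<j. \<delta> i) + E\<^sub>1))"
      proof (rule level_step)
        have "r j / 4 \<le> z \<bullet> e" if "z \<in> ball (x + r (Suc j) *\<^sub>R e) (1 / 4) \<union> ball (x + r j *\<^sub>R e) (1 / 4)" for z
          using that inner_near[of z x "r j"] inner_near[of z x "r (Suc j)"] e rj by (auto simp: r_Suc)
        then show "(\<forall>z\<in>ball (x + r (Suc j) *\<^sub>R e) (1 / 4) \<union> ball (x + r j *\<^sub>R e) (1 / 4). r j / 4 \<le> z \<bullet> e) \<or> r j \<le> 2"
          by blast
        show "norm (x + r j *\<^sub>R e - z) + 1 / 4 \<le> 2 * r j" if "z \<in> ball (x + r (Suc j) *\<^sub>R e) (1 / 4)" for z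
          using dist_near[OF that, of "r j"] rj by (simp add: r_Suc)
        show "steerable ((\<Sum>i<j. \<tau> i) + (T\<^sub>1 + T\<^sub>0)) (ball (x + r j *\<^sub>R e) (1 / 4)) f
            (M * exp (- ((\<Sum>i<j. \<delta> i) + E\<^sub>1))) ((\<Sum>i<j. \<delta> i) + E\<^sub>1)"
          using Suc by simp
      qed (use Suc.prems \<delta> E\<^sub>1 in \<open>auto intro!: add_nonneg_nonneg sum_nonneg\<close>)
      then show ?case by (simp add: ac_simps)
    qed
    have "steerable (\<tau> n + ((\<Sum>i<n. \<tau> i) + (T\<^sub>1 + T\<^sub>0))) {x} f
        (M * exp (- (\<delta> n + ((\<Sum>i<n. \<delta> i) + E\<^sub>1)))) (\<delta> n + ((\<Sum>i<n. \<delta> i) + E\<^sub>1))"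
    proof (rule level_step[OF _ _ _ _ outward])
      show "(\<forall>z\<in>{x} \<union> ball (x + r n *\<^sub>R e) (1 / 4). r n / 4 \<le> z \<bullet> e) \<or> r n \<le> 2"
        using n by (simp add: r_def)
      show "norm (x + r n *\<^sub>R e - z) + 1 / 4 \<le> 2 * r n" if "z \<in> {x}" for z
        using that e r_ge[of n] by simp
    qed (use \<delta> E\<^sub>1 in \<open>auto intro!: add_nonneg_nonneg sum_nonneg\<close>)
    moreover have "\<tau> n + ((\<Sum>i<n. \<tau> i) + (T\<^sub>1 + T\<^sub>0)) = t"
      by (simp add: T\<^sub>1_def T\<^sub>0_def atLeast0AtMost lessThan_Suc_atMost[symmetric])
    ultimately have "steerable t {x} f (M * exp (- (\<delta> n + ((\<Sum>i<n. \<delta> i) + E\<^sub>1)))) (\<delta> n + ((\<Sum>i<n. \<delta> i) + E\<^sub>1))"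
      by simp
    then show "steerable t {x} f ((2 * pi * t) powr (- real DIM('a) / 2) * m * exp (- (C * (\<rho>\<^sup>2 / t)))) (C * (\<rho>\<^sup>2 / t))"
    proof (rule steerable_mono)
      have "\<delta> n + ((\<Sum>i<n. \<delta> i) + E\<^sub>1) = 2 * (\<Sum>j\<le>n. \<delta> j) + A * \<Lambda>"
        by (simp add: E\<^sub>1_def E\<^sub>0_def atLeast0AtMost lessThan_Suc_atMost[symmetric])
      also have "\<dots> \<le> 2 * (A * \<Lambda> * (1 / (1 - Q))) + A * \<Lambda>" using Q_sum by simp
      also have "\<dots> = C * (\<rho>\<^sup>2 / t)" unfolding C_def \<Lambda>_def[symmetric] by (simp add: algebra_simps)
      finally show le: "\<delta> n + ((\<Sum>i<n. \<delta> i) + E\<^sub>1) \<le> C * (\<rho>\<^sup>2 / t)" .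
      show "(2 * pi * t) powr (- real DIM('a) / 2) * m * exp (- (C * (\<rho>\<^sup>2 / t))) \<le> M * exp (- (\<delta> n + ((\<Sum>i<n. \<delta> i) + E\<^sub>1)))"
        using le M unfolding M_def by (intro mult_left_mono) auto
    qed
  qed
qed

end

section \<open>Pointwise bounds on the kernel\<close>

definition bump :: "'a::euclidean_space \<Rightarrow> real \<Rightarrow> 'a \<Rightarrow> real" where
  "bump y \<epsilon> z = max 0 (1 - norm (z - y) / \<epsilon>)"

lemma bump_properties:
  assumes "0 < \<epsilon>"
  shows "0 \<le> bump y \<epsilon> z" "bump y \<epsilon> z \<le> 1" "bump y \<epsilon> z \<noteq> 0 \<Longrightarrow> norm (z - y) \<le> \<epsilon>"
    "bump y \<epsilon> \<in> bcontfun" "bump y \<epsilon> \<in> borel_measurable borel"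
    "0 < (\<integral>z. bump y \<epsilon> z \<partial>lborel)" "integrable lborel (bump y \<epsilon>)"
    "ennreal (\<integral>z. bump y \<epsilon> z \<partial>lborel) = (\<integral>\<^sup>+z. ennreal (bump y \<epsilon> z) \<partial>lborel)"
proof -
  show b: "0 \<le> bump y \<epsilon> z" "bump y \<epsilon> z \<le> 1" for z using assms by (simp_all add: bump_def)
  show supp: "bump y \<epsilon> z \<noteq> 0 \<Longrightarrow> norm (z - y) \<le> \<epsilon>" for z
    using assms by (auto simp: bump_def max_def field_simps split: if_splits)
  have cont: "continuous_on UNIV (bump y \<epsilon>)"
    unfolding bump_def using assms by (intro continuous_intros) auto
  then show meas: "bump y \<epsilon> \<in> borel_measurable borel" by (rule borel_measurable_continuous_onI)
  have "bounded (range (bump y \<epsilon>))"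
    using b by (intro boundedI[of _ 1]) auto
  then show "bump y \<epsilon> \<in> bcontfun" using cont by (simp add: bcontfun_def)
  show int: "integrable lborel (bump y \<epsilon>)"
  proof (rule Bochner_Integration.integrable_bound)
    show "integrable lborel (indicator (cball y \<epsilon>) :: 'a \<Rightarrow> real)"
      using emeasure_lborel_cball_finite[of y \<epsilon>] by (intro integrable_real_indicator) auto
    show "AE z in lborel. norm (bump y \<epsilon> z) \<le> norm (indicator (cball y \<epsilon>) z :: real)"
    proof (rule AE_I2)
      fix z
      show "norm (bump y \<epsilon> z) \<le> norm (indicator (cball y \<epsilon>) z :: real)"
        using b[of z] supp[of z] by (cases "bump y \<epsilon> z = 0") (auto simp: dist_norm norm_minus_commute)
    qed
  qed (use meas in auto)
  show "ennreal (\<integral>z. bump y \<epsilon> z \<partial>lborel) = (\<integral>\<^sup>+z. ennreal (bump y \<epsilon> z) \<partial>lborel)"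
    using int b by (intro nn_integral_eq_integral[symmetric]) auto
  have "0 < (\<integral>z. indicator (ball y (\<epsilon> / 2)) z * (1 / 2) \<partial>lborel :: real)"
    using content_ball_pos[of "\<epsilon> / 2" y] assms by simp
  also have "\<dots> \<le> (\<integral>z. bump y \<epsilon> z \<partial>lborel)"
  proof (rule integral_mono[OF _ int])
    show "integrable lborel (\<lambda>z. indicator (ball y (\<epsilon> / 2)) z * (1 / 2) :: real)"
      using emeasure_lborel_ball_finite[of y "\<epsilon> / 2"] by (intro integrable_mult_left integrable_real_indicator) auto
    show "indicator (ball y (\<epsilon> / 2)) z * (1 / 2) \<le> bump y \<epsilon> z" for z
      using assms by (auto simp: indicator_def bump_def dist_norm norm_minus_commute field_simps)
  qed
  finally show "0 < (\<integral>z. bump y \<epsilon> z \<partial>lborel)" .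
qed

text \<open>If \<open>u\<close> exceeded \<open>v\<close> at \<open>y\<close>, it would do so by a fixed amount on the support of a narrow bump.\<close>

lemma pointwise_le_from_bumps:
  fixes u v :: "'a::euclidean_space \<Rightarrow> real"
  assumes cont: "continuous_on UNIV u" "continuous_on UNIV v"
    and le: "\<And>\<epsilon>. 0 < \<epsilon> \<Longrightarrow> \<epsilon> \<le> 1 / 4 \<Longrightarrow> (\<integral>z. u z * bump y \<epsilon> z \<partial>lborel) \<le> (\<integral>z. v z * bump y \<epsilon> z \<partial>lborel)"
    and int: "\<And>\<epsilon>. 0 < \<epsilon> \<Longrightarrow> integrable lborel (\<lambda>z. u z * bump y \<epsilon> z)" "\<And>\<epsilon>. 0 < \<epsilon> \<Longrightarrow> integrable lborel (\<lambda>z. v z * bump y \<epsilon> z)"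
  shows "u y \<le> v y"
proof (rule ccontr)
  assume "\<not> u y \<le> v y"
  define \<eta> where "\<eta> = (u y - v y) / 2"
  have \<eta>: "0 < \<eta>" using \<open>\<not> u y \<le> v y\<close> by (simp add: \<eta>_def)
  have "continuous_on UNIV (\<lambda>z. u z - v z)" by (intro continuous_intros cont)
  then obtain d where d: "0 < d" "\<And>z. dist z y < d \<Longrightarrow> dist (u z - v z) (u y - v y) < \<eta>"
    using \<eta> unfolding continuous_on_iff by (metis UNIV_I)
  define \<epsilon> where "\<epsilon> = min (d / 2) (1 / 4)"
  have \<epsilon>: "0 < \<epsilon>" "\<epsilon> \<le> 1 / 4" "\<epsilon> < d" using d by (auto simp: \<epsilon>_def)
  note b = bump_properties[OF \<epsilon>(1), of y]
  have "\<eta> * (\<integral>z. bump y \<epsilon> z \<partial>lborel) = (\<integral>z. \<eta> * bump y \<epsilon> z \<partial>lborel)" by simp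
  also have "\<dots> \<le> (\<integral>z. u z * bump y \<epsilon> z - v z * bump y \<epsilon> z \<partial>lborel)"
  proof (rule integral_mono)
    show "\<eta> * bump y \<epsilon> z \<le> u z * bump y \<epsilon> z - v z * bump y \<epsilon> z" for z
    proof (cases "bump y \<epsilon> z = 0")
      case False
      then have "dist z y < d" using b(3)[of z] \<epsilon> by (simp add: dist_norm)
      then have "dist (u z - v z) (u y - v y) < \<eta>" by (rule d(2))
      then have "\<eta> \<le> u z - v z" unfolding dist_real_def \<eta>_def abs_less_iff by (simp add: field_simps)
      then have "\<eta> * bump y \<epsilon> z \<le> (u z - v z) * bump y \<epsilon> z" using b(1) by (rule mult_right_mono)
      then show ?thesis by (simp add: left_diff_distrib)
    qed simp
  qed (use int \<epsilon> b in auto)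
  also have "\<dots> = (\<integral>z. u z * bump y \<epsilon> z \<partial>lborel) - (\<integral>z. v z * bump y \<epsilon> z \<partial>lborel)"
    using int \<epsilon> by (intro Bochner_Integration.integral_diff) auto
  also have "\<dots> \<le> 0" using le[OF \<epsilon>(1,2)] by simp
  finally show False using \<eta> b(6) by (simp add: mult_le_0_iff)
qed

context bounded_potential
begin

lemma Feynman_Kac_ge_heat:
  fixes f :: "'a \<Rightarrow> real"
  assumes bm: "brownian_motion_from x M B" and "0 < t"
    and [measurable]: "f \<in> borel_measurable borel" and f: "\<And>z. 0 \<le> f z" "\<And>z. f z \<le> F"
  shows "ennreal (exp (- K * t)) * (\<integral>\<^sup>+y. ennreal (heat t (y - x)) * ennreal (f y) \<partial>lborel)
    \<le> ennreal (\<integral>\<omega>. f (B t \<omega>) * exp (- action B t \<omega>) \<partial>M)"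
proof -
  have act: "action B t \<omega> \<le> K * t" if "\<omega> \<in> space M" for \<omega>
  proof -
    have "action B t \<omega> \<le> (\<integral>s. indicator {0..t} s * K \<partial>lborel)"
      unfolding action_eq
    proof (rule integral_mono[OF action_integrable[OF bm that]])
      show "integrable lborel (\<lambda>s. indicator {0..t} s * K)"
        by (intro integrable_mult_left integrable_real_indicator) (simp_all add: emeasure_lborel_Icc_eq)
      show "indicator {0..t} s * V (B (max 0 s) \<omega>) \<le> indicator {0..t} s * K" for s
        by (intro mult_left_mono V_le) simp
    qed
    then show ?thesis using \<open>0 < t\<close> by (simp add: mult.commute)
  qed
  have [measurable]: "B t \<in> borel_measurable M" using B_measurable[OF bm] \<open>0 < t\<close> by simp
  have "(\<integral>\<^sup>+y. ennreal (heat t (y - x)) * ennreal (f y) \<partial>lborel) = chain_integral [(t, \<lambda>z. ennreal (f z))] x" by simp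
  also have "\<dots> = (\<integral>\<^sup>+\<omega>. ennreal (f (B t \<omega>)) \<partial>M)"
    using \<open>0 < t\<close> nn_integral_path_weight[OF bm, of "[(t, \<lambda>z. ennreal (f z))]"] by simp
  finally have "ennreal (exp (- K * t)) * (\<integral>\<^sup>+y. ennreal (heat t (y - x)) * ennreal (f y) \<partial>lborel)
     = (\<integral>\<^sup>+\<omega>. ennreal (exp (- K * t)) * ennreal (f (B t \<omega>)) \<partial>M)"
    by (simp add: nn_integral_cmult)
  also have "\<dots> \<le> (\<integral>\<^sup>+\<omega>. ennreal (f (B t \<omega>)) * ennreal (exp (- action B t \<omega>)) \<partial>M)"
  proof (rule nn_integral_mono)
    fix \<omega> assume "\<omega> \<in> space M"
    then have "ennreal (exp (- K * t)) \<le> ennreal (exp (- action B t \<omega>))"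
      using act by (intro ennreal_leI) simp
    then show "ennreal (exp (- K * t)) * ennreal (f (B t \<omega>)) \<le> ennreal (f (B t \<omega>)) * ennreal (exp (- action B t \<omega>))"
      unfolding mult.commute[of "ennreal (f (B t \<omega>))"] by (rule mult_right_mono) simp
  qed
  also have "\<dots> = ennreal (\<integral>\<omega>. f (B t \<omega>) * exp (- action B t \<omega>) \<partial>M)"
    using \<open>0 < t\<close> by (intro ennreal_Feynman_Kac[OF bm _ _ f, symmetric]) auto
  finally show ?thesis .
qed

end

locale heat_kernel_setting = bounded_potential V K for V :: "'a::euclidean_space \<Rightarrow> real" and K +
  fixes P :: "'a \<Rightarrow> 'w measure" and B :: "real \<Rightarrow> 'w \<Rightarrow> 'a" and p :: "real \<Rightarrow> 'a \<Rightarrow> 'a \<Rightarrow> real"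
  assumes bm: "brownian_motion_from x (P x) B" and heat_kernel: "is_heat_kernel P B V p"
begin

lemma p_continuous: "0 < t \<Longrightarrow> continuous_on UNIV (p t x)"
proof -
  assume "0 < t"
  have "continuous_on ({0<..} \<times> UNIV \<times> UNIV) (\<lambda>(t, x, y). p t x y)"
    using heat_kernel by (simp add: is_heat_kernel_def)
  then have "continuous_on UNIV ((\<lambda>(t, x, y). p t x y) \<circ> (\<lambda>y. (t, x, y)))"
    using \<open>0 < t\<close> by (intro continuous_on_compose continuous_intros) (auto elim: continuous_on_subset)
  then show ?thesis by (simp add: comp_def)
qed

lemma p_bump:
  assumes "0 < t" "0 < \<epsilon>"
  shows "integrable lborel (\<lambda>z. p t x z * bump y \<epsilon> z)"
    "(\<integral>z. p t x z * bump y \<epsilon> z \<partial>lborel) = (\<integral>\<omega>. bump y \<epsilon> (B t \<omega>) * exp (- action B t \<omega>) \<partial>P x)"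
proof -
  have "has_bochner_integral lborel (\<lambda>z. p t x z * bump y \<epsilon> z) (feynman_kac P B V t (bump y \<epsilon>) x)"
    using heat_kernel assms(1) bump_properties(4)[OF assms(2)] unfolding is_heat_kernel_def by blast
  then show "integrable lborel (\<lambda>z. p t x z * bump y \<epsilon> z)"
    "(\<integral>z. p t x z * bump y \<epsilon> z \<partial>lborel) = (\<integral>\<omega>. bump y \<epsilon> (B t \<omega>) * exp (- action B t \<omega>) \<partial>P x)"
    by (auto simp: has_bochner_integral_iff feynman_kac_def action_def)
qed

lemma heat_bump:
  fixes x y :: 'a
  assumes "0 < t" "0 < \<epsilon>"
  shows "integrable lborel (\<lambda>z. heat t (z - x) * bump y \<epsilon> z)"
    "ennreal (\<integral>z. heat t (z - x) * bump y \<epsilon> z \<partial>lborel) = (\<integral>\<^sup>+z. ennreal (heat t (z - x)) * ennreal (bump y \<epsilon> z) \<partial>lborel)"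
proof -
  note b = bump_properties[OF assms(2), of y]
  have [measurable]: "bump y \<epsilon> \<in> borel_measurable borel" by (rule b)
  show int: "integrable lborel (\<lambda>z. heat t (z - x) * bump y \<epsilon> z)"
  proof (rule Bochner_Integration.integrable_bound)
    show "integrable lborel (\<lambda>z. (2 * pi * t) powr (- real DIM('a) / 2) * bump y \<epsilon> z)" using b by simp
    show "AE z in lborel. norm (heat t (z - x) * bump y \<epsilon> z) \<le> norm ((2 * pi * t) powr (- real DIM('a) / 2) * bump y \<epsilon> z)"
    proof (rule AE_I2)
      fix z
      have "heat t (z - x) * bump y \<epsilon> z \<le> (2 * pi * t) powr (- real DIM('a) / 2) * bump y \<epsilon> z"
        using heat_le[OF assms(1), of "z - x"] b(1) by (rule mult_right_mono)
      then show "norm (heat t (z - x) * bump y \<epsilon> z) \<le> norm ((2 * pi * t) powr (- real DIM('a) / 2) * bump y \<epsilon> z)"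
        using b(1) by (simp add: abs_mult)
    qed
  qed measurable
  show "ennreal (\<integral>z. heat t (z - x) * bump y \<epsilon> z \<partial>lborel) = (\<integral>\<^sup>+z. ennreal (heat t (z - x)) * ennreal (bump y \<epsilon> z) \<partial>lborel)"
    using b(1) by (subst nn_integral_eq_integral[OF int, symmetric]) (auto simp: ennreal_mult)
qed

lemma Feynman_Kac_bump_nonneg: "0 < \<epsilon> \<Longrightarrow> 0 \<le> (\<integral>\<omega>. bump y \<epsilon> (B t \<omega>) * exp (- action B t \<omega>) \<partial>P x)"
  by (intro Bochner_Integration.integral_nonneg mult_nonneg_nonneg bump_properties(1)) auto

lemma heat_translate_continuous: "continuous_on UNIV (\<lambda>z. heat t (z - x))"
  by (rule continuous_on_compose2[OF heat_continuous]) (auto intro!: continuous_intros)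

lemma p_le_heat:
  assumes "0 < t"
  shows "p t x y \<le> heat t (y - x)"
proof (rule pointwise_le_from_bumps[OF p_continuous[OF assms] heat_translate_continuous])
  fix \<epsilon> :: real assume \<epsilon>: "0 < \<epsilon>"
  note b = bump_properties[OF \<epsilon>, of y]
  show "(\<integral>z. p t x z * bump y \<epsilon> z \<partial>lborel) \<le> (\<integral>z. heat t (z - x) * bump y \<epsilon> z \<partial>lborel)"
  proof -
    have "ennreal (\<integral>z. p t x z * bump y \<epsilon> z \<partial>lborel) \<le> ennreal (\<integral>z. heat t (z - x) * bump y \<epsilon> z \<partial>lborel)"
      unfolding p_bump(2)[OF assms \<epsilon>] heat_bump(2)[OF assms \<epsilon>]
      by (rule Feynman_Kac_le_heat[OF bm assms b(5) b(1,2)])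
    then show ?thesis
      using b(1) by (subst (asm) ennreal_le_iff) (auto intro!: Bochner_Integration.integral_nonneg)
  qed
qed (use p_bump heat_bump assms in auto)

lemma p_ge_heat:
  assumes "0 < t"
  shows "exp (- K * t) * heat t (y - x) \<le> p t x y"
proof (rule pointwise_le_from_bumps[OF _ p_continuous[OF assms]])
  show "continuous_on UNIV (\<lambda>z. exp (- K * t) * heat t (z - x))"
    by (intro continuous_intros heat_translate_continuous)
  fix \<epsilon> :: real assume \<epsilon>: "0 < \<epsilon>"
  note b = bump_properties[OF \<epsilon>, of y]
  show "(\<integral>z. exp (- K * t) * heat t (z - x) * bump y \<epsilon> z \<partial>lborel) \<le> (\<integral>z. p t x z * bump y \<epsilon> z \<partial>lborel)"
  proof -
    have "ennreal (exp (- K * t) * (\<integral>z. heat t (z - x) * bump y \<epsilon> z \<partial>lborel)) \<le> ennreal (\<integral>z. p t x z * bump y \<epsilon> z \<partial>lborel)"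
      unfolding p_bump(2)[OF assms \<epsilon>] ennreal_mult'[OF exp_ge_zero] heat_bump(2)[OF assms \<epsilon>]
      by (rule Feynman_Kac_ge_heat[OF bm assms b(5) b(1,2)])
    then show ?thesis
      using Feynman_Kac_bump_nonneg[OF \<epsilon>] by (subst (asm) ennreal_le_iff) (auto simp: mult.assoc p_bump(2)[OF assms \<epsilon>])
  qed
  show "integrable lborel (\<lambda>z. exp (- K * t) * heat t (z - x) * bump y \<epsilon> z)"
    using heat_bump(1)[OF assms \<epsilon>] by (simp add: mult.assoc)
qed (use p_bump assms in auto)

lemma p_upper_bound:
  assumes "0 < t" "0 \<le> r" "0 \<le> w" "\<And>z. norm (z - x) < r \<Longrightarrow> w \<le> V z"
  shows "p t x y \<le> (pi * t) powr (- real DIM('a) / 2) *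
         (exp (- (t / 2) * w) + 2 powr (real DIM('a) / 2) * exp (- r\<^sup>2 / (2 * t)))" (is "_ \<le> ?c")
proof (rule pointwise_le_from_bumps[OF p_continuous[OF assms(1)]])
  fix \<epsilon> :: real assume \<epsilon>: "0 < \<epsilon>"
  note b = bump_properties[OF \<epsilon>, of y]
  have c: "0 \<le> ?c" by (intro mult_nonneg_nonneg add_nonneg_nonneg) auto
  show "(\<integral>z. p t x z * bump y \<epsilon> z \<partial>lborel) \<le> (\<integral>z. ?c * bump y \<epsilon> z \<partial>lborel)"
  proof -
    have "ennreal (\<integral>z. p t x z * bump y \<epsilon> z \<partial>lborel) \<le> ennreal (?c * (\<integral>z. bump y \<epsilon> z \<partial>lborel))"
      unfolding p_bump(2)[OF assms(1) \<epsilon>] ennreal_mult'[OF c] b(8)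
      by (rule Feynman_Kac_upper_bound[OF bm assms b(5) b(1,2)])
    then show ?thesis
      using b(6) c by (subst (asm) ennreal_le_iff) auto
  qed
  show "integrable lborel (\<lambda>z. ?c * bump y \<epsilon> z)" using b(7) by simp
qed (use p_bump assms in auto)

text \<open>The mass of the terminal weight is kept as a factor \<open>\<mu>\<close>, so that it cancels against the integral of the
  bump.\<close>

lemma p_lower_bound:
  assumes "0 < t" "0 \<le> m" "0 \<le> a"
    and st: "\<And>f \<mu>. f \<in> borel_measurable borel \<Longrightarrow> 0 \<le> \<mu> \<Longrightarrow> ennreal \<mu> \<le> (\<integral>\<^sup>+z. ennreal (f z) \<partial>lborel) \<Longrightarrow>
       (\<And>z. f z \<noteq> 0 \<Longrightarrow> norm (z - y) \<le> 1 / 4) \<Longrightarrow> steerable t {x} f (m * \<mu>) a"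
  shows "m * exp (- a) \<le> p t x y"
proof (rule pointwise_le_from_bumps[OF _ p_continuous[OF assms(1)]])
  fix \<epsilon> :: real assume \<epsilon>: "0 < \<epsilon>"
  note b = bump_properties[OF \<epsilon>, of y]
  show "(\<integral>z. m * exp (- a) * bump y \<epsilon> z \<partial>lborel) \<le> (\<integral>z. p t x z * bump y \<epsilon> z \<partial>lborel)" if "\<epsilon> \<le> 1 / 4"
  proof -
    let ?\<mu> = "\<integral>z. bump y \<epsilon> z \<partial>lborel"
    have "steerable t {x} (bump y \<epsilon>) (m * ?\<mu>) a"
    proof (rule st[OF b(5)])
      show "norm (z - y) \<le> 1 / 4" if "bump y \<epsilon> z \<noteq> 0" for z
        using b(3)[OF that] \<open>\<epsilon> \<le> 1 / 4\<close> by simp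
    qed (use b(6,8) in auto)
    then have "m * ?\<mu> * exp (- a) \<le> (\<integral>\<omega>. bump y \<epsilon> (B t \<omega>) * exp (- action B t \<omega>) \<partial>P x)"
      by (rule Feynman_Kac_lower_bound[OF bm _ _ _ _ b(5) b(1,2)]) (use assms b(6) in auto)
    then show ?thesis unfolding p_bump(2)[OF assms(1) \<epsilon>] by (simp add: ac_simps)
  qed
  show "integrable lborel (\<lambda>z. m * exp (- a) * bump y \<epsilon> z)" using b(7) by simp
qed (use p_bump assms in auto)

end

section \<open>Two-sided bounds for slowly decaying potentials\<close>

lemma Phi_nonneg: "0 < t \<Longrightarrow> 0 \<le> Phi \<alpha> t x y"
  by (simp add: Phi_def)

locale slow_decay_heat_kernel = heat_kernel_setting V K P B p + decaying_potential V K \<alpha>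
  for V :: "'a::euclidean_space \<Rightarrow> real" and K \<alpha> and P :: "'a \<Rightarrow> 'w measure" and B p +
  fixes k :: real
  assumes k: "0 < k" and V_ge: "k * (1 + norm z) powr (- \<alpha>) \<le> V z"
begin

abbreviation "\<theta> \<equiv> (2 - \<alpha>) / (2 + \<alpha>)"

text \<open>The exponents of \<open>t\<close> in the potential cost \<open>t * L powr (- \<alpha>)\<close> and in the displacement cost
  \<open>L\<^sup>2 / t\<close> agree at the length \<open>L = t powr (1 / \<gamma>)\<close>; their common value is the one in \<open>Phi\<close>.\<close>

lemma exponents: "1 - \<alpha> / \<gamma> = \<theta>" "2 / \<gamma> - 1 = \<theta>"
  using \<alpha> by (simp_all add: field_simps)

lemma time_times_scale_powr:
  assumes "0 < t"
  shows "t * (t powr (1 / \<gamma>)) powr (- \<alpha>) = t powr \<theta>"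
proof -
  have "t * (t powr (1 / \<gamma>)) powr (- \<alpha>) = t powr 1 / t powr (\<alpha> / \<gamma>)"
    using assms by (simp add: powr_powr powr_minus_divide)
  also have "\<dots> = t powr (1 - \<alpha> / \<gamma>)" by (rule powr_diff[symmetric])
  finally show ?thesis unfolding exponents .
qed

lemma scale_square_over_time:
  assumes "0 < t"
  shows "(t powr (1 / \<gamma>))\<^sup>2 / t = t powr \<theta>"
proof -
  have "(t powr (1 / \<gamma>))\<^sup>2 = t powr (2 / \<gamma>)" using assms by (simp add: powr_power)
  then have "(t powr (1 / \<gamma>))\<^sup>2 / t = t powr (2 / \<gamma>) / t powr 1" using assms by simp
  also have "\<dots> = t powr (2 / \<gamma> - 1)" by (rule powr_diff[symmetric])
  finally show ?thesis unfolding exponents .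
qed

text \<open>With \<open>L\<close> the larger of \<open>1 + |x|\<close> and \<open>t powr (1 / \<gamma>)\<close>, both \<open>t * L powr (- \<alpha>)\<close> and \<open>L\<^sup>2 / t\<close> are at
  least \<open>Phi\<close>. This bounds \<open>p\<close> by a multiple of \<open>exp (- c * Phi)\<close>, and the Gaussian kernel bounds it by a
  multiple of \<open>exp (- c * |x - y|\<^sup>2 / t)\<close>; the larger of the two exponents is at least half their sum.\<close>

theorem heat_kernel_upper:
  "\<exists>C>0. \<exists>C'>0. \<forall>x y. \<forall>t>0.
     p t x y \<le> C * t powr (- real DIM('a) / 2) * exp (- C' * ((norm (x - y))\<^sup>2 / t + Phi \<alpha> t x y))"
proof -
  define G where "G = 1 + 2 powr (real DIM('a) / 2)"
  define C where "C = pi powr (- real DIM('a) / 2) * G"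
  define c where "c = min (k * 2 powr (- \<alpha>) / 2) (1 / 2)"
  have c: "0 < c" "c \<le> k * 2 powr (- \<alpha>) / 2" "c \<le> 1 / 2" using k by (auto simp: c_def)
  have G: "1 \<le> G" by (simp add: G_def)
  then have C: "0 < C" by (simp add: C_def)
  show ?thesis
  proof (rule exI[of _ C], rule conjI[OF C], rule exI[of _ "c / 2"], intro conjI allI impI)
    fix t :: real and x y :: 'a assume t: "0 < t"
    let ?\<Phi> = "Phi \<alpha> t x y"
    let ?g = "(pi * t) powr (- real DIM('a) / 2)"
    have \<Phi>: "0 \<le> ?\<Phi>" using t by (rule Phi_nonneg)
    have g: "0 < ?g" "?g * G = C * t powr (- real DIM('a) / 2)" using t by (auto simp: C_def powr_mult)
    have gG: "0 \<le> ?g * G" using G by (intro mult_nonneg_nonneg) auto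
    define L where "L = max (1 + norm x) (t powr (1 / \<gamma>))"
    have L: "1 + norm x \<le> L" "t powr (1 / \<gamma>) \<le> L" "0 < L" by (auto simp: L_def less_max_iff_disj add_pos_nonneg)
    have \<Phi>_pot: "?\<Phi> \<le> t * L powr (- \<alpha>)"
    proof (cases "t powr (1 / \<gamma>) \<le> 1 + norm x")
      case True
      then have "L = 1 + norm x" by (simp add: L_def)
      have "?\<Phi> \<le> t / (1 + max (norm x) (norm y)) powr \<alpha>" by (simp add: Phi_def)
      also have "\<dots> \<le> t / (1 + norm x) powr \<alpha>"
      proof (rule divide_left_mono)
        have "0 < 1 + norm x" "0 < 1 + max (norm x) (norm y)"
          by (simp_all add: add_pos_nonneg le_max_iff_disj)
        then show "0 < (1 + max (norm x) (norm y)) powr \<alpha> * (1 + norm x) powr \<alpha>"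
          by (metis less_irrefl mult_pos_pos powr_gt_zero)
      qed (use t \<alpha> in \<open>auto intro: powr_mono2\<close>)
      finally show ?thesis using \<open>L = 1 + norm x\<close> by (simp add: powr_minus_divide)
    next
      case False
      then have "L = t powr (1 / \<gamma>)" by (simp add: L_def)
      then show ?thesis using time_times_scale_powr[OF t] by (simp add: Phi_def)
    qed
    have \<Phi>_dist: "?\<Phi> \<le> L\<^sup>2 / t"
    proof -
      have "?\<Phi> \<le> t powr \<theta>" by (simp add: Phi_def)
      also have "\<dots> = (t powr (1 / \<gamma>))\<^sup>2 / t" using scale_square_over_time[OF t] by simp
      also have "\<dots> \<le> L\<^sup>2 / t" using L t by (intro divide_right_mono power_mono) auto
      finally show ?thesis .
    qed
    define w where "w = k * (2 * L) powr (- \<alpha>)"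
    have "p t x y \<le> ?g * (exp (- (t / 2) * w) + 2 powr (real DIM('a) / 2) * exp (- L\<^sup>2 / (2 * t)))"
    proof (rule p_upper_bound[OF t])
      show "w \<le> V z" if "norm (z - x) < L" for z
      proof -
        have "norm z \<le> norm x + norm (z - x)" by (rule norm_triangle_sub)
        then have "1 + norm z \<le> 2 * L" using that L by simp
        then have "(2 * L) powr (- \<alpha>) \<le> (1 + norm z) powr (- \<alpha>)"
          using \<alpha> by (intro powr_mono2') (auto simp: add_pos_nonneg)
        then show ?thesis unfolding w_def using k by (intro order_trans[OF mult_left_mono V_ge]) auto
      qed
    qed (use L k in \<open>auto simp: w_def\<close>)
    also have "\<dots> \<le> ?g * (exp (- c * ?\<Phi>) + 2 powr (real DIM('a) / 2) * exp (- c * ?\<Phi>))"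
    proof (intro mult_left_mono add_mono)
      have "c * ?\<Phi> \<le> (k * 2 powr (- \<alpha>) / 2) * (t * L powr (- \<alpha>))"
        using c \<Phi> \<Phi>_pot k by (intro mult_mono) auto
      also have "\<dots> = t / 2 * w" using L by (simp add: w_def powr_mult)
      finally show "exp (- (t / 2) * w) \<le> exp (- c * ?\<Phi>)" by simp
      have "c * ?\<Phi> \<le> 1 / 2 * (L\<^sup>2 / t)" using c \<Phi> \<Phi>_dist by (intro mult_mono) auto
      then show "exp (- L\<^sup>2 / (2 * t)) \<le> exp (- c * ?\<Phi>)" by simp
    qed auto
    also have "\<dots> = ?g * G * exp (- c * ?\<Phi>)" by (simp add: G_def algebra_simps)
    finally have far: "p t x y \<le> ?g * G * exp (- c * ?\<Phi>)" .
    have near: "p t x y \<le> ?g * G * exp (- c * ((norm (x - y))\<^sup>2 / t))"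
    proof -
      have "p t x y \<le> heat t (y - x)" by (rule p_le_heat[OF t])
      also have "\<dots> = (2 * pi * t) powr (- real DIM('a) / 2) * exp (- (norm (x - y))\<^sup>2 / (2 * t))"
        by (simp add: heat_def norm_minus_commute)
      also have "\<dots> \<le> (?g * G) * exp (- c * ((norm (x - y))\<^sup>2 / t))"
      proof (rule mult_mono)
        have "(2 * pi * t) powr (- real DIM('a) / 2) \<le> ?g * 1" using t unfolding mult_1_right by (intro powr_mono2') auto
        also have "?g * 1 \<le> ?g * G" using G by (intro mult_left_mono) auto
        finally show "(2 * pi * t) powr (- real DIM('a) / 2) \<le> ?g * G" .
        have "c * ((norm (x - y))\<^sup>2 / t) \<le> 1 / 2 * ((norm (x - y))\<^sup>2 / t)"
          using c t by (intro mult_right_mono) auto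
        then show "exp (- (norm (x - y))\<^sup>2 / (2 * t)) \<le> exp (- c * ((norm (x - y))\<^sup>2 / t))" by simp
        show "0 \<le> ?g * G" by (rule gG)
      qed simp
      finally show ?thesis .
    qed
    show "p t x y \<le> C * t powr (- real DIM('a) / 2) * exp (- (c / 2) * ((norm (x - y))\<^sup>2 / t + ?\<Phi>))"
      unfolding g(2)[symmetric]
    proof (cases "?\<Phi> \<le> (norm (x - y))\<^sup>2 / t")
      case True
      then have "(c / 2) * ((norm (x - y))\<^sup>2 / t + ?\<Phi>) \<le> (c / 2) * (2 * ((norm (x - y))\<^sup>2 / t))"
        using c by (intro mult_left_mono) auto
      then have "?g * G * exp (- c * ((norm (x - y))\<^sup>2 / t)) \<le> ?g * G * exp (- (c / 2) * ((norm (x - y))\<^sup>2 / t + ?\<Phi>))"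
        using gG by (intro mult_left_mono) auto
      then show "p t x y \<le> ?g * G * exp (- (c / 2) * ((norm (x - y))\<^sup>2 / t + ?\<Phi>))"
        using near by (rule order_trans[rotated])
    next
      case False
      then have "(c / 2) * ((norm (x - y))\<^sup>2 / t + ?\<Phi>) \<le> (c / 2) * (2 * ?\<Phi>)"
        using c by (intro mult_left_mono) auto
      then have "?g * G * exp (- c * ?\<Phi>) \<le> ?g * G * exp (- (c / 2) * ((norm (x - y))\<^sup>2 / t + ?\<Phi>))"
        using gG by (intro mult_left_mono) auto
      then show "p t x y \<le> ?g * G * exp (- (c / 2) * ((norm (x - y))\<^sup>2 / t + ?\<Phi>))"
        using far by (rule order_trans[rotated])
    qed
  qed (use C c in auto)
qed

text \<open>For \<open>t \<le> 1\<close> the action is bounded. For larger \<open>t\<close>, the length \<open>s = t powr (1 / \<gamma>)\<close> decides: the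
  segment from \<open>x\<close> to \<open>y\<close> is followed if it stays far from the origin on this scale, and otherwise
  a detour at distance \<open>\<rho> = max R s\<close>. In the second case either \<open>\<rho> = s\<close>, and \<open>\<rho>\<^sup>2 / t = t powr \<theta>\<close> is comparable
  to \<open>Phi\<close>, or \<open>\<rho> = R < 2 * |x - y|\<close>.\<close>

theorem heat_kernel_lower:
  assumes dim: "2 \<le> DIM('a)"
  shows "\<exists>C>0. \<exists>C'>0. \<forall>x y. \<forall>t>0.
     C * t powr (- real DIM('a) / 2) * exp (- C' * ((norm (x - y))\<^sup>2 / t + Phi \<alpha> t x y)) \<le> p t x y"
proof -
  obtain D where D: "0 < D" and direct:
    "\<And>R t x y f m. 1 \<le> R \<Longrightarrow> 0 < t \<Longrightarrow> t \<le> R powr \<gamma> \<Longrightarrow> norm (x - y) \<le> R / 2 \<Longrightarrow> norm x = R \<or> norm y = R \<Longrightarrow>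
       f \<in> borel_measurable borel \<Longrightarrow> 0 \<le> m \<Longrightarrow> ennreal m \<le> (\<integral>\<^sup>+z. ennreal (f z) \<partial>lborel) \<Longrightarrow>
       (\<And>z. f z \<noteq> 0 \<Longrightarrow> norm (z - y) \<le> 1 / 4) \<Longrightarrow>
       steerable t {x} f ((2 * pi * t) powr (- real DIM('a) / 2) * exp (- (norm (x - y) + 1 / 4)\<^sup>2 / (2 * t)) * m)
         (D * R powr (- \<alpha>) * t)"
    using steerable_direct by blast
  obtain E where E: "0 < E" and detour:
    "\<And>\<rho> t x y f m. 1 \<le> \<rho> \<Longrightarrow> 0 < t \<Longrightarrow> t \<le> \<rho> powr \<gamma> \<Longrightarrow> norm x \<le> \<rho> \<Longrightarrow> norm y \<le> \<rho> \<Longrightarrow>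
       f \<in> borel_measurable borel \<Longrightarrow> 0 \<le> m \<Longrightarrow> ennreal m \<le> (\<integral>\<^sup>+z. ennreal (f z) \<partial>lborel) \<Longrightarrow>
       (\<And>z. f z \<noteq> 0 \<Longrightarrow> norm (z - y) \<le> 1 / 4) \<Longrightarrow>
       steerable t {x} f ((2 * pi * t) powr (- real DIM('a) / 2) * m * exp (- (E * (\<rho>\<^sup>2 / t)))) (E * (\<rho>\<^sup>2 / t))"
    using steerable_detour[OF dim] by blast
  define C where "C = (2 * pi) powr (- real DIM('a) / 2) * exp (- (K + 1))"
  define C' where "C' = 1 + 2 powr \<alpha> * D + 2 * E * (4 + 2 powr \<alpha>)"
  have C: "0 < C" by (simp add: C_def)
  have D2: "0 \<le> 2 powr \<alpha> * D" and E2: "0 \<le> 2 * E * (4 + 2 powr \<alpha>)" using D E by auto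
  then have C': "0 < C'" by (simp add: C'_def)
  show ?thesis
  proof (rule exI[of _ C], rule conjI[OF C], rule exI[of _ C'], intro conjI allI impI)
    fix t :: real and x y :: 'a assume t: "0 < t"
    let ?\<Phi> = "Phi \<alpha> t x y"
    let ?N = "(norm (x - y))\<^sup>2 / t"
    let ?g = "(2 * pi * t) powr (- real DIM('a) / 2)"
    have \<Phi>: "0 \<le> ?\<Phi>" using t by (rule Phi_nonneg)
    have N: "0 \<le> ?N" using t by simp
    have goal: "C * t powr (- real DIM('a) / 2) * exp (- C' * (?N + ?\<Phi>)) \<le> p t x y"
      if "?g * exp (- X) \<le> p t x y" "X \<le> K + 1 + C' * (?N + ?\<Phi>)" for X
    proof -
      have "C * t powr (- real DIM('a) / 2) * exp (- C' * (?N + ?\<Phi>)) = ?g * (exp (- (K + 1)) * exp (- C' * (?N + ?\<Phi>)))"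
        using t by (simp add: C_def powr_mult)
      also have "exp (- (K + 1)) * exp (- C' * (?N + ?\<Phi>)) = exp (- (K + 1 + C' * (?N + ?\<Phi>)))"
        by (simp add: exp_add[symmetric])
      also have "?g * exp (- (K + 1 + C' * (?N + ?\<Phi>))) \<le> ?g * exp (- X)"
        using that(2) by (intro mult_left_mono) auto
      finally show ?thesis using that(1) by simp
    qed
    define R where "R = max (norm x) (norm y)"
    have R: "norm x \<le> R" "norm y \<le> R" "0 \<le> R" "norm x = R \<or> norm y = R" by (auto simp: R_def le_max_iff_disj)
    have \<Phi>_eq: "?\<Phi> = min (t / (1 + R) powr \<alpha>) (t powr \<theta>)" by (simp add: Phi_def R_def)
    show "C * t powr (- real DIM('a) / 2) * exp (- C' * (?N + ?\<Phi>)) \<le> p t x y"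
    proof (cases "t \<le> 1")
      case True
      show ?thesis
      proof (rule goal)
        have "exp (- K * t) * heat t (y - x) \<le> p t x y" by (rule p_ge_heat[OF t])
        then show "?g * exp (- (K * t + ?N / 2)) \<le> p t x y"
          by (simp add: heat_def norm_minus_commute exp_diff exp_minus field_simps)
        have 1: "K * t \<le> K" using True K_nonneg by (simp add: mult_left_le)
        have 2: "?N \<le> C' * (?N + ?\<Phi>)"
        proof -
          have "1 * ?N \<le> C' * (?N + ?\<Phi>)" using D2 E2 N \<Phi> by (intro mult_mono) (auto simp: C'_def)
          then show ?thesis by simp
        qed
        have "?N / 2 \<le> ?N" using N by simp
        then have "K * t + ?N / 2 \<le> K + C' * (?N + ?\<Phi>)"
          by (intro add_mono[OF 1 order_trans[OF _ 2]])
        also have "\<dots> \<le> K + 1 + C' * (?N + ?\<Phi>)" by simp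
        finally show "K * t + ?N / 2 \<le> K + 1 + C' * (?N + ?\<Phi>)" .
      qed
    next
      case t1: False
      define s where "s = t powr (1 / \<gamma>)"
      have s: "1 \<le> s" using t1 \<alpha> by (auto simp: s_def intro!: ge_one_powr_ge_zero)
      have s\<gamma>: "s powr \<gamma> = t" using t \<alpha> by (simp add: s_def powr_powr)
      have far_enough: "t \<le> \<rho> powr \<gamma>" if "s \<le> \<rho>" for \<rho>
        unfolding s\<gamma>[symmetric] using that s \<alpha> by (intro powr_mono2) auto
      have two_scale: "t * \<rho> powr (- \<alpha>) \<le> 2 powr \<alpha> * ?\<Phi>" if \<rho>: "s \<le> \<rho>" "R \<le> \<rho>" for \<rho>
      proof -
        have "(2 * \<rho>) powr (- \<alpha>) \<le> (1 + R) powr (- \<alpha>)"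
          using \<rho> s R \<alpha> by (intro powr_mono2') auto
        then have "t * (2 * \<rho>) powr (- \<alpha>) \<le> t * (1 + R) powr (- \<alpha>)"
          using t by (intro mult_left_mono) auto
        also have "\<dots> = t / (1 + R) powr \<alpha>" by (simp add: powr_minus_divide)
        finally have "t * (2 * \<rho>) powr (- \<alpha>) \<le> t / (1 + R) powr \<alpha>" .
        moreover have "t * (2 * \<rho>) powr (- \<alpha>) \<le> t powr \<theta>"
        proof -
          have "(2 * \<rho>) powr (- \<alpha>) \<le> s powr (- \<alpha>)" using \<rho> s \<alpha> by (intro powr_mono2') auto
          then have "t * (2 * \<rho>) powr (- \<alpha>) \<le> t * s powr (- \<alpha>)" using t by simp
          then show ?thesis using time_times_scale_powr[OF t] by (simp add: s_def)
        qed
        ultimately have "t * (2 * \<rho>) powr (- \<alpha>) \<le> ?\<Phi>" by (simp add: \<Phi>_eq)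
        moreover have "(2 * \<rho>) powr (- \<alpha>) = 2 powr (- \<alpha>) * \<rho> powr (- \<alpha>)" using \<rho> s by (simp add: powr_mult)
        ultimately have "2 powr \<alpha> * (t * (2 powr (- \<alpha>) * \<rho> powr (- \<alpha>))) \<le> 2 powr \<alpha> * ?\<Phi>" by simp
        also have "2 powr \<alpha> * (t * (2 powr (- \<alpha>) * \<rho> powr (- \<alpha>))) = (2 powr \<alpha> * 2 powr (- \<alpha>)) * (t * \<rho> powr (- \<alpha>))"
          by (simp only: ac_simps)
        also have "2 powr \<alpha> * 2 powr (- \<alpha>) = 1" by (simp add: powr_minus)
        finally show ?thesis by simp
      qed
      show ?thesis
      proof (cases "s \<le> R \<and> norm (x - y) \<le> R / 2")
        case True
        have "?g * exp (- (norm (x - y) + 1 / 4)\<^sup>2 / (2 * t)) * exp (- (D * R powr (- \<alpha>) * t)) \<le> p t x y"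
        proof (rule p_lower_bound[OF t])
          have R_hyps: "1 \<le> R" "norm (x - y) \<le> R / 2" "t \<le> R powr \<gamma>" using True s far_enough[of R] by auto
          show "steerable t {x} f (?g * exp (- (norm (x - y) + 1 / 4)\<^sup>2 / (2 * t)) * \<mu>) (D * R powr (- \<alpha>) * t)"
            if "f \<in> borel_measurable borel" "0 \<le> \<mu>" "ennreal \<mu> \<le> (\<integral>\<^sup>+z. ennreal (f z) \<partial>lborel)"
              "\<And>z. f z \<noteq> 0 \<Longrightarrow> norm (z - y) \<le> 1 / 4" for f \<mu>
            using that by (intro direct[OF R_hyps(1) t R_hyps(3,2) R(4)])
        qed (use D t in auto)
        then have "?g * exp (- ((norm (x - y) + 1 / 4)\<^sup>2 / (2 * t) + D * R powr (- \<alpha>) * t)) \<le> p t x y"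
          by (simp only: mult.assoc exp_add[symmetric] minus_add_distrib minus_divide_left)
        then show ?thesis
        proof (rule goal)
          have "(norm (x - y) + 1 / 4)\<^sup>2 \<le> 2 * (norm (x - y))\<^sup>2 + 2"
            using zero_le_power2[of "norm (x - y) - 1 / 4"] by (simp add: power2_eq_square algebra_simps)
          then have "(norm (x - y) + 1 / 4)\<^sup>2 / (2 * t) \<le> (2 * (norm (x - y))\<^sup>2 + 2) / (2 * t)"
            using t by (intro divide_right_mono) auto
          also have "\<dots> = ?N + 1 / t" using t by (simp add: field_simps)
          also have "\<dots> \<le> ?N + 1" using t1 by simp
          finally have 1: "(norm (x - y) + 1 / 4)\<^sup>2 / (2 * t) \<le> ?N + 1" .
          have "D * R powr (- \<alpha>) * t = D * (t * R powr (- \<alpha>))" by simp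
          also have "\<dots> \<le> D * (2 powr \<alpha> * ?\<Phi>)" using D two_scale[of R] True by (intro mult_left_mono) auto
          finally have 2: "D * R powr (- \<alpha>) * t \<le> (2 powr \<alpha> * D) * ?\<Phi>" by (simp add: ac_simps)
          have "C' * (?N + ?\<Phi>) = ?N + ?\<Phi> + (2 powr \<alpha> * D) * ?N + (2 powr \<alpha> * D) * ?\<Phi> + (2 * E * (4 + 2 powr \<alpha>)) * (?N + ?\<Phi>)"
            by (simp only: C'_def distrib_right distrib_left mult_1_left add.assoc)
          moreover have "0 \<le> (2 powr \<alpha> * D) * ?N" "0 \<le> (2 * E * (4 + 2 powr \<alpha>)) * (?N + ?\<Phi>)"
            by (rule mult_nonneg_nonneg[OF D2 N], rule mult_nonneg_nonneg[OF E2 add_nonneg_nonneg[OF N \<Phi>]])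
          ultimately show "(norm (x - y) + 1 / 4)\<^sup>2 / (2 * t) + D * R powr (- \<alpha>) * t \<le> K + 1 + C' * (?N + ?\<Phi>)"
            using 1 2 \<Phi> K_nonneg by linarith
        qed
      next
        case False
        define \<rho> where "\<rho> = max R s"
        have \<rho>: "R \<le> \<rho>" "s \<le> \<rho>" "1 \<le> \<rho>" using s by (auto simp: \<rho>_def)
        have "(?g * exp (- (E * (\<rho>\<^sup>2 / t)))) * exp (- (E * (\<rho>\<^sup>2 / t))) \<le> p t x y"
        proof (rule p_lower_bound[OF t])
          show "steerable t {x} f (?g * exp (- (E * (\<rho>\<^sup>2 / t))) * \<mu>) (E * (\<rho>\<^sup>2 / t))"
            if "f \<in> borel_measurable borel" "0 \<le> \<mu>" "ennreal \<mu> \<le> (\<integral>\<^sup>+z. ennreal (f z) \<partial>lborel)"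
              "\<And>z. f z \<noteq> 0 \<Longrightarrow> norm (z - y) \<le> 1 / 4" for f \<mu>
            using detour[OF \<rho>(3) t far_enough[OF \<rho>(2)], of x y f \<mu>] that R \<rho> by (simp add: ac_simps)
        qed (use E t in auto)
        then have "?g * exp (- (2 * E * (\<rho>\<^sup>2 / t))) \<le> p t x y"
          by (simp add: mult.assoc exp_add[symmetric])
        then show ?thesis
        proof (rule goal)
          have "\<rho>\<^sup>2 / t \<le> (4 + 2 powr \<alpha>) * (?N + ?\<Phi>)"
          proof (cases "s \<le> R")
            case True
            then have "\<rho> = R" "R / 2 < norm (x - y)" using False by (auto simp: \<rho>_def)
            then have "R\<^sup>2 \<le> (2 * norm (x - y))\<^sup>2" using R by (intro power_mono) auto
            then have "\<rho>\<^sup>2 / t \<le> (2 * norm (x - y))\<^sup>2 / t" using t \<open>\<rho> = R\<close> by (intro divide_right_mono) auto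
            also have "\<dots> = 4 * ?N" by (simp add: power_mult_distrib)
            also have "\<dots> \<le> (4 + 2 powr \<alpha>) * (?N + ?\<Phi>)" using N \<Phi> by (intro mult_mono) auto
            finally show ?thesis .
          next
            case False
            then have "\<rho> = s" by (simp add: \<rho>_def)
            then have "\<rho>\<^sup>2 / t = t * s powr (- \<alpha>)"
              using scale_square_over_time[OF t] time_times_scale_powr[OF t] by (simp add: s_def)
            also have "\<dots> \<le> 2 powr \<alpha> * ?\<Phi>" using two_scale[of s] False by simp
            also have "\<dots> \<le> (4 + 2 powr \<alpha>) * (?N + ?\<Phi>)" using N \<Phi> by (intro mult_mono) auto
            finally show ?thesis .
          qed
          then have "2 * E * (\<rho>\<^sup>2 / t) \<le> (2 * E * (4 + 2 powr \<alpha>)) * (?N + ?\<Phi>)"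
            unfolding mult.assoc[of "2 * E"] using E by (intro mult_left_mono) auto
          also have "\<dots> \<le> C' * (?N + ?\<Phi>)"
            using D2 N \<Phi> by (intro mult_right_mono) (auto simp: C'_def)
          finally show "2 * E * (\<rho>\<^sup>2 / t) \<le> K + 1 + C' * (?N + ?\<Phi>)" using K_nonneg by linarith
        qed
      qed
    qed
  qed (use C C' in auto)
qed

end

theorem theorem1p3:
  fixes V :: "real ^ 'd \<Rightarrow> real"
    and \<alpha> K\<^sub>1 K\<^sub>2 :: real
    and P :: "real ^ 'd \<Rightarrow> 'w measure"
    and B :: "real \<Rightarrow> 'w \<Rightarrow> real ^ 'd"
    and p :: "real \<Rightarrow> real ^ 'd \<Rightarrow> real ^ 'd \<Rightarrow> real"
  assumes dim: "CARD('d) \<ge> 2"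
    and alpha: "0 < \<alpha>" "\<alpha> < 2"
    and K: "K\<^sub>1 > 0" "K\<^sub>2 > 0"
    and V_meas: "V \<in> borel_measurable borel"
    and V_locally_bounded: "\<And>S. compact S \<Longrightarrow> bounded (V ` S)"
    and V_bounds: "\<And>x. K\<^sub>1 * (1 + norm x) powr (- \<alpha>) \<le> V x"
                  "\<And>x. V x \<le> K\<^sub>2 * (1 + norm x) powr (- \<alpha>)"
    and brownian: "\<And>x. brownian_motion_from x (P x) B"
    and heat_kernel: "is_heat_kernel P B V p"
  shows "\<exists>C\<^sub>1>0. \<exists>C\<^sub>2>0. \<exists>C\<^sub>3>0. \<exists>C\<^sub>4>0. \<forall>x y. \<forall>t>0.
           C\<^sub>1 * t powr (- real CARD('d) / 2) *
             exp (- C\<^sub>2 * ((norm (x - y))\<^sup>2 / t + Phi \<alpha> t x y)) \<le> p t x y \<and>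
           p t x y \<le> C\<^sub>3 * t powr (- real CARD('d) / 2) *
             exp (- C\<^sub>4 * ((norm (x - y))\<^sup>2 / t + Phi \<alpha> t x y))"
proof -
  interpret slow_decay_heat_kernel V K\<^sub>2 \<alpha> P B p K\<^sub>1
  proof
    fix z
    show "0 \<le> V z" using V_bounds(1)[of z] K by (meson mult_nonneg_nonneg less_imp_le order_trans powr_ge_zero)
    have "(1 + norm z) powr (- \<alpha>) \<le> 1 powr (- \<alpha>)" using alpha by (intro powr_mono2') auto
    then have "K\<^sub>2 * (1 + norm z) powr (- \<alpha>) \<le> K\<^sub>2 * 1" using K by (intro mult_left_mono) auto
    then show "V z \<le> K\<^sub>2" using V_bounds(2)[of z] by simp
  qed (use assms in auto)
  have DIM: "DIM(real ^ 'd) = CARD('d)" by simp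
  obtain C\<^sub>1 C\<^sub>2 where lower: "0 < C\<^sub>1" "0 < C\<^sub>2" "\<forall>x y. \<forall>t>0.
      C\<^sub>1 * t powr (- real CARD('d) / 2) * exp (- C\<^sub>2 * ((norm (x - y))\<^sup>2 / t + Phi \<alpha> t x y)) \<le> p t x y"
    using heat_kernel_lower[unfolded DIM, OF dim] by blast
  obtain C\<^sub>3 C\<^sub>4 where upper: "0 < C\<^sub>3" "0 < C\<^sub>4" "\<forall>x y. \<forall>t>0.
      p t x y \<le> C\<^sub>3 * t powr (- real CARD('d) / 2) * exp (- C\<^sub>4 * ((norm (x - y))\<^sup>2 / t + Phi \<alpha> t x y))"
    using heat_kernel_upper[unfolded DIM] by blast
  show ?thesis
    by (rule exI[of _ C\<^sub>1], rule conjI[OF lower(1)], rule exI[of _ C\<^sub>2], rule conjI[OF lower(2)],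
        rule exI[of _ C\<^sub>3], rule conjI[OF upper(1)], rule exI[of _ C\<^sub>4], rule conjI[OF upper(2)])
      (use lower(3) upper(3) in blast)
qed

end
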